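(* Let $\tau\in\mathbb{H}$ and $\alpha,\beta,\gamma\in\mathbb{C}$ be such that none of $2\alpha$, $2\gamma-2\alpha$, $-2\beta$, $2\beta-2\gamma$ is an integer. Let $\iota:E\to E$, $\iota(u)=-u$. Then the involution $\iota^*:\Omega^1_E( *D)(E)\to\Omega^1_E( *D)(E)$ induces automorphisms $\iota^*:H^1(M;\mathcal{L})\to H^1(M;\mathcal{L})$ and $\iota^{*\vee}:H^1(M;\mathcal{L}^\vee)\to H^1(M;\mathcal{L}^\vee)$, and these cohomology groups decompose into eigenspaces $$H^1(M;\mathcal{L})=H^{(-1)}\oplus H^{(1)},\qquad H^1(M;\mathcal{L}^\vee)=H^{(-1)\vee}\oplus H^{(1)\vee},$$ where $H^{(\pm1)}=\{[\varphi]\in H^1(M;\mathcal{L})\mid\iota^*[\varphi]=\pm[\varphi]\}$ and $H^{(\pm1)\vee}=\{[\varphi]\in H^1(M;\mathcal{L}^\vee)\mid\iota^{*\vee}[\varphi]=\pm[\varphi]\}$. The classes $[\phi_1],[\phi_2]$ form a basis of $H^{(-1)}$ and (as classes in $H^1(M;\mathcal{L}^\vee)$) a basis of $H^{(-1)\vee}$; the classes $[\phi_3],[\phi_4]$ form a basis of $H^{(1)}$ and a basis of $H^{(1)\vee}$. Further, $H^{(\pm1)}$ and $H^{(\mp1)\vee}$ are orthogonal to each other with respect to the intersection form $\langle\cdot,\cdot\rangle_{\mathrm{ch}}$ (i.e. $H^{(1)}\perp H^{(-1)\vee}$ and $H^{(-1)}\perp H^{(1)\vee}$).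
   Context: Theta functions: with $\mathbf{e}(x)=e^{2\pi\sqrt{-1}x}$ and fixed $\tau\in\mathbb{H}$ (upper half plane), $\vartheta_1(u)=-\sum_{m\in\mathbb{Z}}\mathbf{e}(\frac12(m+\frac12)^2\tau+(m+\frac12)(u+\frac12))$, $\vartheta_2(u)=\sum_{m}\mathbf{e}(\frac12(m+\frac12)^2\tau+(m+\frac12)u)$, $\vartheta_3(u)=\sum_m\mathbf{e}(\frac12m^2\tau+mu)$, $\vartheta_4(u)=\sum_m\mathbf{e}(\frac12m^2\tau+m(u+\frac12))$. Space and local systems: $E=\mathbb{C}/(\mathbb{Z}+\mathbb{Z}\tau)$, $D=\{0,\frac12,\frac{1+\tau}2,\frac\tau2\}\subset E$, $M=E\setminus D$ (note $\iota(D)=D$). $T(u)=\vartheta_1(u)^{2\alpha}\vartheta_2(u)^{2\gamma-2\alpha}\vartheta_3(u)^{-2\beta}\vartheta_4(u)^{2\beta-2\gamma}$ (multivalued), $\omega=d\log T(u)$, a meromorphic $1$-form on $E$. $\mathcal{L}=\mathbb{C}T(u)^{-1}$ and $\mathcal{L}^\vee=\mathbb{C}T(u)$ are the local systems on $M$ defined by $T^{-1}$ and $T$. Twisted cohomology: let $\mathcal{O}_E( *D)(E)$ and $\Omega^1_E( *D)(E)$ be the spaces of functions, resp. $1$-forms, meromorphic on $E$ and holomorphic on $M$. Put $\nabla f=df+f\omega$, $\nabla^\vee f=df-f\omega$. One identifies $H^1(M;\mathcal{L})=\Omega^1_E( *D)(E)/\nabla(\mathcal{O}_E( *D)(E))$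 and $H^1(M;\mathcal{L}^\vee)=\Omega^1_E( *D)(E)/\nabla^\vee(\mathcal{O}_E( *D)(E))$ (both are 4-dimensional). Cohomology intersection form: $\langle[\varphi],[\psi]\rangle_{\mathrm{ch}}=\int_M\varphi_{\mathrm c}\wedge\psi$ for $[\varphi]\in H^1(M;\mathcal{L})$, $[\psi]\in H^1(M;\mathcal{L}^\vee)$, where $\varphi_{\mathrm c}$ is a smooth compactly supported $\nabla$-closed form representing the image of $[\varphi]$ under the inverse of the natural isomorphism $H^1_{\mathrm c}(M;\mathcal{L})\to H^1(M;\mathcal{L})$. Equivalently, $\langle[\varphi],[\psi]\rangle_{\mathrm{ch}}=2\pi\sqrt{-1}\sum_{p\in D}\operatorname{Res}_p(f_p\psi)$, where $f_p$ is the unique germ of meromorphic function at $p$ with $\nabla f_p=\varphi$ near $p$. Cocycles: $\phi_1=\pi\vartheta_3(0)^2du$, $\phi_2=\pi\vartheta_2(0)^2\frac{\vartheta_4(u)^2}{\vartheta_1(u)^2}du$, $\phi_3=\pi\vartheta_2(0)^2\frac{\vartheta_3(u)\vartheta_4(u)}{\vartheta_1(u)\vartheta_2(u)}du=d\log\frac{\vartheta_2(u)}{\vartheta_1(u)}$, $\phi_4=\pi\vartheta_3(0)^2\frac{\vartheta_2(u)\vartheta_4(u)}{\vartheta_1(u)\vartheta_3(u)}du=d\log\frac{\vartheta_3(u)}{\vartheta_1(u)}$. *)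

theory Defs
  imports "HOL-Complex_Analysis.Complex_Analysis" "HOL-Algebra.AbelCoset" "Jordan_Normal_Form.VS_Connect"
begin

section \<open>Theta functions\<close>

definition ee :: "complex \<Rightarrow> complex" where
  "ee x = exp (2 * of_real pi * \<i> * x)"

definition theta1 :: "complex \<Rightarrow> complex \<Rightarrow> complex" where
  "theta1 \<tau> u = - (\<Sum>\<^sub>\<infinity>m\<in>(UNIV::int set).
     ee (1/2 * (of_int m + 1/2)^2 * \<tau> + (of_int m + 1/2) * (u + 1/2)))"

definition theta2 :: "complex \<Rightarrow> complex \<Rightarrow> complex" where
  "theta2 \<tau> u = (\<Sum>\<^sub>\<infinity>m\<in>(UNIV::int set).
     ee (1/2 * (of_int m + 1/2)^2 * \<tau> + (of_int m + 1/2) * u))"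

definition theta3 :: "complex \<Rightarrow> complex \<Rightarrow> complex" where
  "theta3 \<tau> u = (\<Sum>\<^sub>\<infinity>m\<in>(UNIV::int set).
     ee (1/2 * (of_int m)^2 * \<tau> + of_int m * u))"

definition theta4 :: "complex \<Rightarrow> complex \<Rightarrow> complex" where
  "theta4 \<tau> u = (\<Sum>\<^sub>\<infinity>m\<in>(UNIV::int set).
     ee (1/2 * (of_int m)^2 * \<tau> + of_int m * (u + 1/2)))"

section \<open>Meromorphic functions and 1-forms on the elliptic curve\<close>

text \<open>
  Points of \<open>E = \<complex> / (\<int> + \<int>\<tau>)\<close> are handled through the coordinate \<open>u\<close> on \<open>\<complex>\<close>: \<open>D_reps \<tau>\<close> consists of
  representatives of the four points of \<open>D\<close>, and \<open>D_lift \<tau>\<close> is the preimage of \<open>D\<close> in \<open>\<complex>\<close>, so that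
  \<open>- D_lift \<tau>\<close> is the preimage of \<open>M = E \<setminus> D\<close>.
\<close>

definition D_reps :: "complex \<Rightarrow> complex set" where
  "D_reps \<tau> = {0, 1/2, (1 + \<tau>)/2, \<tau>/2}"

definition D_lift :: "complex \<Rightarrow> complex set" where
  "D_lift \<tau> = {p + of_int m + of_int n * \<tau> | p m n. p \<in> D_reps \<tau>}"

text \<open>
  Functions on \<open>M\<close> are doubly periodic functions on \<open>- D_lift \<tau>\<close>. To have a unique HOL function for each
  of them, they are extended by \<open>0\<close> to \<open>D_lift \<tau>\<close>; this value carries no information, poles included.
\<close>

definition on_M :: "complex \<Rightarrow> (complex \<Rightarrow> complex) \<Rightarrow> (complex \<Rightarrow> complex)" where
  "on_M \<tau> f = (\<lambda>u. if u \<in> D_lift \<tau> then 0 else f u)"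

text \<open>\<open>O_E(*D)(E)\<close>:\<close>

definition mero_functions :: "complex \<Rightarrow> (complex \<Rightarrow> complex) set" where
  "mero_functions \<tau> = {f. f holomorphic_on (- D_lift \<tau>) \<and> f meromorphic_on (D_lift \<tau>) \<and>
     (\<forall>u. f (u + 1) = f u \<and> f (u + \<tau>) = f u) \<and> (\<forall>u\<in>D_lift \<tau>. f u = 0)}"

text \<open>
  \<open>\<Omega>\<^sup>1_E(*D)(E)\<close> as a vector space over \<open>\<complex>\<close>. Since \<open>du\<close> is a nowhere vanishing holomorphic 1-form on \<open>E\<close>,
  every form is \<open>g du\<close> for a unique \<open>g\<close> in \<open>O_E(*D)(E)\<close>; all 1-forms below are represented by this
  coefficient \<open>g\<close>. The ring fields \<open>mult\<close> and \<open>one\<close> of the record play no role.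
\<close>

definition mero_forms :: "complex \<Rightarrow> (complex, complex \<Rightarrow> complex) module" where
  "mero_forms \<tau> = \<lparr>carrier = mero_functions \<tau>, mult = (\<lambda>_ _ _. 0), one = (\<lambda>_. 0), zero = (\<lambda>_. 0),
     add = (\<lambda>f g u. f u + g u), smult = (\<lambda>c f u. c * f u)\<rparr>"

text \<open>The pullback of \<open>g(u) du\<close> under \<open>u \<mapsto> -u\<close> is \<open>g(-u) d(-u) = - g(-u) du\<close>.\<close>

definition iota_pullback :: "(complex \<Rightarrow> complex) \<Rightarrow> (complex \<Rightarrow> complex)" where
  "iota_pullback g = (\<lambda>u. - g (- u))"

section \<open>Linear algebra\<close>

definition quot_module :: "('a, 'b) module \<Rightarrow> 'b set \<Rightarrow> ('a, 'b set) module" where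
  "quot_module V N = \<lparr>carrier = a_rcosets\<^bsub>V\<^esub> N, mult = (\<lambda>_ _. N), one = N, zero = N,
     add = (\<lambda>A B. A <+>\<^bsub>V\<^esub> B),
     smult = (\<lambda>c A. N <+>\<^bsub>V\<^esub> ((\<lambda>a. c \<odot>\<^bsub>V\<^esub> a) ` A))\<rparr>"

definition eigenspace :: "(complex, 'b) module \<Rightarrow> ('b \<Rightarrow> 'b) \<Rightarrow> complex \<Rightarrow> 'b set" where
  "eigenspace V F c = {x \<in> carrier V. F x = c \<odot>\<^bsub>V\<^esub> x}"

definition is_direct_sum :: "(complex, 'b) module \<Rightarrow> 'b set \<Rightarrow> 'b set \<Rightarrow> bool" where
  "is_direct_sum V W1 W2 \<longleftrightarrow>
     VectorSpace.subspace class_ring W1 V \<and> VectorSpace.subspace class_ring W2 V \<and>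
     module.submodule_sum V W1 W2 = carrier V \<and> W1 \<inter> W2 = {\<zero>\<^bsub>V\<^esub>}"

text \<open>\<open>x, y\<close> form a basis of the subspace \<open>W\<close> of \<open>V\<close>; distinctness is required because the
  library's notion of a basis is about sets.\<close>

definition is_basis2 :: "(complex, 'b) module \<Rightarrow> 'b set \<Rightarrow> 'b \<Rightarrow> 'b \<Rightarrow> bool" where
  "is_basis2 V W x y \<longleftrightarrow> x \<noteq> y \<and>
     vectorspace.basis class_ring (V\<lparr>carrier := W\<rparr>) {x, y}"

text \<open>
  A self-map \<open>f\<close> of \<open>V\<close> inducing an automorphism of \<open>V/N\<close>: the coset of \<open>v\<close> goes to the coset of \<open>f v\<close>.
  The induced map is taking direct images of cosets.
\<close>

definition induces_automorphism :: "(complex, 'b) module \<Rightarrow> 'b set \<Rightarrow> ('b \<Rightarrow> 'b) \<Rightarrow> bool" where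
  "induces_automorphism V N f \<longleftrightarrow>
     (\<forall>v\<in>carrier V. f ` (N +>\<^bsub>V\<^esub> v) = N +>\<^bsub>V\<^esub> f v) \<and>
     linear_map class_ring (quot_module V N) (quot_module V N) ((`) f) \<and>
     bij_betw ((`) f) (carrier (quot_module V N)) (carrier (quot_module V N))"

section \<open>Twisted cohomology\<close>

text \<open>
  The coefficient of \<open>\<omega> = d log T(u)\<close> for
  \<open>T = \<theta>\<^sub>1\<^bsup>2\<alpha>\<^esup> \<theta>\<^sub>2\<^bsup>2\<gamma>-2\<alpha>\<^esup> \<theta>\<^sub>3\<^bsup>-2\<beta>\<^esup> \<theta>\<^sub>4\<^bsup>2\<beta>-2\<gamma>\<^esup>\<close>: although \<open>T\<close> is multivalued, its logarithmic derivative is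
  single-valued. The values of \<open>omega\<close> on \<open>D_lift \<tau>\<close> are irrelevant.
\<close>

definition omega :: "complex \<Rightarrow> complex \<Rightarrow> complex \<Rightarrow> complex \<Rightarrow> complex \<Rightarrow> complex" where
  "omega \<tau> \<alpha> \<beta> \<gamma> u =
     2 * \<alpha> * (deriv (theta1 \<tau>) u / theta1 \<tau> u) +
     (2 * \<gamma> - 2 * \<alpha>) * (deriv (theta2 \<tau>) u / theta2 \<tau> u) +
     (- 2 * \<beta>) * (deriv (theta3 \<tau>) u / theta3 \<tau> u) +
     (2 * \<beta> - 2 * \<gamma>) * (deriv (theta4 \<tau>) u / theta4 \<tau> u)"

definition nabla :: "complex \<Rightarrow> complex \<Rightarrow> complex \<Rightarrow> complex \<Rightarrow> (complex \<Rightarrow> complex) \<Rightarrow> (complex \<Rightarrow> complex)" where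
  "nabla \<tau> \<alpha> \<beta> \<gamma> f = on_M \<tau> (\<lambda>u. deriv f u + f u * omega \<tau> \<alpha> \<beta> \<gamma> u)"

definition nabla_dual :: "complex \<Rightarrow> complex \<Rightarrow> complex \<Rightarrow> complex \<Rightarrow> (complex \<Rightarrow> complex) \<Rightarrow> (complex \<Rightarrow> complex)" where
  "nabla_dual \<tau> \<alpha> \<beta> \<gamma> f = on_M \<tau> (\<lambda>u. deriv f u - f u * omega \<tau> \<alpha> \<beta> \<gamma> u)"

definition exact_forms :: "complex \<Rightarrow> complex \<Rightarrow> complex \<Rightarrow> complex \<Rightarrow> (complex \<Rightarrow> complex) set" where
  "exact_forms \<tau> \<alpha> \<beta> \<gamma> = nabla \<tau> \<alpha> \<beta> \<gamma> ` mero_functions \<tau>"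

definition exact_forms_dual :: "complex \<Rightarrow> complex \<Rightarrow> complex \<Rightarrow> complex \<Rightarrow> (complex \<Rightarrow> complex) set" where
  "exact_forms_dual \<tau> \<alpha> \<beta> \<gamma> = nabla_dual \<tau> \<alpha> \<beta> \<gamma> ` mero_functions \<tau>"

text \<open>\<open>H\<^sup>1(M; L)\<close> and \<open>H\<^sup>1(M; L\<^sup>\<or>)\<close>, and the classes of a form in them:\<close>

definition H1 :: "complex \<Rightarrow> complex \<Rightarrow> complex \<Rightarrow> complex \<Rightarrow> (complex, (complex \<Rightarrow> complex) set) module" where
  "H1 \<tau> \<alpha> \<beta> \<gamma> = quot_module (mero_forms \<tau>) (exact_forms \<tau> \<alpha> \<beta> \<gamma>)"

definition H1_dual :: "complex \<Rightarrow> complex \<Rightarrow> complex \<Rightarrow> complex \<Rightarrow> (complex, (complex \<Rightarrow> complex) set) module" where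
  "H1_dual \<tau> \<alpha> \<beta> \<gamma> = quot_module (mero_forms \<tau>) (exact_forms_dual \<tau> \<alpha> \<beta> \<gamma>)"

definition cls :: "complex \<Rightarrow> complex \<Rightarrow> complex \<Rightarrow> complex \<Rightarrow> (complex \<Rightarrow> complex) \<Rightarrow> (complex \<Rightarrow> complex) set" where
  "cls \<tau> \<alpha> \<beta> \<gamma> \<phi> = exact_forms \<tau> \<alpha> \<beta> \<gamma> +>\<^bsub>mero_forms \<tau>\<^esub> \<phi>"

definition cls_dual :: "complex \<Rightarrow> complex \<Rightarrow> complex \<Rightarrow> complex \<Rightarrow> (complex \<Rightarrow> complex) \<Rightarrow> (complex \<Rightarrow> complex) set" where
  "cls_dual \<tau> \<alpha> \<beta> \<gamma> \<phi> = exact_forms_dual \<tau> \<alpha> \<beta> \<gamma> +>\<^bsub>mero_forms \<tau>\<^esub> \<phi>"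

definition H1_eig :: "complex \<Rightarrow> complex \<Rightarrow> complex \<Rightarrow> complex \<Rightarrow> complex \<Rightarrow> (complex \<Rightarrow> complex) set set" where
  "H1_eig \<tau> \<alpha> \<beta> \<gamma> s = eigenspace (H1 \<tau> \<alpha> \<beta> \<gamma>) ((`) iota_pullback) s"

definition H1_dual_eig :: "complex \<Rightarrow> complex \<Rightarrow> complex \<Rightarrow> complex \<Rightarrow> complex \<Rightarrow> (complex \<Rightarrow> complex) set set" where
  "H1_dual_eig \<tau> \<alpha> \<beta> \<gamma> s = eigenspace (H1_dual \<tau> \<alpha> \<beta> \<gamma>) ((`) iota_pullback) s"

section \<open>The cohomology intersection form\<close>

text \<open>\<open>f\<close> is a germ at \<open>p\<close> of a meromorphic function with \<open>\<nabla>f = \<phi>\<close> near \<open>p\<close>.\<close>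

definition local_solution ::
  "complex \<Rightarrow> complex \<Rightarrow> complex \<Rightarrow> complex \<Rightarrow> (complex \<Rightarrow> complex) \<Rightarrow> complex \<Rightarrow> (complex \<Rightarrow> complex) \<Rightarrow> bool" where
  "local_solution \<tau> \<alpha> \<beta> \<gamma> \<phi> p f \<longleftrightarrow> f meromorphic_on {p} \<and>
     (\<forall>\<^sub>F u in at p. deriv f u + f u * omega \<tau> \<alpha> \<beta> \<gamma> u = \<phi> u)"

text \<open>
  The intersection number of two forms, \<open>2\<pi>\<i> \<Sum>\<^bsub>p\<in>D\<^esub> Res\<^sub>p(f\<^sub>p \<psi>)\<close>. Germs are unique but functions
  representing them are not, hence \<open>SOME\<close>; the residue only depends on the germ.
\<close>

definition intersection_number ::
  "complex \<Rightarrow> complex \<Rightarrow> complex \<Rightarrow> complex \<Rightarrow> (complex \<Rightarrow> complex) \<Rightarrow> (complex \<Rightarrow> complex) \<Rightarrow> complex" where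
  "intersection_number \<tau> \<alpha> \<beta> \<gamma> \<phi> \<psi> = 2 * of_real pi * \<i> *
     (\<Sum>p\<in>D_reps \<tau>. residue (\<lambda>u. (SOME f. local_solution \<tau> \<alpha> \<beta> \<gamma> \<phi> p f) u * \<psi> u) p)"

text \<open>The pairing of two classes is the common value on all representatives.\<close>

definition ch_form ::
  "complex \<Rightarrow> complex \<Rightarrow> complex \<Rightarrow> complex \<Rightarrow> (complex \<Rightarrow> complex) set \<Rightarrow> (complex \<Rightarrow> complex) set \<Rightarrow> complex" where
  "ch_form \<tau> \<alpha> \<beta> \<gamma> A B = (THE c. \<forall>\<phi>\<in>A. \<forall>\<psi>\<in>B. intersection_number \<tau> \<alpha> \<beta> \<gamma> \<phi> \<psi> = c)"

section \<open>The four cocycles\<close>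

definition phi1 :: "complex \<Rightarrow> complex \<Rightarrow> complex" where
  "phi1 \<tau> = on_M \<tau> (\<lambda>u. of_real pi * (theta3 \<tau> 0)^2)"

definition phi2 :: "complex \<Rightarrow> complex \<Rightarrow> complex" where
  "phi2 \<tau> = on_M \<tau> (\<lambda>u. of_real pi * (theta2 \<tau> 0)^2 * ((theta4 \<tau> u)^2 / (theta1 \<tau> u)^2))"

definition phi3 :: "complex \<Rightarrow> complex \<Rightarrow> complex" where
  "phi3 \<tau> = on_M \<tau> (\<lambda>u. of_real pi * (theta2 \<tau> 0)^2 *
     ((theta3 \<tau> u * theta4 \<tau> u) / (theta1 \<tau> u * theta2 \<tau> u)))"

definition phi4 :: "complex \<Rightarrow> complex \<Rightarrow> complex" where
  "phi4 \<tau> = on_M \<tau> (\<lambda>u. of_real pi * (theta3 \<tau> 0)^2 *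
     ((theta2 \<tau> u * theta4 \<tau> u) / (theta1 \<tau> u * theta3 \<tau> u)))"

end

theory Submission
  imports Defs
begin

text \<open>
  A form \<open>g du\<close> is pulled back by \<open>\<iota>\<close> to \<open>- g(- u) du\<close>, so forms with even coefficients have
  eigenvalue \<open>-1\<close> and forms with odd coefficients eigenvalue \<open>1\<close>. The coefficient of \<open>\<omega>\<close> is odd.
  Therefore \<open>\<iota>\<^sup>*\<close> maps exact forms to exact forms and acts on the quotient as a linear involution, and
  a linear involution always splits a complex vector space into its eigenspaces for \<open>\<plusminus>1\<close>. The
  coefficients of \<open>\<phi>\<^sub>1, \<phi>\<^sub>2\<close> are even and those of \<open>\<phi>\<^sub>3, \<phi>\<^sub>4\<close> are odd. Once the four classes are known
  to form a basis of the cohomology, each pair is a basis of its eigenspace. The dual connection is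
  \<open>\<nabla>\<close> for the parameters \<open>- \<alpha>, - \<beta>, - \<gamma>\<close>, which satisfy the same hypotheses, so the dual statements
  come for free.

  That the four classes are a basis (\<open>twisted_cohomology_span\<close>, \<open>twisted_cohomology_independent\<close>) is
  a matter of pole orders. The form \<open>\<omega>\<close> has simple poles at the points of \<open>D\<close>, with the residues \<open>2\<alpha>,
  2\<gamma> - 2\<alpha>, - 2\<beta>, 2\<beta> - 2\<gamma>\<close>. If \<open>f\<close> has a pole of order \<open>k\<close> at \<open>p\<close> (or, for \<open>k = 0\<close>, a finite nonzero
  value), the leading coefficient of \<open>\<nabla>f\<close> is that of \<open>f\<close> times the residue minus \<open>k\<close>, so for
  nonintegral residues \<open>\<nabla>\<close> raises the pole order by exactly one. Exact forms thus remove all poles of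
  order above \<open>2\<close> and most of the remaining principal parts; the four cocycles remove what is left, by
  the residue theorem and because a doubly periodic function without poles is constant. Conversely, if
  \<open>\<nabla>f\<close> is a combination of the cocycles, then \<open>f\<close> has at most a simple pole at \<open>0\<close>, hence no pole by
  the residue theorem, so it is constant, and it is \<open>0\<close> because the cocycles are holomorphic at \<open>\<tau>/2\<close>.

  The doubly periodic functions that this requires are made from \<open>\<zeta> = \<theta>\<^sub>1'/\<theta>\<^sub>1\<close>, whose translates
  differ by functions on the curve and whose derivatives are functions on the curve. It also gives the
  residue theorem (\<open>sum_residues_eq_0\<close>): a function with simple poles minus its residues times
  translates of \<open>\<zeta>\<close> is entire with a doubly periodic derivative, hence affine, and having period \<open>1\<close>
  it is constant; but under translation by \<open>\<tau>\<close> it gains \<open>2\<pi>\<i>\<close> times the sum of the residues. All this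
  depends on the zeros of the theta functions and on their simplicity; these are read off from an
  infinite product that is proportional to \<open>\<theta>\<^sub>3\<close> (\<open>theta3_conv_theta_prod\<close>).

  For the orthogonality, the points of \<open>D\<close> are half-periods, so \<open>\<iota>\<close> induces the reflection \<open>u \<mapsto> 2p -
  u\<close> near each of them. As the residues of \<open>\<omega>\<close> are not integers, the local equation \<open>\<nabla>f\<^sub>p = \<phi>\<close> has a
  unique meromorphic solution, and uniqueness makes its parity opposite to that of the coefficient of
  \<open>\<phi>\<close> (\<open>local_solution_reflect\<close>). When the coefficients of \<open>\<phi>\<close> and \<open>\<psi>\<close> have opposite parities, \<open>f\<^sub>p \<psi>\<close>
  is even about \<open>p\<close> and has residue \<open>0\<close>. Other representatives of the two classes change the sum of
  residues by residues of derivatives and of global functions, that is, by \<open>0\<close>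
  (\<open>intersection_number_opposite_parity\<close>).
\<close>

section \<open>Theta series\<close>

lemma ee_add: "ee (x + y) = ee x * ee y"
  by (simp add: ee_def distrib_left exp_add)

lemma ee_0 [simp]: "ee 0 = 1"
  by (simp add: ee_def)

lemma ee_nonzero [simp]: "ee x \<noteq> 0"
  by (simp add: ee_def)

lemma ee_minus: "ee (- x) = inverse (ee x)"
  by (simp add: ee_def exp_minus)

lemma ee_of_int [simp]: "ee (of_int n) = 1"
proof -
  have "ee (of_int n) = exp (2 * of_int n * of_real pi * \<i>)"
    by (simp add: ee_def mult_ac)
  thus ?thesis using exp_integer_2pi[of "of_int n"] by simp
qed

lemma ee_eq_1_iff: "ee x = 1 \<longleftrightarrow> x \<in> \<int>"
proof
  assume "ee x = 1"
  then obtain n :: int where n: "2 * of_real pi * \<i> * x = of_int (2 * n) * of_real pi * \<i>"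
    unfolding ee_def complex_eq_iff using exp_eq_1[of "2 * of_real pi * \<i> * x"]
    by (auto simp: ee_def complex_eq_iff)
  hence "x = of_int n" by simp
  thus "x \<in> \<int>" by simp
qed (auto elim: Ints_cases)

lemma ee_half: "ee (1/2) = -1"
proof -
  have "ee (1/2) = exp (\<i> * of_real pi)" by (simp add: ee_def mult_ac)
  thus ?thesis by simp
qed

lemma norm_ee: "norm (ee x) = exp (- 2 * pi * Im x)"
  by (simp add: ee_def)

lemma ee_has_field_derivative: "(ee has_field_derivative 2 * of_real pi * \<i> * ee x) (at x within A)"
  unfolding ee_def by (auto intro!: derivative_eq_intros)

lemma ee_holomorphic [holomorphic_intros]:
  "f holomorphic_on A \<Longrightarrow> (\<lambda>x. ee (f x)) holomorphic_on A"
  unfolding ee_def by (intro holomorphic_intros) auto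

definition theta_term :: "complex \<Rightarrow> complex \<Rightarrow> int \<Rightarrow> complex" where
  "theta_term \<tau> u m = ee (1/2 * (of_int m)^2 * \<tau> + of_int m * u)"

text \<open>
  The exponent is at most \<open>- \<pi> Im \<tau> m\<^sup>2 + 2\<pi>R\<bar>m\<bar>\<close>, and completing the square bounds this by \<open>K - \<bar>m\<bar>\<close>.
  Hence on every horizontal strip the series is dominated by a geometric one.
\<close>
lemma norm_theta_term_le:
  assumes "Im \<tau> > 0" and "\<bar>Im u\<bar> \<le> R"
  defines "K \<equiv> (2 * pi * R + 1)\<^sup>2 / (4 * pi * Im \<tau>)"
  shows "norm (theta_term \<tau> u m) \<le> exp K * exp (-1) ^ nat \<bar>m\<bar>"
proof -
  define x where "x = \<bar>real_of_int m\<bar>"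
  have x2: "x\<^sup>2 = (of_int m)\<^sup>2" "x \<ge> 0" by (auto simp: x_def)
  have "norm (theta_term \<tau> u m) = exp (- 2 * pi * (1/2 * x\<^sup>2 * Im \<tau> + of_int m * Im u))"
    by (simp add: theta_term_def norm_ee x2 Re_power2 flip: of_int_power)
  also have "- 2 * pi * (1/2 * x\<^sup>2 * Im \<tau> + of_int m * Im u) \<le> K - x"
  proof -
    have "- (of_int m * Im u) \<le> x * R"
    proof -
      have "- (of_int m * Im u) \<le> \<bar>of_int m * Im u\<bar>" by linarith
      also have "\<dots> = x * \<bar>Im u\<bar>" by (simp add: x_def abs_mult)
      also have "\<dots> \<le> x * R" using assms(2) x2(2) by (intro mult_left_mono)
      finally show ?thesis .
    qed
    hence 1: "2 * pi * (- (of_int m * Im u)) \<le> 2 * pi * (x * R)"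
      by (intro mult_left_mono) auto
    define t where "t = pi * Im \<tau>"
    have t: "t > 0" using assms(1) by (simp add: t_def)
    \<comment> \<open>the summand \<open>1\<close> pays for the decay \<open>exp (- x)\<close>; \<open>K\<close> is the maximum of the quadratic \<open>b x - t x\<^sup>2\<close>\<close>
    define b where "b = 2 * pi * R + 1"
    have "0 \<le> (2 * t * x - b)\<^sup>2" by simp
    hence "4 * t * (b * x - t * x\<^sup>2) \<le> b\<^sup>2" by (simp add: power2_eq_square algebra_simps)
    hence "b * x - t * x\<^sup>2 \<le> b\<^sup>2 / (4 * t)" using t by (simp add: field_simps)
    hence 2: "b * x - t * x\<^sup>2 \<le> K" by (simp add: K_def b_def t_def mult_ac)
    have "- 2 * pi * (1/2 * x\<^sup>2 * Im \<tau> + of_int m * Im u) = 2 * pi * (- (of_int m * Im u)) - t * x\<^sup>2"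
      by (simp add: t_def algebra_simps)
    also have "\<dots> \<le> K - x" using 1 2 by (simp add: b_def algebra_simps)
    finally show ?thesis .
  qed
  also have "exp (K - x) = exp K * exp (-1) ^ nat \<bar>m\<bar>"
    by (simp add: exp_diff x_def exp_minus field_simps flip: exp_of_nat_mult)
  finally show ?thesis by simp
qed

lemma summable_on_int_geometric:
  fixes r :: real assumes "0 \<le> r" "r < 1"
  shows "(\<lambda>m::int. r ^ nat \<bar>m\<bar>) summable_on UNIV"
proof -
  have nat: "(\<lambda>n::nat. r ^ n) summable_on UNIV"
    using assms by (intro norm_summable_imp_summable_on) (auto simp: summable_geometric)
  have 1: "(\<lambda>m::int. r ^ nat \<bar>m\<bar>) summable_on (range int)"
    using nat by (subst summable_on_reindex) (auto simp: o_def)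
  have 2: "(\<lambda>m::int. r ^ nat \<bar>m\<bar>) summable_on (range (\<lambda>n. - int n))"
    using nat by (subst summable_on_reindex) (auto simp: o_def inj_def)
  have "range int \<union> range (\<lambda>n. - int n) = UNIV"
    by (auto simp: image_iff) (metis int_nat_eq nat_int minus_minus linorder_linear neg_0_le_iff_le nat_0_le)
  with summable_on_union[OF 1 2] show ?thesis by simp
qed

lemma theta3_alt: "theta3 \<tau> u = (\<Sum>\<^sub>\<infinity>m. theta_term \<tau> u m)"
  by (simp add: theta3_def theta_term_def)

text \<open>
  Uniformity on strips serves twice: on discs it makes the sum holomorphic, and on \<open>[0, 1]\<close> it permits
  integration term by term.
\<close>
lemma theta3_uniform_limit:
  assumes "Im \<tau> > 0"
  shows "uniform_limit {u. \<bar>Im u\<bar> \<le> R} (\<lambda>X u. \<Sum>m\<in>X. theta_term \<tau> u m) (theta3 \<tau>)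
           (finite_subsets_at_top UNIV)"
  unfolding theta3_alt [abs_def]
proof (rule Weierstrass_m_test_general)
  show "(\<lambda>m. exp ((2 * pi * R + 1)\<^sup>2 / (4 * pi * Im \<tau>)) * exp (-1) ^ nat \<bar>m::int\<bar>) summable_on UNIV"
    by (intro summable_on_cmult_right summable_on_int_geometric) auto
qed (use norm_theta_term_le[OF assms] in auto)

lemma theta3_holomorphic:
  assumes "Im \<tau> > 0"
  shows "theta3 \<tau> holomorphic_on A"
proof (rule holomorphic_on_subset)
  have "theta3 \<tau> analytic_on UNIV"
  proof (subst analytic_on_analytic_at, intro ballI)
    fix z :: complex
    have "uniform_limit (cball z 1) (\<lambda>X u. \<Sum>m\<in>X. theta_term \<tau> u m) (theta3 \<tau>)
             (finite_subsets_at_top UNIV)"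
    proof (rule uniform_limit_on_subset[OF theta3_uniform_limit[OF assms, of "\<bar>Im z\<bar> + 1"]])
      show "cball z 1 \<subseteq> {u. \<bar>Im u\<bar> \<le> \<bar>Im z\<bar> + 1}"
      proof
        fix u assume "u \<in> cball z 1"
        hence "\<bar>Im (u - z)\<bar> \<le> 1" using abs_Im_le_cmod[of "u - z"] by (simp add: dist_norm norm_minus_commute)
        thus "u \<in> {u. \<bar>Im u\<bar> \<le> \<bar>Im z\<bar> + 1}" by simp
      qed
    qed
    moreover have "\<forall>\<^sub>F X in finite_subsets_at_top UNIV. continuous_on (cball z 1) (\<lambda>u. \<Sum>m\<in>X. theta_term \<tau> u m) \<and>
        (\<lambda>u. \<Sum>m\<in>X. theta_term \<tau> u m) holomorphic_on ball z 1"
      unfolding theta_term_def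
      by (intro always_eventually allI conjI holomorphic_on_imp_continuous_on holomorphic_intros)
    ultimately have "theta3 \<tau> holomorphic_on ball z 1"
      using holomorphic_uniform_limit[where F = "finite_subsets_at_top (UNIV :: int set)" and z = z and r = 1]
      by (meson finite_subsets_at_top_neq_bot)
    thus "theta3 \<tau> analytic_on {z}"
      by (auto simp: analytic_at intro!: exI[of _ "ball z 1"])
  qed
  thus "theta3 \<tau> holomorphic_on UNIV" by (rule analytic_imp_holomorphic)
qed auto

lemma theta3_add_1: "theta3 \<tau> (u + 1) = theta3 \<tau> u"
proof -
  have "theta_term \<tau> (u + 1) m = theta_term \<tau> u m" for m
    by (simp add: theta_term_def distrib_left ee_add)
  thus ?thesis by (simp add: theta3_alt)
qed

text \<open>
  Completing the square, \<open>m\<^sup>2\<tau>/2 + m(u + \<tau>) = (m + 1)\<^sup>2\<tau>/2 + (m + 1)u - \<tau>/2 - u\<close>: the translation by \<open>\<tau>\<close> is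
  a shift of the summation index.
\<close>
lemma theta3_add_tau: "theta3 \<tau> (u + \<tau>) = ee (- \<tau>/2 - u) * theta3 \<tau> u"
proof -
  have "theta3 \<tau> (u + \<tau>) = (\<Sum>\<^sub>\<infinity>m. ee (- \<tau>/2 - u) * theta_term \<tau> u (m + 1))"
    unfolding theta3_alt
    unfolding theta_term_def ee_add [symmetric]
    by (intro infsum_cong arg_cong[of _ _ ee]) (simp add: power2_eq_square field_simps)
  also have "\<dots> = ee (- \<tau>/2 - u) * (\<Sum>\<^sub>\<infinity>m. theta_term \<tau> u (m + 1))"
    by (rule infsum_cmult_right')
  also have "(\<Sum>\<^sub>\<infinity>m. theta_term \<tau> u (m + 1)) = (\<Sum>\<^sub>\<infinity>m. theta_term \<tau> u m)"
    by (rule infsum_reindex_bij_betw) (rule bij_betwI[of _ _ _ "\<lambda>m. m - 1"], auto)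
  finally show ?thesis by (simp add: theta3_alt)
qed

lemma theta3_minus: "theta3 \<tau> (- u) = theta3 \<tau> u"
proof -
  have "(\<Sum>\<^sub>\<infinity>m. theta_term \<tau> u (- m)) = (\<Sum>\<^sub>\<infinity>m. theta_term \<tau> u m)"
    by (rule infsum_reindex_bij_betw) (rule bij_betwI[of _ _ _ "\<lambda>m. - m"], auto)
  thus ?thesis by (simp add: theta3_alt theta_term_def)
qed

lemma theta4_conv_theta3: "theta4 \<tau> u = theta3 \<tau> (u + 1/2)"
  by (simp add: theta4_def theta3_def)

text \<open>
  Only \<open>theta3\<close> is studied as a series; the other three theta functions are translates of it by half-periods,
  up to nowhere vanishing factors.
\<close>
lemma theta2_conv_theta3: "theta2 \<tau> u = ee (\<tau>/8 + u/2) * theta3 \<tau> (u + \<tau>/2)"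
  unfolding theta2_def theta3_def infsum_cmult_right' [symmetric] ee_add [symmetric]
  by (intro infsum_cong arg_cong[of _ _ ee]) (simp add: power2_eq_square field_simps)

lemma theta1_conv_theta2: "theta1 \<tau> u = - theta2 \<tau> (u + 1/2)"
  by (simp add: theta1_def theta2_def)

text \<open>
  The \<open>0\<close>-th Fourier coefficient is \<open>1\<close>: in the integral over a period all other terms of the series vanish.
\<close>
lemma theta3_not_identically_0:
  assumes "Im \<tau> > 0"
  shows "\<exists>u. theta3 \<tau> u \<noteq> 0"
proof (rule ccontr)
  assume "\<not> ?thesis"
  hence zero: "theta3 \<tau> = (\<lambda>_. 0)" by auto
  define F where "F = finite_subsets_at_top (UNIV :: int set)"
  define I where "I = (\<lambda>X. contour_integral (linepath 0 1) (\<lambda>u. \<Sum>m\<in>X. theta_term \<tau> u m))"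
  have coeff: "((\<lambda>u. theta_term \<tau> u m) has_contour_integral (if m = 0 then 1 else 0)) (linepath 0 1)" for m
  proof (cases "m = 0")
    case True
    hence "theta_term \<tau> u m = 1" for u by (simp add: theta_term_def)
    thus ?thesis using True has_contour_integral_const_linepath[where a = 0 and b = 1 and c = 1] by auto
  next
    case False
    define P where "P = (\<lambda>u. theta_term \<tau> u m / (2 * of_real pi * \<i> * of_int m))"
    have "(P has_field_derivative theta_term \<tau> u m) (at u within UNIV)" for u
      unfolding P_def theta_term_def ee_def using False
      by (auto intro!: derivative_eq_intros)
    hence "((\<lambda>u. theta_term \<tau> u m) has_contour_integral (P (pathfinish (linepath 0 1)) - P (pathstart (linepath 0 1)))) (linepath 0 1)"
      by (intro contour_integral_primitive[where S = UNIV] valid_path_linepath subset_UNIV)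
    moreover have "P 1 = P 0" by (simp add: P_def theta_term_def ee_add)
    ultimately show ?thesis using False by simp
  qed
  have sums: "((\<lambda>u. \<Sum>m\<in>X. theta_term \<tau> u m) has_contour_integral (\<Sum>m\<in>X. if m = 0 then 1 else 0)) (linepath 0 1)"
    if "finite X" for X
    using that coeff by (intro has_contour_integral_sum)
  have "(I \<longlongrightarrow> contour_integral (linepath 0 1) (theta3 \<tau>)) F"
    unfolding I_def
  proof (rule contour_integral_uniform_limit)
    have "uniform_limit (path_image (linepath 0 1)) (\<lambda>X u. \<Sum>m\<in>X. theta_term \<tau> u m) (theta3 \<tau>) F"
      unfolding F_def
    proof (rule uniform_limit_on_subset[OF theta3_uniform_limit[OF assms, of 0]])
      show "path_image (linepath 0 1) \<subseteq> {u. \<bar>Im u\<bar> \<le> 0}"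
        by (auto simp: closed_segment_def)
    qed
    thus "uniform_limit (path_image (linepath 0 1)) (\<lambda>X u. \<Sum>m\<in>X. theta_term \<tau> u m) (theta3 \<tau>) F" .
    show "\<forall>\<^sub>F X in F. (\<lambda>u. \<Sum>m\<in>X. theta_term \<tau> u m) contour_integrable_on linepath 0 1"
      unfolding F_def using sums
      by (intro eventually_finite_subsets_at_top_weakI) (auto simp: contour_integrable_on_def)
    show "norm (vector_derivative (linepath 0 (1::complex)) (at t)) \<le> 1" for t :: real
      unfolding vector_derivative_linepath_at by simp
  qed (auto simp: F_def)
  moreover have "\<forall>\<^sub>F X in F. I X = 1"
  proof -
    have "\<forall>\<^sub>F X in F. finite X \<and> {0} \<subseteq> X"
      unfolding F_def eventually_finite_subsets_at_top by (intro exI[of _ "{0}"]) auto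
    thus ?thesis
    proof eventually_elim
      case (elim X)
      thus ?case using contour_integral_unique[OF sums[of X]] by (auto simp: I_def)
    qed
  qed
  hence "(I \<longlongrightarrow> 1) F" by (rule tendsto_eventually)
  moreover have "F \<noteq> bot" by (simp add: F_def)
  ultimately have "contour_integral (linepath 0 1) (theta3 \<tau>) = 1"
    using tendsto_unique by blast
  thus False by (simp add: zero)
qed

section \<open>The period lattice\<close>

definition period_lattice :: "complex \<Rightarrow> complex set" where
  "period_lattice \<tau> = {of_int m + of_int n * \<tau> | m n. True}"

lemma period_latticeI: "of_int m + of_int n * \<tau> \<in> period_lattice \<tau>"
  by (auto simp: period_lattice_def)

lemma period_lattice_cases:
  assumes "z \<in> period_lattice \<tau>"
  obtains m n where "z = of_int m + of_int n * \<tau>"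
  using assms by (auto simp: period_lattice_def)

lemma zero_in_period_lattice: "0 \<in> period_lattice \<tau>"
  using period_latticeI[of 0 0 \<tau>] by simp

lemma period_lattice_minus: "z \<in> period_lattice \<tau> \<Longrightarrow> - z \<in> period_lattice \<tau>"
  by (elim period_lattice_cases) (use period_latticeI[of "- _" "- _" \<tau>] in \<open>auto simp: algebra_simps\<close>)

lemma period_lattice_add:
  assumes "z \<in> period_lattice \<tau>" "w \<in> period_lattice \<tau>" shows "z + w \<in> period_lattice \<tau>"
proof -
  obtain a b c d where "z = of_int a + of_int b * \<tau>" "w = of_int c + of_int d * \<tau>"
    using assms by (auto elim!: period_lattice_cases)
  thus ?thesis using period_latticeI[of "a + c" "b + d" \<tau>] by (simp add: algebra_simps)
qed

text \<open>
  Translation behaviour is iterated on an invariant set \<open>U\<close> only, because for functions with poles it will be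
  known only away from the poles.
\<close>
lemma additive_shift_int:
  fixes f :: "complex \<Rightarrow> complex"
  assumes "\<And>u. u \<in> U \<Longrightarrow> u + w \<in> U" "\<And>u. u \<in> U \<Longrightarrow> u - w \<in> U"
    and "\<And>u. u \<in> U \<Longrightarrow> f (u + w) = f u + c" and "u \<in> U"
  shows "f (u + of_int n * w) = f u + of_int n * c \<and> u + of_int n * w \<in> U"
proof (induction n rule: int_induct[where k = 0])
  case (step1 i)
  thus ?case using assms(1)[of "u + of_int i * w"] assms(3)[of "u + of_int i * w"]
    by (simp add: algebra_simps)
next
  case (step2 i)
  have "f (u + of_int i * w) = f (u + of_int (i - 1) * w) + c"
    using assms(2)[of "u + of_int i * w"] assms(3)[of "u + of_int (i - 1) * w"] step2
    by (simp add: algebra_simps)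
  thus ?case using assms(2)[of "u + of_int i * w"] step2 by (simp add: algebra_simps)
qed (use assms in auto)

lemma additive_shift_period_lattice:
  fixes f :: "complex \<Rightarrow> complex"
  assumes "\<And>u v. u \<in> U \<Longrightarrow> v \<in> period_lattice \<tau> \<Longrightarrow> u + v \<in> U"
    and "\<And>u. u \<in> U \<Longrightarrow> f (u + 1) = f u + a" and "\<And>u. u \<in> U \<Longrightarrow> f (u + \<tau>) = f u + b" and "u \<in> U"
  shows "f (u + (of_int m + of_int n * \<tau>)) = f u + of_int m * a + of_int n * b"
proof -
  have 1: "v \<in> U \<Longrightarrow> v + 1 \<in> U" "v \<in> U \<Longrightarrow> v - 1 \<in> U"
          "v \<in> U \<Longrightarrow> v + \<tau> \<in> U" "v \<in> U \<Longrightarrow> v - \<tau> \<in> U" for v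
    using assms(1)[of v 1] assms(1)[of v "-1"] assms(1)[of v "\<tau>"] assms(1)[of v "-\<tau>"]
          period_latticeI[of 1 0 \<tau>] period_latticeI[of "-1" 0 \<tau>]
          period_latticeI[of 0 1 \<tau>] period_latticeI[of 0 "-1" \<tau>] by simp_all
  have 2: "f (u + of_int m * 1) = f u + of_int m * a \<and> u + of_int m * 1 \<in> U"
    by (rule additive_shift_int) (use 1 assms in auto)
  have "f (u + of_int m * 1 + of_int n * \<tau>) = f (u + of_int m * 1) + of_int n * b \<and>
        u + of_int m * 1 + of_int n * \<tau> \<in> U"
    by (rule additive_shift_int) (use 1 2 assms in auto)
  thus ?thesis using 2 by (simp add: algebra_simps)
qed

lemma periodic_period_lattice:
  fixes f :: "complex \<Rightarrow> complex"
  assumes "\<And>u. f (u + 1) = f u" "\<And>u. f (u + \<tau>) = f u" "v \<in> period_lattice \<tau>"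
  shows "f (u + v) = f u"
  using additive_shift_period_lattice[of UNIV \<tau> f 0 0 u] assms by (auto elim!: period_lattice_cases)

text \<open>
  All values are taken on the closed fundamental parallelogram, which is compact; Liouville's theorem applies.
\<close>
lemma entire_doubly_periodic_constant:
  assumes "Im \<tau> > 0" "f holomorphic_on UNIV"
    and per: "\<And>u. f (u + 1) = f u" "\<And>u. f (u + \<tau>) = f u"
  obtains c where "\<And>u. f u = c"
proof -
  define K where "K = (\<lambda>(s, t). complex_of_real s + complex_of_real t * \<tau>) ` ({0..1} \<times> {0..1})"
  have "compact K"
    unfolding K_def case_prod_unfold
    by (intro compact_continuous_image continuous_intros compact_Times compact_Icc)
  have "range f \<subseteq> f ` K"
  proof safe
    fix u
    define t where "t = Im u / Im \<tau>"
    define s where "s = Re u - t * Re \<tau>"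
    have u: "u = of_real s + of_real t * \<tau>"
      using assms(1) by (simp add: complex_eq_iff s_def t_def)
    define v where "v = of_int (-\<lfloor>s\<rfloor>) + of_int (-\<lfloor>t\<rfloor>) * \<tau>"
    have "f (u + v) = f u"
      unfolding v_def by (rule periodic_period_lattice[OF per]) (rule period_latticeI)
    moreover have "u + v = of_real (frac s) + of_real (frac t) * \<tau>"
      by (simp add: u v_def frac_def algebra_simps)
    hence "u + v \<in> K" unfolding K_def
      by (intro image_eqI[of _ _ "(frac s, frac t)"]) (auto simp: less_imp_le[OF frac_lt_1])
    ultimately show "f u \<in> f ` K" by (metis imageI)
  qed
  moreover have "compact (f ` K)"
    using \<open>compact K\<close> assms(2) holomorphic_on_imp_continuous_on
    by (intro compact_continuous_image) (auto intro: continuous_on_subset)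
  ultimately have "bounded (range f)" using compact_imp_bounded bounded_subset by blast
  with Liouville_theorem[OF assms(2)] that show ?thesis
    unfolding constant_on_def by auto
qed

lemma remove_sings_shift_periodic:
  assumes "\<And>u. f (u + w) = f u"
  shows "remove_sings f (u + w) = remove_sings f u"
proof -
  have "remove_sings f (u + w) = remove_sings (\<lambda>x. f (u + w + x)) 0" by (rule remove_sings_shift_0)
  also have "(\<lambda>x. f (u + w + x)) = (\<lambda>x. f (u + x))"
    using assms[of "u + _"] by (auto simp: add_ac)
  also have "remove_sings \<dots> 0 = remove_sings f u" by (rule remove_sings_shift_0 [symmetric])
  finally show ?thesis .
qed

lemma remove_sings_entire:
  assumes "f meromorphic_on UNIV" "\<And>z. \<not> is_pole f z"
  shows "remove_sings f holomorphic_on UNIV"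
proof -
  have "remove_sings f nicely_meromorphic_on UNIV"
    using assms(1) by (rule remove_sings_nicely_meromorphic)
  moreover have "\<not> is_pole (remove_sings f) z" for z
    using assms by (subst is_pole_remove_sings_iff)
      (auto intro!: meromorphic_on_isolated_singularity meromorphic_on_subset[OF assms(1)])
  ultimately have "remove_sings f analytic_on UNIV"
    by (intro nicely_meromorphic_without_singularities) auto
  thus ?thesis by (rule analytic_imp_holomorphic)
qed

text \<open>
  A function without poles may still have a wrong value at a removable singularity, so the conclusion is
  about points of analyticity.
\<close>
lemma doubly_periodic_no_poles_constant:
  assumes "Im \<tau> > 0" "f meromorphic_on UNIV"
    and "\<And>u. f (u + 1) = f u" "\<And>u. f (u + \<tau>) = f u" and "\<And>z. \<not> is_pole f z"
  obtains c where "\<And>u. f analytic_on {u} \<Longrightarrow> f u = c"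
proof -
  obtain c where "\<And>u. remove_sings f u = c"
    using entire_doubly_periodic_constant[OF assms(1) remove_sings_entire[OF assms(2,5)]]
          remove_sings_shift_periodic assms(3,4) by metis
  with that show ?thesis using remove_sings_at_analytic by metis
qed

section \<open>A product with the same zeros as the third theta function\<close>

text \<open>
  The \<open>q\<close>-Pochhammer symbol \<open>(- w; Q)\<^sub>\<infinity>\<close>.
\<close>
definition qprod :: "complex \<Rightarrow> complex \<Rightarrow> complex" where
  "qprod Q w = (\<Prod>k. 1 + Q ^ k * w)"

context
  fixes Q :: complex
  assumes Q: "norm Q < 1"
begin

lemma qprod_has_prod: "(\<lambda>k. 1 + Q ^ k * w) has_prod qprod Q w"
proof -
  have "summable (\<lambda>k. norm (Q ^ k * w))"
    unfolding norm_mult norm_power using Q by (intro summable_mult2 summable_geometric) simp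
  hence "abs_convergent_prod (\<lambda>k. 1 + Q ^ k * w)"
    by (intro summable_imp_abs_convergent_prod) simp
  thus ?thesis
    unfolding qprod_def by (intro convergent_prod_has_prod abs_convergent_prod_imp_convergent_prod)
qed

lemma qprod_eq_0_iff: "qprod Q w = 0 \<longleftrightarrow> (\<exists>k. 1 + Q ^ k * w = 0)"
  using has_prod_eq_0_iff[OF qprod_has_prod[of w]] by (auto simp: image_iff eq_commute[of 0])

lemma qprod_rec: "qprod Q w = (1 + w) * qprod Q (Q * w)"
proof -
  have lim: "(\<lambda>n. \<Prod>k<n. 1 + Q ^ k * v) \<longlonglongrightarrow> qprod Q v" for v
    by (rule has_prod_imp_tendsto') (rule qprod_has_prod)
  have "(\<lambda>n. \<Prod>k<Suc n. 1 + Q ^ k * w) = (\<lambda>n. (1 + w) * (\<Prod>k<n. 1 + Q ^ k * (Q * w)))"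
    by (subst prod.lessThan_Suc_shift) (simp add: mult_ac)
  moreover have "(\<lambda>n. (1 + w) * (\<Prod>k<n. 1 + Q ^ k * (Q * w))) \<longlonglongrightarrow> (1 + w) * qprod Q (Q * w)"
    by (intro tendsto_mult tendsto_const lim)
  moreover have "(\<lambda>n. \<Prod>k<Suc n. 1 + Q ^ k * w) \<longlonglongrightarrow> qprod Q w"
    using lim by (rule LIMSEQ_Suc)
  ultimately show ?thesis using LIMSEQ_unique by metis
qed

lemma qprod_entire: "qprod Q holomorphic_on UNIV"
proof (rule holomorphic_uniform_sequence)
  fix z :: complex
  have "uniformly_convergent_on (cball z 1) (\<lambda>N w. \<Prod>k<N. 1 + Q ^ k * w)"
  proof (rule uniformly_convergent_on_prod)
    show "uniformly_convergent_on (cball z 1) (\<lambda>N w. \<Sum>k<N. norm (Q ^ k * w))"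
    proof (rule Weierstrass_m_test')
      show "norm (norm (Q ^ k * w)) \<le> norm Q ^ k * (norm z + 1)" if "w \<in> cball z 1" for k w
      proof -
        have "norm w \<le> norm z + 1"
          using that norm_triangle_sub[of w z] by (simp add: dist_norm norm_minus_commute)
        thus ?thesis by (simp add: norm_mult norm_power mult_left_mono)
      qed
      show "summable (\<lambda>k. norm Q ^ k * (norm z + 1))"
        using Q by (intro summable_mult2 summable_geometric) auto
    qed
  qed (auto intro!: continuous_intros)
  then obtain l where l: "uniform_limit (cball z 1) (\<lambda>N w. \<Prod>k<N. 1 + Q ^ k * w) l sequentially"
    by (auto simp: uniformly_convergent_on_def)
  have "l w = qprod Q w" if "w \<in> cball z 1" for w
    using LIMSEQ_unique[OF tendsto_uniform_limitI[OF l that] has_prod_imp_tendsto'[OF qprod_has_prod]] .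
  with l have "uniform_limit (cball z 1) (\<lambda>N w. \<Prod>k<N. 1 + Q ^ k * w) (qprod Q) sequentially"
    by (metis (no_types, lifting) uniform_limit_cong')
  thus "\<exists>d>0. cball z d \<subseteq> UNIV \<and>
          uniform_limit (cball z d) (\<lambda>N w. \<Prod>k<N. 1 + Q ^ k * w) (qprod Q) sequentially"
    by (intro exI[of _ 1]) auto
qed (auto intro!: holomorphic_intros)

end

lemmas qprod_holomorphic [holomorphic_intros] =
  holomorphic_on_compose_gen[OF _ qprod_entire, unfolded o_def, OF _ _ subset_UNIV]

text \<open>
  The Jacobi triple product without the factor that does not depend on \<open>u\<close>. Unlike the series, it shows its zeros.
\<close>
definition theta_prod :: "complex \<Rightarrow> complex \<Rightarrow> complex" where
  "theta_prod \<tau> u = qprod (ee \<tau>) (ee (\<tau>/2 + u)) * qprod (ee \<tau>) (ee (\<tau>/2 - u))"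

lemma norm_ee_less_1: "Im \<tau> > 0 \<Longrightarrow> norm (ee \<tau>) < 1"
  by (simp add: norm_ee)

lemma ee_power: "ee x ^ k = ee (of_nat k * x)"
  by (induction k) (simp_all add: ee_add distrib_right)

context
  fixes \<tau> :: complex
  assumes tau: "Im \<tau> > 0"
begin

lemma theta_prod_entire: "theta_prod \<tau> holomorphic_on UNIV"
  unfolding theta_prod_def by (intro holomorphic_intros norm_ee_less_1 tau)

lemma theta_prod_add_1: "theta_prod \<tau> (u + 1) = theta_prod \<tau> u"
proof -
  have "ee (\<tau>/2 + (u + 1)) = ee (\<tau>/2 + u) * ee (of_int 1)"
       "ee (\<tau>/2 - (u + 1)) = ee (\<tau>/2 - u) * ee (of_int (-1))"
    unfolding ee_add [symmetric] by (simp_all add: algebra_simps)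
  thus ?thesis by (simp add: theta_prod_def del: of_int_1 of_int_minus)
qed

text \<open>
  With \<open>x = ee (\<tau>/2 + u)\<close>, the translation by \<open>\<tau>\<close> moves one factor from the first product to the second:
  \<open>1 + x\<close> is lost and \<open>1 + 1/x\<close> is gained, and \<open>(1 + 1/x) / (1 + x) = 1/x\<close>.
\<close>
lemma theta_prod_add_tau: "theta_prod \<tau> (u + \<tau>) = ee (- \<tau>/2 - u) * theta_prod \<tau> u"
proof -
  note rec = qprod_rec[OF norm_ee_less_1[OF tau]]
  define x where "x = ee (\<tau>/2 + u)"
  have x0: "x \<noteq> 0" by (simp add: x_def)
  have 1: "ee (\<tau>/2 + (u + \<tau>)) = ee \<tau> * x"
    unfolding x_def ee_add [symmetric] by (rule arg_cong[of _ _ ee]) simp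
  have xinv: "1 / x = ee (- (\<tau>/2 + u))"
    by (simp only: x_def ee_minus inverse_eq_divide)
  have 2: "ee (\<tau>/2 - (u + \<tau>)) = 1 / x" "ee (- \<tau>/2 - u) = 1 / x"
    unfolding xinv by (rule arg_cong[of _ _ ee], simp add: field_simps)+
  have 3: "ee (\<tau>/2 - u) = ee \<tau> * (1 / x)"
    unfolding xinv ee_add [symmetric] by (rule arg_cong[of _ _ ee]) (simp add: field_simps)
  have a: "theta_prod \<tau> (u + \<tau>) = qprod (ee \<tau>) (ee \<tau> * x) * ((1 + 1 / x) * qprod (ee \<tau>) (ee \<tau> * (1 / x)))"
    unfolding theta_prod_def 1 2 by (subst rec[of "1 / x"]) simp
  have b: "theta_prod \<tau> u = (1 + x) * qprod (ee \<tau>) (ee \<tau> * x) * qprod (ee \<tau>) (ee \<tau> * (1 / x))"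
    unfolding theta_prod_def 3 x_def [symmetric] by (subst rec[of x]) simp
  show ?thesis unfolding a b 2 using x0 by (simp add: field_simps)
qed

lemma theta_prod_zeros:
  assumes "theta_prod \<tau> u = 0"
  shows "u - (1 + \<tau>)/2 \<in> period_lattice \<tau>"
proof -
  have *: "\<exists>k n. v = of_int n - 1/2 - of_nat k * \<tau> - \<tau>/2" if zero: "qprod (ee \<tau>) (ee (\<tau>/2 + v)) = 0" for v
  proof -
    obtain k where "1 + ee \<tau> ^ k * ee (\<tau>/2 + v) = 0"
      using zero by (auto simp: qprod_eq_0_iff[OF norm_ee_less_1[OF tau]])
    hence "ee (1/2 + (of_nat k * \<tau> + (\<tau>/2 + v))) = 1"
      by (simp add: ee_add ee_power ee_half add_eq_0_iff)
    then obtain n where "1/2 + (of_nat k * \<tau> + (\<tau>/2 + v)) = of_int n"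
      by (auto simp: ee_eq_1_iff elim: Ints_cases)
    hence "v = of_int n - 1/2 - of_nat k * \<tau> - \<tau>/2" by (simp add: algebra_simps)
    thus ?thesis by blast
  qed
  from assms consider "qprod (ee \<tau>) (ee (\<tau>/2 + u)) = 0" | "qprod (ee \<tau>) (ee (\<tau>/2 + - u)) = 0"
    by (auto simp: theta_prod_def)
  thus ?thesis
  proof cases
    case 1
    then obtain k n where "u = of_int n - 1/2 - of_nat k * \<tau> - \<tau>/2" using * by blast
    moreover have "(of_int n - 1/2 - of_nat k * \<tau> - \<tau>/2) - (1 + \<tau>)/2 =
        of_int (n - 1) + of_int (- int k - 1) * \<tau>" by (simp add: field_simps)
    ultimately show ?thesis by (metis period_latticeI)
  next
    case 2
    then obtain k n where "- u = of_int n - 1/2 - of_nat k * \<tau> - \<tau>/2" using * by blast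
    hence "u = - (of_int n - 1/2 - of_nat k * \<tau> - \<tau>/2)" by (metis minus_minus)
    moreover have "- (of_int n - 1/2 - of_nat k * \<tau> - \<tau>/2) - (1 + \<tau>)/2 =
        of_int (- n) + of_int (int k) * \<tau>" by (simp add: field_simps)
    ultimately show ?thesis by (metis period_latticeI)
  qed
qed

text \<open>
  At \<open>(1 + \<tau>)/2\<close> only the factor of index \<open>0\<close> of the second product vanishes, and it has a nonzero derivative.
  So this factor is split off from the remaining product \<open>G\<close>.
\<close>
lemma theta_prod_simple_zero:
  shows "theta_prod \<tau> ((1 + \<tau>)/2) = 0" and "deriv (theta_prod \<tau>) ((1 + \<tau>)/2) \<noteq> 0"
proof -
  define p where "p = (1 + \<tau>)/2"
  define G where "G = (\<lambda>u. qprod (ee \<tau>) (ee (\<tau>/2 + u)) * qprod (ee \<tau>) (ee \<tau> * ee (\<tau>/2 - u)))"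
  have eq: "theta_prod \<tau> = (\<lambda>u. (1 + ee (\<tau>/2 - u)) * G u)"
    unfolding theta_prod_def G_def
    by (subst qprod_rec[OF norm_ee_less_1[OF tau], of "ee (\<tau>/2 - _)"]) (simp add: mult_ac)
  have p1: "\<tau>/2 - p = - (1/2)" "\<tau>/2 + p = 1/2 + \<tau>" by (simp_all add: p_def field_simps)
  have e: "ee (\<tau>/2 - p) = -1" "ee (\<tau>/2 + p) = - ee \<tau>"
    unfolding p1 by (simp_all only: ee_minus ee_half ee_add) simp_all
  have "1 + ee \<tau> ^ k * (- ee \<tau>) \<noteq> 0" for k
  proof
    assume "1 + ee \<tau> ^ k * (- ee \<tau>) = 0"
    hence "ee \<tau> ^ Suc k = 1" by (simp add: mult_ac)
    hence "norm (ee \<tau>) ^ Suc k = 1" by (metis norm_one norm_power)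
    moreover have "norm (ee \<tau>) ^ Suc k < 1"
      using norm_ee_less_1[OF tau] by (intro power_Suc_less_one) auto
    ultimately show False by simp
  qed
  hence "qprod (ee \<tau>) (- ee \<tau>) \<noteq> 0"
    using qprod_eq_0_iff[OF norm_ee_less_1[OF tau]] by blast
  hence G0: "G p \<noteq> 0" by (simp add: G_def e)
  have "G holomorphic_on UNIV"
    unfolding G_def by (intro holomorphic_intros norm_ee_less_1 tau)
  hence G': "(G has_field_derivative deriv G p) (at p)"
    by (rule holomorphic_derivI) auto
  have "(theta_prod \<tau> has_field_derivative
          (0 + 2 * of_real pi * \<i> * ee (\<tau>/2 - p) * (0 - 1)) * G p + deriv G p * (1 + ee (\<tau>/2 - p))) (at p)"
    unfolding eq by (intro derivative_intros G' DERIV_chain2[OF ee_has_field_derivative])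
  hence "deriv (theta_prod \<tau>) p = 2 * of_real pi * \<i> * G p"
    by (simp add: e DERIV_imp_deriv)
  thus "deriv (theta_prod \<tau>) ((1 + \<tau>)/2) \<noteq> 0" using G0 by (simp add: p_def)
  show "theta_prod \<tau> ((1 + \<tau>)/2) = 0" using e(1) by (simp add: eq p_def)
qed

text \<open>
  The points \<open>\<plusminus>(1 + \<tau>)/2\<close> differ by the period \<open>1 + \<tau>\<close>, for which the multiplier at this point is \<open>-1\<close>; but \<open>theta3\<close> is
  even.
\<close>
lemma theta3_zero: "theta3 \<tau> ((1 + \<tau>)/2) = 0"
proof -
  have "theta3 \<tau> ((1 + \<tau>)/2) = theta3 \<tau> ((- ((1 + \<tau>)/2) + 1) + \<tau>)" by (simp add: field_simps)
  also have "\<dots> = ee (- \<tau>/2 - (- ((1 + \<tau>)/2) + 1)) * theta3 \<tau> (- ((1 + \<tau>)/2))"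
    by (simp only: theta3_add_tau theta3_add_1)
  also have "- \<tau>/2 - (- ((1 + \<tau>)/2) + 1) = - (1/2)" by (simp add: field_simps)
  also have "ee \<dots> = -1" by (simp add: ee_minus ee_half del: minus_divide_left)
  finally show ?thesis by (simp only: theta3_minus) simp
qed

text \<open>
  Series and product have the same multipliers, so their quotient is doubly periodic. It has poles at most at
  the zeros of the product; these are simple and lie in a single class modulo the lattice, where the series
  vanishes too. Hence the quotient is constant, and the constant is not \<open>0\<close> as the series does not vanish identically.
\<close>
lemma theta3_conv_theta_prod: "\<exists>c. c \<noteq> 0 \<and> (\<forall>u. theta3 \<tau> u = c * theta_prod \<tau> u)"
proof -
  define p where "p = (1 + \<tau>)/2"
  define h where "h = (\<lambda>u. theta3 \<tau> u / theta_prod \<tau> u)"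
  have per: "h (u + 1) = h u" "h (u + \<tau>) = h u" for u
    by (simp_all add: h_def theta3_add_1 theta3_add_tau theta_prod_add_1 theta_prod_add_tau)
  have ana: "theta3 \<tau> analytic_on A" "theta_prod \<tau> analytic_on A" for A
    using theta3_holomorphic[OF tau, of UNIV] theta_prod_entire
    by (auto simp flip: analytic_on_open[of UNIV] intro: analytic_on_subset[OF _ subset_UNIV])
  have ana_h: "h analytic_on {u}" if "theta_prod \<tau> u \<noteq> 0" for u
    unfolding h_def using that by (intro analytic_intros ana) auto
  have mero: "h meromorphic_on UNIV"
    unfolding h_def by (intro meromorphic_intros analytic_on_imp_meromorphic_on ana)
  have "(h \<longlongrightarrow> deriv (theta3 \<tau>) p / deriv (theta_prod \<tau>) p) (at p)"
    unfolding h_def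
  proof (rule lhopital_complex_simple)
    show "(theta3 \<tau> has_field_derivative deriv (theta3 \<tau>) p) (at p)"
         "(theta_prod \<tau> has_field_derivative deriv (theta_prod \<tau>) p) (at p)"
      using theta3_holomorphic[OF tau, of UNIV] theta_prod_entire by (auto intro: holomorphic_derivI)
  qed (use theta3_zero theta_prod_simple_zero in \<open>auto simp: p_def\<close>)
  hence lim: "\<not> is_pole h p"
    unfolding is_pole_def using not_tendsto_and_filterlim_at_infinity trivial_limit_at by blast
  have no_pole: "\<not> is_pole h z" for z
  proof (cases "theta_prod \<tau> z = 0")
    case False
    thus ?thesis using ana_h analytic_at_imp_no_pole by blast
  next
    case True
    define v where "v = z - p"
    have v: "v \<in> period_lattice \<tau>" using theta_prod_zeros[OF True] by (simp add: v_def p_def)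
    have "is_pole h (p + v) \<longleftrightarrow> is_pole (\<lambda>u. h (u + v)) p"
      by (simp add: is_pole_shift_0[of _ "p + v"] is_pole_shift_0[of _ p] add_ac)
    also have "(\<lambda>u. h (u + v)) = h"
      using periodic_period_lattice[of h \<tau> v] per v by auto
    finally show ?thesis using lim by (simp add: v_def)
  qed
  obtain c where c: "\<And>u. h analytic_on {u} \<Longrightarrow> h u = c"
    using doubly_periodic_no_poles_constant[OF tau mero per no_pole] by blast
  have "theta3 \<tau> u = c * theta_prod \<tau> u" for u
  proof (cases "theta_prod \<tau> u = 0")
    case False
    thus ?thesis using c[OF ana_h[OF False]] by (simp add: h_def field_simps)
  next
    case True
    hence "u - p \<in> period_lattice \<tau>" using theta_prod_zeros[OF True] by (simp only: p_def)
    \<comment> \<open>the multipliers do not vanish, so the indicator function of the zeros is doubly periodic\<close>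
    moreover define f where "f = (\<lambda>u. if theta3 \<tau> u = 0 then 0 else 1 :: complex)"
    have "f (u + 1) = f u" "f (u + \<tau>) = f u" for u
      by (simp_all add: f_def theta3_add_1 theta3_add_tau)
    ultimately have "f (p + (u - p)) = f p" by (intro periodic_period_lattice[of f \<tau> "u - p" p])
    hence "theta3 \<tau> u = 0" using theta3_zero by (simp add: f_def p_def split: if_splits)
    thus ?thesis using True by simp
  qed
  moreover have "c \<noteq> 0" using theta3_not_identically_0[OF tau] calculation by auto
  ultimately show ?thesis by blast
qed

lemma theta3_eq_0_imp: "theta3 \<tau> u = 0 \<Longrightarrow> u - (1 + \<tau>)/2 \<in> period_lattice \<tau>"
  using theta3_conv_theta_prod theta_prod_zeros by auto

lemma deriv_theta3_zero: "deriv (theta3 \<tau>) ((1 + \<tau>)/2) \<noteq> 0"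
proof -
  obtain c where c: "c \<noteq> 0" "theta3 \<tau> = (\<lambda>u. c * theta_prod \<tau> u)"
    using theta3_conv_theta_prod by auto
  have "(theta_prod \<tau>) field_differentiable at ((1 + \<tau>)/2)"
    using theta_prod_entire by (simp add: holomorphic_on_imp_differentiable_at)
  thus ?thesis using c theta_prod_simple_zero(2) by simp
qed

end

section \<open>Laurent coefficients\<close>

text \<open>
  Coefficients only depend on the germ of \<open>f\<close> at the punctured point \<open>p\<close>. They are therefore insensitive to the
  values that a meromorphic function is given at its poles.
\<close>
definition lcoeff :: "(complex \<Rightarrow> complex) \<Rightarrow> complex \<Rightarrow> int \<Rightarrow> complex" where
  "lcoeff f p n = fls_nth (laurent_expansion f p) n"

lemma meromorphic_at_expansion:
  assumes "f meromorphic_on {p}"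
  shows "(\<lambda>x. f (p + x)) has_laurent_expansion laurent_expansion f p"
  using assms laurent_expansion_eqI by (auto simp: meromorphic_on_def)

lemma lcoeff_cong: "(\<And>u. u \<noteq> p \<Longrightarrow> f u = g u) \<Longrightarrow> lcoeff f p n = lcoeff g p n"
  unfolding lcoeff_def by (intro arg_cong2[of _ _ _ _ fls_nth] laurent_expansion_cong refl)
    (auto simp: eventually_at_filter)

lemma lcoeff_cong_ev: "eventually (\<lambda>u. f u = g u) (at p) \<Longrightarrow> lcoeff f p n = lcoeff g p n"
  unfolding lcoeff_def by (intro arg_cong2[of _ _ _ _ fls_nth] laurent_expansion_cong refl)

lemma lcoeff_shift: "lcoeff (\<lambda>u. f (u + w)) p n = lcoeff f (p + w) n" if "f meromorphic_on {p + w}"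
proof -
  have "laurent_expansion (\<lambda>u. f (u + w)) p = laurent_expansion f (p + w)"
    using meromorphic_at_expansion[OF that]
    by (intro laurent_expansion_eqI) (simp add: add_ac)
  thus ?thesis by (simp add: lcoeff_def)
qed

lemma lcoeff_add:
  assumes "f meromorphic_on {p}" "g meromorphic_on {p}"
  shows "lcoeff (\<lambda>u. f u + g u) p n = lcoeff f p n + lcoeff g p n"
proof -
  have "laurent_expansion (\<lambda>u. f u + g u) p = laurent_expansion f p + laurent_expansion g p"
    using assms by (intro laurent_expansion_eqI has_laurent_expansion_add meromorphic_at_expansion)
  thus ?thesis by (simp add: lcoeff_def)
qed

lemma lcoeff_cmult:
  assumes "f meromorphic_on {p}"
  shows "lcoeff (\<lambda>u. c * f u) p n = c * lcoeff f p n"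
proof -
  have "laurent_expansion (\<lambda>u. c * f u) p = fls_const c * laurent_expansion f p"
    using assms by (intro laurent_expansion_eqI has_laurent_expansion_cmult_left meromorphic_at_expansion)
  thus ?thesis by (simp add: lcoeff_def)
qed

lemma lcoeff_diff:
  assumes "f meromorphic_on {p}" "g meromorphic_on {p}"
  shows "lcoeff (\<lambda>u. f u - g u) p n = lcoeff f p n - lcoeff g p n"
proof -
  have "laurent_expansion (\<lambda>u. f u - g u) p = laurent_expansion f p - laurent_expansion g p"
    using assms by (intro laurent_expansion_eqI has_laurent_expansion_diff meromorphic_at_expansion)
  thus ?thesis by (simp add: lcoeff_def)
qed

lemma deriv_shift: "deriv (\<lambda>x. f (p + x)) x = deriv f (p + x)"
  by (simp add: deriv_def DERIV_shift[of f _ x p] add.commute[of p])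

lemma lcoeff_deriv:
  assumes "f meromorphic_on {p}"
  shows "lcoeff (deriv f) p n = of_int (n + 1) * lcoeff f p (n + 1)"
proof -
  have "deriv (\<lambda>x. f (p + x)) has_laurent_expansion fls_deriv (laurent_expansion f p)"
    using assms by (intro has_laurent_expansion_deriv meromorphic_at_expansion)
  hence "laurent_expansion (deriv f) p = fls_deriv (laurent_expansion f p)"
    by (intro laurent_expansion_eqI) (simp add: deriv_shift[abs_def, symmetric])
  thus ?thesis by (simp add: lcoeff_def)
qed

text \<open>
  With lower bounds \<open>m\<close> and \<open>n\<close> of the orders instead of the orders themselves, applications have no case distinctions
  about vanishing leading coefficients.
\<close>
lemma fls_mult_lowest_nth:
  fixes F G :: "complex fls"
  assumes "\<And>i. i < m \<Longrightarrow> fls_nth F i = 0" "\<And>i. i < n \<Longrightarrow> fls_nth G i = 0"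
  shows "i < m + n \<Longrightarrow> fls_nth (F * G) i = 0" and "fls_nth (F * G) (m + n) = fls_nth F m * fls_nth G n"
proof -
  have "(i < m + n \<longrightarrow> fls_nth (F * G) i = 0) \<and> fls_nth (F * G) (m + n) = fls_nth F m * fls_nth G n"
  proof (cases "F = 0 \<or> G = 0")
    case False
    hence F: "F \<noteq> 0" and G: "G \<noteq> 0" by auto
    have m: "m \<le> fls_subdegree F" and n: "n \<le> fls_subdegree G"
      using F G assms nth_fls_subdegree_nonzero by (meson not_le)+
    have sub: "fls_subdegree (F * G) = fls_subdegree F + fls_subdegree G"
      using F G by simp
    have 1: "i < m + n \<longrightarrow> fls_nth (F * G) i = 0"
      using m n sub by auto
    have 2: "fls_nth (F * G) (m + n) = fls_nth F m * fls_nth G n"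
    proof (cases "m = fls_subdegree F \<and> n = fls_subdegree G")
      case True
      thus ?thesis by (simp add: fls_times_base)
    next
      case False
      hence "m + n < fls_subdegree (F * G)" "m < fls_subdegree F \<or> n < fls_subdegree G"
        using m n sub by auto
      thus ?thesis by auto
    qed
    from 1 2 show ?thesis ..
  qed auto
  thus "i < m + n \<Longrightarrow> fls_nth (F * G) i = 0" and "fls_nth (F * G) (m + n) = fls_nth F m * fls_nth G n"
    by auto
qed

lemma lcoeff_mult_lowest:
  assumes "f meromorphic_on {p}" "g meromorphic_on {p}"
    and "\<And>i. i < m \<Longrightarrow> lcoeff f p i = 0" "\<And>i. i < n \<Longrightarrow> lcoeff g p i = 0"
  shows "i < m + n \<Longrightarrow> lcoeff (\<lambda>u. f u * g u) p i = 0"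
    and "lcoeff (\<lambda>u. f u * g u) p (m + n) = lcoeff f p m * lcoeff g p n"
proof -
  have "laurent_expansion (\<lambda>u. f u * g u) p = laurent_expansion f p * laurent_expansion g p"
    using assms(1,2) by (intro laurent_expansion_eqI has_laurent_expansion_mult meromorphic_at_expansion)
  thus "i < m + n \<Longrightarrow> lcoeff (\<lambda>u. f u * g u) p i = 0"
    and "lcoeff (\<lambda>u. f u * g u) p (m + n) = lcoeff f p m * lcoeff g p n"
    using fls_mult_lowest_nth[of m "laurent_expansion f p" n "laurent_expansion g p"] assms(3,4)
    by (auto simp: lcoeff_def)
qed

lemma lcoeff_residue:
  assumes "f meromorphic_on {p}"
  shows "residue f p = lcoeff f p (-1)"
  unfolding lcoeff_def fls_residue_def [symmetric]
  using has_laurent_expansion_residue[OF meromorphic_at_expansion[OF assms]] by simp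

lemma analytic_lcoeff:
  assumes "f analytic_on {p}"
  shows "n < 0 \<Longrightarrow> lcoeff f p n = 0" and "lcoeff f p 0 = f p" and "lcoeff f p 1 = deriv f p"
proof -
  have "(\<lambda>x. f (p + x)) has_fps_expansion fps_expansion f p"
    using analytic_at_imp_has_fps_expansion[OF assms] .
  hence exp: "laurent_expansion f p = fps_to_fls (fps_expansion f p)"
    by (intro laurent_expansion_eqI has_laurent_expansion_fps)
  show "n < 0 \<Longrightarrow> lcoeff f p n = 0" "lcoeff f p 0 = f p" "lcoeff f p 1 = deriv f p"
    by (simp_all add: lcoeff_def exp fps_expansion_def)
qed

lemma not_is_pole_iff_lcoeff:
  assumes "f meromorphic_on {p}"
  shows "\<not> is_pole f p \<longleftrightarrow> (\<forall>n<0. lcoeff f p n = 0)"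
proof -
  define F where "F = laurent_expansion f p"
  have "is_pole f p \<longleftrightarrow> fls_subdegree F < 0"
    unfolding F_def by (rule is_pole_fls_subdegree_iff[OF meromorphic_at_expansion[OF assms]])
  moreover have "\<not> fls_subdegree F < 0 \<longleftrightarrow> (\<forall>n<0. fls_nth F n = 0)"
    by (metis fls_eq0_below_subdegree fls_zero_subdegree less_irrefl less_le_trans linorder_not_less nth_fls_subdegree_nonzero)
  ultimately show ?thesis by (simp add: lcoeff_def F_def)
qed

lemma lcoeff_eventually_bounded:
  assumes "f meromorphic_on {p}"
  obtains k :: nat where "\<And>n. n < - int k \<Longrightarrow> lcoeff f p n = 0"
proof -
  have "lcoeff f p n = 0" if "n < - int (nat (- fls_subdegree (laurent_expansion f p)))" for n
    unfolding lcoeff_def using that by (intro fls_eq0_below_subdegree) (simp split: if_splits)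
  thus ?thesis using that by blast
qed

definition logderiv :: "(complex \<Rightarrow> complex) \<Rightarrow> complex \<Rightarrow> complex" where
  "logderiv f u = deriv f u / f u"

text \<open>
  At a simple zero the logarithmic derivative has a simple pole of residue \<open>1\<close>: compare the lowest coefficients
  in \<open>f' = (f'/f) f\<close>.
\<close>
lemma logderiv_lcoeff:
  assumes "f analytic_on {p}" "f p = 0" "deriv f p \<noteq> 0"
  shows "n < -1 \<Longrightarrow> lcoeff (logderiv f) p n = 0"
    and "lcoeff (logderiv f) p (-1) = 1"
proof -
  define g where "g = logderiv f"
  have mero: "f meromorphic_on {p}" "deriv f meromorphic_on {p}" "g meromorphic_on {p}"
    unfolding g_def logderiv_def[abs_def] by (intro meromorphic_intros analytic_on_imp_meromorphic_on assms(1))+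
  define k where "k = fls_subdegree (laurent_expansion g p)"
  have low: "lcoeff g p i = 0" if "i < k" for i
    using that by (simp add: lcoeff_def k_def)
  have f_low: "lcoeff f p i = 0" if "i < 1" for i
    using that analytic_lcoeff(1)[OF assms(1), of i] analytic_lcoeff(2)[OF assms(1)] assms(2) by (cases "i = 0") auto
  have "lcoeff f p 1 \<noteq> 0" using analytic_lcoeff[OF assms(1)] assms(3) by simp
  have "eventually (\<lambda>u. f u \<noteq> 0) (at p)"
  proof -
    have "laurent_expansion f p \<noteq> 0" using \<open>lcoeff f p 1 \<noteq> 0\<close> by (auto simp: lcoeff_def)
    with has_laurent_expansion_nonzero_imp_eventually_nonzero[OF meromorphic_at_expansion[OF mero(1)]]
    show ?thesis by (simp add: eventually_at_to_0[of _ p] add_ac)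
  qed
  hence eq: "lcoeff (\<lambda>u. g u * f u) p i = lcoeff (deriv f) p i" for i
    by (intro lcoeff_cong_ev) (auto elim!: eventually_mono simp: g_def logderiv_def)
  have d: "lcoeff (deriv f) p i = of_int (i + 1) * lcoeff f p (i + 1)" for i
    by (rule lcoeff_deriv[OF mero(1)])
  have d0: "lcoeff (deriv f) p 0 = lcoeff f p 1" "lcoeff (deriv f) p i = 0" if "i < 0" for i
    using d[of 0] d[of i] f_low[of "i + 1"] that by auto
  have g_ne: "lcoeff g p k \<noteq> 0"
  proof
    assume "lcoeff g p k = 0"
    hence "laurent_expansion g p = 0" unfolding lcoeff_def k_def
      using nth_fls_subdegree_nonzero by blast
    hence "lcoeff g p i = 0" for i by (simp add: lcoeff_def)
    hence "lcoeff (\<lambda>u. g u * f u) p 0 = 0"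
      using lcoeff_mult_lowest(1)[OF mero(3,1), where m = 0 and n = 1 and i = 0] f_low by auto
    thus False using eq[of 0] d[of 0] \<open>lcoeff f p 1 \<noteq> 0\<close> by simp
  qed
  have prod: "lcoeff (deriv f) p (k + 1) = lcoeff g p k * lcoeff f p 1"
       "i < k + 1 \<Longrightarrow> lcoeff (deriv f) p i = 0" for i
    using lcoeff_mult_lowest[OF mero(3,1), where m = k and n = 1] low f_low eq by auto
  have "k = -1"
  proof (rule antisym)
    show "k \<le> -1"
      using prod(2)[of 0] d[of 0] \<open>lcoeff f p 1 \<noteq> 0\<close> by (cases "0 < k + 1") auto
    show "-1 \<le> k"
      using prod(1) g_ne \<open>lcoeff f p 1 \<noteq> 0\<close> d0(2)[of "k + 1"] by (cases "k + 1 < 0") auto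
  qed
  thus "n < -1 \<Longrightarrow> lcoeff (logderiv f) p n = 0"
    and "lcoeff (logderiv f) p (-1) = 1"
    using low[of n] prod(1) d[of 0] \<open>lcoeff f p 1 \<noteq> 0\<close> unfolding g_def by auto
qed

text \<open>
  The substitution \<open>x \<mapsto> - x\<close> changes the sign of the coefficient of \<open>1/x\<close>.
\<close>
lemma residue_even_eq_0:
  assumes "f meromorphic_on {p}" "\<forall>\<^sub>F u in at p. f (2 * p - u) = f u"
  shows "residue f p = 0"
proof -
  define F where "F = laurent_expansion f p"
  have F: "(\<lambda>x. f (p + x)) has_laurent_expansion F"
    unfolding F_def by (rule meromorphic_at_expansion[OF assms(1)])
  have neg: "uminus has_laurent_expansion fps_to_fls (fps_const (-1) * fps_X :: complex fps)"
    by (intro has_laurent_expansion_fps) (use has_fps_expansion_cmult_left[OF has_fps_expansion_fps_X, of "-1"] in simp)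
  have e1: "((\<lambda>x. f (p + x)) \<circ> uminus) has_laurent_expansion fls_compose_fps F (fps_const (-1) * fps_X)"
    by (rule has_laurent_expansion_compose[OF F neg]) auto
  have e2: "\<forall>\<^sub>F x in at 0. ((\<lambda>x. f (p + x)) \<circ> uminus) x = f (p + x)"
    using assms(2) by (simp add: eventually_at_to_0[of _ p] add_ac algebra_simps)
  have "(\<lambda>x. f (p + x)) has_laurent_expansion fls_compose_fps F (fps_const (-1) * fps_X)"
    by (rule iffD1[OF has_laurent_expansion_cong[OF e2 refl] e1])
  hence "F = fls_compose_fps F (fps_const (-1) * fps_X)"
    using has_laurent_expansion_unique[OF F] by blast
  hence "fls_nth F (-1) = fls_nth (fls_compose_fps F (fps_const (-1) * fps_X)) (-1)" by simp
  also have "\<dots> = - fls_nth F (-1)"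
    by (subst fls_nth_fls_compose_fps_linear) auto
  finally show ?thesis by (simp add: lcoeff_residue[OF assms(1)] lcoeff_def F_def)
qed

section \<open>Multipliers, parity and zeros of the four theta functions\<close>

lemma ee_minus_cancel: "ee (- x) * ee x = 1" "ee (- x) * (ee x * z) = z"
  by (simp_all add: ee_minus)

lemma theta2_conv_theta1: "theta2 \<tau> u = theta1 \<tau> (u + 1/2)"
proof -
  have "theta1 \<tau> (u + 1/2) = - (ee (\<tau>/8 + (u + 1)/2) * theta3 \<tau> (u + \<tau>/2 + 1))"
    by (simp add: theta1_conv_theta2 theta2_conv_theta3 add_ac)
  also have "\<tau>/8 + (u + 1)/2 = 1/2 + (\<tau>/8 + u/2)" by (simp add: field_simps)
  also have "- (ee (1/2 + (\<tau>/8 + u/2)) * theta3 \<tau> (u + \<tau>/2 + 1)) = theta2 \<tau> u"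
    by (simp only: ee_add ee_half theta3_add_1 theta2_conv_theta3) simp
  finally show ?thesis ..
qed

lemma theta1_conv_theta3: "theta1 \<tau> u = - ee (\<tau>/8 + u/2 + 1/4) * theta3 \<tau> (u + (1 + \<tau>)/2)"
proof -
  have "theta1 \<tau> u = - (ee (\<tau>/8 + (u + 1/2)/2) * theta3 \<tau> (u + 1/2 + \<tau>/2))"
    by (simp only: theta1_conv_theta2 theta2_conv_theta3)
  also have "\<tau>/8 + (u + 1/2)/2 = \<tau>/8 + u/2 + 1/4" by (simp add: field_simps)
  also have "u + 1/2 + \<tau>/2 = u + (1 + \<tau>)/2" by (simp add: field_simps)
  finally show ?thesis by simp
qed

lemma theta1_add_1: "theta1 \<tau> (u + 1) = - theta1 \<tau> u"
  using theta2_conv_theta1[of \<tau> "u + 1/2"] theta1_conv_theta2[of \<tau> u] by (simp add: add.assoc)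

lemma theta1_add_tau: "theta1 \<tau> (u + \<tau>) = - ee (- \<tau>/2 - u) * theta1 \<tau> u"
proof -
  define p where "p = (1 + \<tau>)/2"
  have "theta1 \<tau> (u + \<tau>) = - ee (\<tau>/8 + (u + \<tau>)/2 + 1/4) * theta3 \<tau> (u + p + \<tau>)"
    by (subst theta1_conv_theta3) (simp add: p_def add_ac)
  also have "\<dots> = - (ee (\<tau>/8 + (u + \<tau>)/2 + 1/4) * ee (- \<tau>/2 - (u + p))) * theta3 \<tau> (u + p)"
    by (simp add: theta3_add_tau)
  also have "ee (\<tau>/8 + (u + \<tau>)/2 + 1/4) * ee (- \<tau>/2 - (u + p)) =
      ee (- (1/2)) * (ee (- \<tau>/2 - u) * ee (\<tau>/8 + u/2 + 1/4))"
    unfolding ee_add [symmetric] by (rule arg_cong[of _ _ ee]) (simp add: p_def field_simps)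
  also have "ee (- (1/2)) = -1" by (simp only: ee_minus ee_half) simp
  finally show ?thesis by (subst (2) theta1_conv_theta3) (simp add: p_def)
qed

lemma theta4_conv_theta1: "theta4 \<tau> u = - ee (- (\<tau>/8 + (u - \<tau>/2)/2 + 1/4)) * theta1 \<tau> (u - \<tau>/2)"
proof -
  have "u - \<tau>/2 + (1 + \<tau>)/2 = u + 1/2" by (simp add: field_simps)
  thus ?thesis by (simp only: theta1_conv_theta3 theta4_conv_theta3 mult_minus_left mult_minus_right
     minus_minus ee_minus_cancel)
qed

lemma theta3_conv_theta1:
  "theta3 \<tau> u = - ee (- (\<tau>/8 + (u - (1 + \<tau>)/2)/2 + 1/4)) * theta1 \<tau> (u - (1 + \<tau>)/2)"
  by (simp only: theta1_conv_theta3 diff_add_cancel mult_minus_left mult_minus_right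
     minus_minus ee_minus_cancel)

lemma theta2_add_1: "theta2 \<tau> (u + 1) = - theta2 \<tau> u"
  using theta1_add_1[of \<tau> "u + 1/2"] by (simp add: theta2_conv_theta1 add_ac)

lemma theta2_add_tau: "theta2 \<tau> (u + \<tau>) = ee (- \<tau>/2 - u) * theta2 \<tau> u"
proof -
  have "theta2 \<tau> (u + \<tau>) = - ee (- \<tau>/2 - (u + 1/2)) * theta2 \<tau> u"
    using theta1_add_tau[of \<tau> "u + 1/2"] by (simp add: theta2_conv_theta1 add_ac)
  also have "- \<tau>/2 - (u + 1/2) = - (1/2) + (- \<tau>/2 - u)" by simp
  also have "ee \<dots> = - ee (- \<tau>/2 - u)" by (simp only: ee_add ee_minus ee_half) simp
  finally show ?thesis by simp
qed

lemma theta4_add_1: "theta4 \<tau> (u + 1) = theta4 \<tau> u"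
  using theta3_add_1[of \<tau> "u + 1/2"] by (simp add: theta4_conv_theta3 add_ac)

lemma theta4_add_tau: "theta4 \<tau> (u + \<tau>) = - ee (- \<tau>/2 - u) * theta4 \<tau> u"
proof -
  have "theta4 \<tau> (u + \<tau>) = ee (- \<tau>/2 - (u + 1/2)) * theta4 \<tau> u"
    using theta3_add_tau[of \<tau> "u + 1/2"] by (simp add: theta4_conv_theta3 add_ac)
  also have "- \<tau>/2 - (u + 1/2) = - (1/2) + (- \<tau>/2 - u)" by simp
  also have "ee \<dots> = - ee (- \<tau>/2 - u)" by (simp only: ee_add ee_minus ee_half) simp
  finally show ?thesis by simp
qed

lemma theta4_minus: "theta4 \<tau> (- u) = theta4 \<tau> u"
proof -
  have "theta4 \<tau> (- u) = theta3 \<tau> (- (u - 1/2))" by (simp add: theta4_conv_theta3)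
  also have "\<dots> = theta3 \<tau> (u - 1/2 + 1)" by (simp only: theta3_minus theta3_add_1)
  also have "u - 1/2 + 1 = u + 1/2" by simp
  finally show ?thesis by (simp only: theta4_conv_theta3)
qed

lemma theta2_minus: "theta2 \<tau> (- u) = theta2 \<tau> u"
proof -
  have "theta2 \<tau> (- u) = ee (\<tau>/8 - u/2) * theta3 \<tau> (- (u - \<tau>/2))"
    by (simp add: theta2_conv_theta3)
  also have "theta3 \<tau> (- (u - \<tau>/2)) = theta3 \<tau> (u - \<tau>/2)" by (rule theta3_minus)
  also have "\<dots> = ee (\<tau>/2 + (u - \<tau>/2)) * theta3 \<tau> (u - \<tau>/2 + \<tau>)"
    using ee_minus_cancel(2)[of "- (\<tau>/2 + (u - \<tau>/2))"] by (simp only: theta3_add_tau minus_minus minus_add_distrib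
      diff_conv_add_uminus minus_divide_left)
  also have "u - \<tau>/2 + \<tau> = u + \<tau>/2" by (simp add: field_simps)
  also have "ee (\<tau>/8 - u/2) * (ee (\<tau>/2 + (u - \<tau>/2)) * theta3 \<tau> (u + \<tau>/2)) =
     ee (\<tau>/8 + u/2) * theta3 \<tau> (u + \<tau>/2)"
  proof -
    have "ee (\<tau>/8 - u/2) * ee (\<tau>/2 + (u - \<tau>/2)) = ee (\<tau>/8 + u/2)"
      unfolding ee_add [symmetric] by (rule arg_cong[of _ _ ee]) (simp add: field_simps)
    thus ?thesis by (simp only: mult.assoc [symmetric])
  qed
  finally show ?thesis by (simp only: theta2_conv_theta3)
qed

lemma theta1_minus: "theta1 \<tau> (- u) = - theta1 \<tau> u"
proof -
  have "theta1 \<tau> (- u) = theta2 \<tau> (- (u + 1/2))" by (simp add: theta2_conv_theta1)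
  thus ?thesis by (simp only: theta2_minus theta1_conv_theta2 minus_minus)
qed

lemma entire_analytic: "f holomorphic_on UNIV \<Longrightarrow> f analytic_on A"
  by (rule analytic_on_subset[OF _ subset_UNIV]) (simp add: analytic_on_open)

lemma entire_compose:
  "f holomorphic_on UNIV \<Longrightarrow> g holomorphic_on A \<Longrightarrow> (\<lambda>u. f (g u)) holomorphic_on A"
  using holomorphic_on_compose_gen[of g A f UNIV] by (simp add: o_def)

context
  fixes \<tau> :: complex
  assumes tau: "Im \<tau> > 0"
begin

lemma theta_entire:
  "theta1 \<tau> holomorphic_on UNIV" "theta2 \<tau> holomorphic_on UNIV"
  "theta3 \<tau> holomorphic_on UNIV" "theta4 \<tau> holomorphic_on UNIV"
proof -
  show 3: "theta3 \<tau> holomorphic_on UNIV" by (rule theta3_holomorphic[OF tau])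
  show 1: "theta1 \<tau> holomorphic_on UNIV"
    unfolding theta1_conv_theta3[abs_def]
    by (rule holomorphic_on_mult, (intro holomorphic_intros; simp), rule entire_compose[OF 3])
       (intro holomorphic_intros)
  show "theta2 \<tau> holomorphic_on UNIV"
    unfolding theta2_conv_theta1[abs_def] by (rule entire_compose[OF 1]) (intro holomorphic_intros)
  show "theta4 \<tau> holomorphic_on UNIV"
    unfolding theta4_conv_theta3[abs_def] by (rule entire_compose[OF 3]) (intro holomorphic_intros)
qed

lemma theta1_eq_0_imp: "theta1 \<tau> u = 0 \<Longrightarrow> u \<in> period_lattice \<tau>"
  using theta3_eq_0_imp[OF tau, of "u + (1 + \<tau>)/2"] by (simp add: theta1_conv_theta3)

lemma theta1_0: "theta1 \<tau> 0 = 0"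
  using theta3_zero[OF tau] by (simp add: theta1_conv_theta3)

text \<open>
  By the product rule, as \<open>theta1\<close> is \<open>theta3\<close> translated by its zero, times a nowhere vanishing function.
\<close>
lemma deriv_theta1_0: "deriv (theta1 \<tau>) 0 \<noteq> 0"
proof -
  define e where "e = (\<lambda>u. - ee (\<tau>/8 + u/2 + 1/4))"
  define p where "p = (1 + \<tau>)/2"
  have "e holomorphic_on UNIV" unfolding e_def by (intro holomorphic_intros) auto
  hence e: "(e has_field_derivative deriv e 0) (at 0)"
    by (rule holomorphic_derivI) auto
  have "(theta3 \<tau> has_field_derivative deriv (theta3 \<tau>) p) (at (0 + p))"
    using theta3_holomorphic[OF tau, of UNIV] by (auto intro: holomorphic_derivI)
  hence "((\<lambda>u. theta3 \<tau> (u + p)) has_field_derivative deriv (theta3 \<tau>) p) (at 0)"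
    by (subst (asm) DERIV_shift)
  hence "((\<lambda>u. e u * theta3 \<tau> (u + p)) has_field_derivative
           deriv e 0 * theta3 \<tau> (0 + p) + deriv (theta3 \<tau>) p * e 0) (at 0)"
    by (rule DERIV_mult[OF e])
  hence "deriv (theta1 \<tau>) 0 = deriv (theta3 \<tau>) p * e 0"
    using theta3_zero[OF tau] unfolding theta1_conv_theta3[abs_def]
    by (intro DERIV_imp_deriv) (simp add: e_def p_def)
  thus ?thesis using deriv_theta3_zero[OF tau] by (simp add: e_def p_def)
qed

lemma theta1_eq_0_iff: "theta1 \<tau> u = 0 \<longleftrightarrow> u \<in> period_lattice \<tau>"
proof
  assume "u \<in> period_lattice \<tau>"
  \<comment> \<open>the multipliers do not vanish, so the indicator function of the zeros is doubly periodic\<close>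
  moreover define f where "f = (\<lambda>u. if theta1 \<tau> u = 0 then 0 else 1 :: complex)"
  have "f (u + 1) = f u" "f (u + \<tau>) = f u" for u
    by (auto simp: f_def theta1_add_1 theta1_add_tau)
  ultimately have "f (0 + u) = f 0" by (intro periodic_period_lattice[of f \<tau> u 0])
  thus "theta1 \<tau> u = 0" by (simp add: f_def theta1_0 split: if_splits)
qed (rule theta1_eq_0_imp)

lemma theta2_eq_0_iff: "theta2 \<tau> u = 0 \<longleftrightarrow> u - 1/2 \<in> period_lattice \<tau>"
proof -
  have "theta2 \<tau> u = theta1 \<tau> (u - 1/2 + 1)" by (simp add: theta2_conv_theta1 add.commute)
  thus ?thesis by (simp only: theta1_add_1 neg_equal_0_iff_equal theta1_eq_0_iff)
qed

lemma theta3_eq_0_iff: "theta3 \<tau> u = 0 \<longleftrightarrow> u - (1 + \<tau>)/2 \<in> period_lattice \<tau>"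
  by (subst theta3_conv_theta1) (simp add: theta1_eq_0_iff)

lemma theta4_eq_0_iff: "theta4 \<tau> u = 0 \<longleftrightarrow> u - \<tau>/2 \<in> period_lattice \<tau>"
  by (subst theta4_conv_theta1) (simp add: theta1_eq_0_iff)

end

section \<open>Logarithmic derivatives of quasi-periodic functions\<close>

lemma logderiv_shift_constant_factor:
  assumes "\<And>u. f (u + w) = s * f u" "s \<noteq> 0" "f holomorphic_on UNIV"
  shows "logderiv f (u + w) = logderiv f u"
proof -
  have "deriv f (u + w) = deriv (\<lambda>u. s * f u) u"
    using deriv_shift[of f w u] assms(1) by (simp add: add.commute)
  also have "\<dots> = s * deriv f u"
    using assms(3) by (intro deriv_cmult holomorphic_on_imp_differentiable_at[of f UNIV]) auto
  finally show ?thesis using assms(1,2) by (simp add: logderiv_def)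
qed

lemma logderiv_shift_exponential_factor:
  assumes "\<And>u. f (u + w) = s * ee (a - u) * f u" "s \<noteq> 0" "f holomorphic_on UNIV" "f u \<noteq> 0"
  shows "logderiv f (u + w) = logderiv f u - 2 * of_real pi * \<i>"
proof -
  have f': "(f has_field_derivative deriv f u) (at u)"
    using assms(3) by (rule holomorphic_derivI) auto
  have "((\<lambda>u. ee (a - u)) has_field_derivative 2 * of_real pi * \<i> * ee (a - u) * (0 - 1)) (at u)"
    by (rule DERIV_chain2[OF ee_has_field_derivative]) (intro derivative_intros)
  from DERIV_mult[OF DERIV_cmult[OF this, of s] f']
  have "deriv (\<lambda>u. s * ee (a - u) * f u) u =
      s * ee (a - u) * (deriv f u - 2 * of_real pi * \<i> * f u)"
    by (intro DERIV_imp_deriv) (simp add: algebra_simps)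
  moreover have "deriv f (u + w) = deriv (\<lambda>u. s * ee (a - u) * f u) u"
    using deriv_shift[of f w u] assms(1) by (simp add: add.commute)
  ultimately show ?thesis using assms(1,2,4) by (simp add: logderiv_def field_simps)
qed

lemma logderiv_minus:
  assumes "\<And>u. f (- u) = s * f u" "s \<noteq> 0" "f holomorphic_on UNIV"
  shows "logderiv f (- u) = - logderiv f u"
proof -
  have f': "(f has_field_derivative deriv f (- u)) (at (- u))"
    using assms(3) by (rule holomorphic_derivI) auto
  have "((\<lambda>u. f (- u)) has_field_derivative deriv f (- u) * (- 1)) (at u)"
    by (rule DERIV_chain2[where f = f and g = uminus, OF f']) (auto intro!: derivative_eq_intros)
  hence "deriv (\<lambda>u. f (- u)) u = - deriv f (- u)" by (intro DERIV_imp_deriv) simp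
  moreover have "deriv (\<lambda>u. s * f u) u = s * deriv f u"
    using assms(3) by (intro deriv_cmult holomorphic_on_imp_differentiable_at[of f UNIV]) auto
  ultimately have "deriv f (- u) = - (s * deriv f u)" using assms(1) by simp
  thus ?thesis using assms(1,2) by (simp add: logderiv_def)
qed

section \<open>Functions on the punctured curve\<close>

lemma finite_D_reps: "finite (D_reps \<tau>)" by (simp add: D_reps_def)

context
  fixes \<tau> :: complex
  assumes tau: "Im \<tau> > 0"
begin

lemma real_comb_in_period_lattice_iff:
  "of_real a + of_real b * \<tau> \<in> period_lattice \<tau> \<longleftrightarrow> a \<in> \<int> \<and> b \<in> \<int>"
proof
  assume "of_real a + of_real b * \<tau> \<in> period_lattice \<tau>"
  then obtain m n where mn: "of_real a + of_real b * \<tau> = of_int m + of_int n * \<tau>"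
    by (rule period_lattice_cases)
  hence "b * Im \<tau> = of_int n * Im \<tau>" by (simp add: complex_eq_iff)
  hence b: "b = of_int n" using tau by simp
  moreover have "a = of_int m" using mn b by (simp add: complex_eq_iff)
  ultimately show "a \<in> \<int> \<and> b \<in> \<int>" by simp
next
  assume "a \<in> \<int> \<and> b \<in> \<int>"
  then obtain m n where "a = of_int m" "b = of_int n" by (auto elim!: Ints_cases)
  thus "of_real a + of_real b * \<tau> \<in> period_lattice \<tau>" using period_latticeI[of m n \<tau>] by simp
qed

lemma half_not_Ints: "(1/2::real) \<notin> \<int>" "(-1/2::real) \<notin> \<int>"
proof -
  have "real_of_int n \<noteq> 1/2" "real_of_int n \<noteq> -1/2" for n
  proof -
    have "2 * n \<noteq> 1" "2 * n \<noteq> -1" by presburger+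
    hence "real_of_int (2 * n) \<noteq> 1" "real_of_int (2 * n) \<noteq> -1" by linarith+
    thus "real_of_int n \<noteq> 1/2" "real_of_int n \<noteq> -1/2" by auto
  qed
  thus "(1/2::real) \<notin> \<int>" "(-1/2::real) \<notin> \<int>" by (metis Ints_cases)+
qed

lemma D_reps_cases:
  assumes "p \<in> D_reps \<tau>"
  obtains "p = 0" | "p = 1/2" | "p = (1 + \<tau>)/2" | "p = \<tau>/2"
  using assms unfolding D_reps_def by blast

lemma D_reps_coordinates:
  assumes "p \<in> D_reps \<tau>"
  shows "\<exists>a\<in>{0, 1/2}. \<exists>b\<in>{0, 1/2}. p = of_real a + of_real b * \<tau>"
  using assms by (cases rule: D_reps_cases) (simp_all add: add_divide_distrib)

lemma D_reps_diff_not_in_period_lattice: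
  assumes "p \<in> D_reps \<tau>" "q \<in> D_reps \<tau>" "p \<noteq> q"
  shows "p - q \<notin> period_lattice \<tau>"
proof -
  obtain a b where p: "p = of_real a + of_real b * \<tau>" "a \<in> {0, 1/2}" "b \<in> {0, 1/2::real}"
    using D_reps_coordinates[OF assms(1)] by blast
  obtain c d where q: "q = of_real c + of_real d * \<tau>" "c \<in> {0, 1/2}" "d \<in> {0, 1/2::real}"
    using D_reps_coordinates[OF assms(2)] by blast
  have eq: "p - q = of_real (a - c) + of_real (b - d) * \<tau>" using p(1) q(1) by (simp add: algebra_simps)
  have "a \<noteq> c \<or> b \<noteq> d" using p(1) q(1) assms(3) by auto
  moreover have "x - y \<notin> \<int>" if "x \<in> {0, 1/2}" "y \<in> {0, 1/2}" "x \<noteq> y" for x y :: real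
  proof -
    have "x - y = 1/2 \<or> x - y = -1/2" using that by auto
    thus ?thesis using half_not_Ints by metis
  qed
  ultimately show ?thesis using p(2,3) q(2,3) unfolding eq real_comb_in_period_lattice_iff by blast
qed

lemma D_reps_distinct:
  "distinct [0, 1/2, (1 + \<tau>)/2, \<tau>/2]"
  using tau by (auto simp: complex_eq_iff)

text \<open>
  The points of \<open>D\<close> are the half-periods. Hence \<open>u \<mapsto> - u\<close> fixes each of them on the curve, and the reflection
  \<open>u \<mapsto> 2p - u\<close> at such a point \<open>p\<close> agrees with \<open>u \<mapsto> - u\<close> on doubly periodic functions.
\<close>
lemma D_reps_twice:
  assumes "p \<in> D_reps \<tau>"
  shows "2 * p \<in> period_lattice \<tau>"
proof -
  have "2 * p = 0 \<or> 2 * p = 1 \<or> 2 * p = 1 + \<tau> \<or> 2 * p = \<tau>"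
    using assms by (cases rule: D_reps_cases) (simp_all add: mult.commute)
  moreover have "0 \<in> period_lattice \<tau>" "1 \<in> period_lattice \<tau>" "1 + \<tau> \<in> period_lattice \<tau>" "\<tau> \<in> period_lattice \<tau>"
    using period_latticeI[of 0 0 \<tau>] period_latticeI[of 1 0 \<tau>] period_latticeI[of 1 1 \<tau>]
      period_latticeI[of 0 1 \<tau>] by simp_all
  ultimately show ?thesis by metis
qed

lemma D_lift_iff: "u \<in> D_lift \<tau> \<longleftrightarrow> (\<exists>p\<in>D_reps \<tau>. u - p \<in> period_lattice \<tau>)"
proof
  assume "u \<in> D_lift \<tau>"
  then obtain p m n where "u = p + of_int m + of_int n * \<tau>" "p \<in> D_reps \<tau>"
    by (auto simp: D_lift_def)
  thus "\<exists>p\<in>D_reps \<tau>. u - p \<in> period_lattice \<tau>"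
    using period_latticeI[of m n \<tau>] by (intro bexI[of _ p]) simp_all
next
  assume "\<exists>p\<in>D_reps \<tau>. u - p \<in> period_lattice \<tau>"
  then obtain p m n where "p \<in> D_reps \<tau>" "u - p = of_int m + of_int n * \<tau>"
    by (auto simp: period_lattice_def)
  moreover from this have "u = p + of_int m + of_int n * \<tau>" by (simp add: algebra_simps)
  ultimately show "u \<in> D_lift \<tau>" unfolding D_lift_def by blast
qed

lemma D_lift_add: "u \<in> D_lift \<tau> \<Longrightarrow> v \<in> period_lattice \<tau> \<Longrightarrow> u + v \<in> D_lift \<tau>"
  unfolding D_lift_iff using period_lattice_add[of "u - _" \<tau> v] by (force simp: algebra_simps)

lemma D_lift_add_iff:
  assumes "v \<in> period_lattice \<tau>" shows "u + v \<in> D_lift \<tau> \<longleftrightarrow> u \<in> D_lift \<tau>"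
  using D_lift_add[of u v] D_lift_add[of "u + v" "- v"] period_lattice_minus[of v \<tau>] assms by auto

lemma D_lift_uminus_iff: "- u \<in> D_lift \<tau> \<longleftrightarrow> u \<in> D_lift \<tau>"
proof -
  have "- u \<in> D_lift \<tau>" if u: "u \<in> D_lift \<tau>" for u
  proof -
    obtain p where p: "p \<in> D_reps \<tau>" "u - p \<in> period_lattice \<tau>" using u by (auto simp: D_lift_iff)
    have "- (u - p) + - (2 * p) \<in> period_lattice \<tau>"
      by (intro period_lattice_add period_lattice_minus p D_reps_twice)
    also have "- (u - p) + - (2 * p) = - u - p" by simp
    finally have "- u - p \<in> period_lattice \<tau>" .
    with p(1) show ?thesis by (auto simp: D_lift_iff)
  qed
  from this[of u] this[of "- u"] show ?thesis by auto
qed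

lemma one_tau_in_period_lattice: "1 \<in> period_lattice \<tau>" "\<tau> \<in> period_lattice \<tau>"
  using period_latticeI[of 1 0 \<tau>] period_latticeI[of 0 1 \<tau>] by simp_all

lemma D_lift_add_periods [simp]: "u + 1 \<in> D_lift \<tau> \<longleftrightarrow> u \<in> D_lift \<tau>" "u + \<tau> \<in> D_lift \<tau> \<longleftrightarrow> u \<in> D_lift \<tau>"
  using D_lift_add_iff one_tau_in_period_lattice by auto

text \<open>
  Being the zero set of an entire function that does not vanish identically, \<open>D_lift\<close> is closed and discrete.
\<close>
lemma D_lift_iff_theta:
  "u \<in> D_lift \<tau> \<longleftrightarrow> theta1 \<tau> u * theta2 \<tau> u * theta3 \<tau> u * theta4 \<tau> u = 0"
  unfolding D_lift_iff D_reps_def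
  by (simp add: theta1_eq_0_iff[OF tau] theta2_eq_0_iff[OF tau] theta3_eq_0_iff[OF tau] theta4_eq_0_iff[OF tau])

lemma entire_eventually_nonzero:
  assumes "f holomorphic_on UNIV" "f b \<noteq> 0"
  shows "\<forall>\<^sub>F u in at p. f u \<noteq> 0"
  using non_zero_neighbour_alt[OF assms(1) open_UNIV connected_UNIV _ _ assms(2), of p]
  by (auto elim: eventually_mono)

lemma eventually_not_in_D_lift: "\<forall>\<^sub>F u in at p. u \<notin> D_lift \<tau>"
proof -
  \<comment> \<open>\<open>1/4\<close> is not a half-period\<close>
  define v where "v = of_real (1/4) + of_real 0 * \<tau>"
  have "v \<notin> D_lift \<tau>"
  proof
    assume "v \<in> D_lift \<tau>"
    then obtain p where p: "p \<in> D_reps \<tau>" "v - p \<in> period_lattice \<tau>" by (auto simp: D_lift_iff)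
    have "2 * v = (v - p) + (v - p) + 2 * p" by simp
    also have "\<dots> \<in> period_lattice \<tau>" by (intro period_lattice_add p D_reps_twice)
    also have "2 * v = of_real (1/2) + of_real 0 * \<tau>" by (simp add: v_def)
    finally show False using half_not_Ints by (simp only: real_comb_in_period_lattice_iff) simp
  qed
  hence nz: "theta1 \<tau> v * theta2 \<tau> v * theta3 \<tau> v * theta4 \<tau> v \<noteq> 0" by (simp only: D_lift_iff_theta) simp
  have "\<forall>\<^sub>F u in at p. theta1 \<tau> u * theta2 \<tau> u * theta3 \<tau> u * theta4 \<tau> u \<noteq> 0"
    by (rule entire_eventually_nonzero[where b = v]) (intro holomorphic_on_mult theta_entire[OF tau], rule nz)
  thus ?thesis by (simp only: D_lift_iff_theta)
qed

lemma open_compl_D_lift: "open (- D_lift \<tau>)"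
proof -
  have "continuous_on UNIV (\<lambda>u. theta1 \<tau> u * theta2 \<tau> u * theta3 \<tau> u * theta4 \<tau> u)"
    by (intro holomorphic_on_imp_continuous_on holomorphic_on_mult theta_entire[OF tau])
  hence "open ((\<lambda>u. theta1 \<tau> u * theta2 \<tau> u * theta3 \<tau> u * theta4 \<tau> u) -` (- {0}))"
    by (intro open_vimage) auto
  also have "\<dots> = - D_lift \<tau>" using D_lift_iff_theta by auto
  finally show ?thesis .
qed

lemma eventually_on_M: "\<forall>\<^sub>F u in at p. on_M \<tau> f u = f u"
  using eventually_not_in_D_lift[of p] by eventually_elim (simp add: on_M_def)

lemma lcoeff_on_M: "lcoeff (on_M \<tau> f) p n = lcoeff f p n"
  by (rule lcoeff_cong_ev[OF eventually_on_M])

lemma on_M_eq [simp]: "u \<notin> D_lift \<tau> \<Longrightarrow> on_M \<tau> f u = f u"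
  by (simp add: on_M_def)

lemma on_M_meromorphic_iff: "on_M \<tau> f meromorphic_on A \<longleftrightarrow> f meromorphic_on A"
  by (intro meromorphic_on_cong eventually_on_M refl)

lemma on_M_in_mero_functions:
  assumes "f analytic_on (- D_lift \<tau>)" "f meromorphic_on (D_lift \<tau>)"
    and "\<And>u. u \<notin> D_lift \<tau> \<Longrightarrow> f (u + 1) = f u" "\<And>u. u \<notin> D_lift \<tau> \<Longrightarrow> f (u + \<tau>) = f u"
  shows "on_M \<tau> f \<in> mero_functions \<tau>"
proof -
  have "on_M \<tau> f holomorphic_on (- D_lift \<tau>) \<longleftrightarrow> f holomorphic_on (- D_lift \<tau>)"
    by (rule holomorphic_cong) auto
  thus ?thesis
    using assms(1) analytic_imp_holomorphic assms(2-) unfolding mero_functions_def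
    by (auto simp: on_M_meromorphic_iff) (auto simp: on_M_def)
qed

lemma mero_functionsD:
  assumes "f \<in> mero_functions \<tau>"
  shows "f analytic_on (- D_lift \<tau>)" "f meromorphic_on A" "f (u + 1) = f u" "f (u + \<tau>) = f u"
    and "u \<in> D_lift \<tau> \<Longrightarrow> f u = 0" and "v \<in> period_lattice \<tau> \<Longrightarrow> f (u + v) = f u"
proof -
  show ana: "f analytic_on (- D_lift \<tau>)"
    using assms open_compl_D_lift by (auto simp: mero_functions_def analytic_on_open)
  have "f meromorphic_on (- D_lift \<tau> \<union> D_lift \<tau>)"
    using assms analytic_on_imp_meromorphic_on[OF ana]
    by (simp only: meromorphic_on_Un mero_functions_def mem_Collect_eq)
  thus "f meromorphic_on A" by (rule meromorphic_on_subset) auto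
  show "f (u + 1) = f u" "f (u + \<tau>) = f u" "u \<in> D_lift \<tau> \<Longrightarrow> f u = 0"
    using assms by (auto simp: mero_functions_def)
  show "v \<in> period_lattice \<tau> \<Longrightarrow> f (u + v) = f u"
    by (rule periodic_period_lattice[of f \<tau>]) (use assms in \<open>auto simp: mero_functions_def\<close>)
qed

lemma mero_functionsI:
  assumes "f analytic_on (- D_lift \<tau>)" "f meromorphic_on (D_lift \<tau>)"
    and "\<And>u. f (u + 1) = f u" "\<And>u. f (u + \<tau>) = f u" "\<And>u. u \<in> D_lift \<tau> \<Longrightarrow> f u = 0"
  shows "f \<in> mero_functions \<tau>"
  using assms analytic_imp_holomorphic by (auto simp: mero_functions_def)

lemma mero_functions_add:
  assumes "f \<in> mero_functions \<tau>" "g \<in> mero_functions \<tau>"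
  shows "(\<lambda>u. f u + g u) \<in> mero_functions \<tau>"
proof (rule mero_functionsI)
  show "(\<lambda>u. f u + g u) analytic_on - D_lift \<tau>"
    by (rule analytic_on_add) (rule mero_functionsD(1)[OF assms(1)], rule mero_functionsD(1)[OF assms(2)])
  show "(\<lambda>u. f u + g u) meromorphic_on D_lift \<tau>"
    by (rule meromorphic_on_add) (rule mero_functionsD(2)[OF assms(1)], rule mero_functionsD(2)[OF assms(2)])
qed (simp_all add: mero_functionsD[OF assms(1)] mero_functionsD[OF assms(2)])

lemma mero_functions_mult:
  assumes "f \<in> mero_functions \<tau>" "g \<in> mero_functions \<tau>"
  shows "(\<lambda>u. f u * g u) \<in> mero_functions \<tau>"
proof (rule mero_functionsI)
  show "(\<lambda>u. f u * g u) analytic_on - D_lift \<tau>"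
    by (rule analytic_on_mult) (rule mero_functionsD(1)[OF assms(1)], rule mero_functionsD(1)[OF assms(2)])
  show "(\<lambda>u. f u * g u) meromorphic_on D_lift \<tau>"
    by (rule meromorphic_on_mult) (rule mero_functionsD(2)[OF assms(1)], rule mero_functionsD(2)[OF assms(2)])
qed (simp_all add: mero_functionsD[OF assms(1)] mero_functionsD[OF assms(2)])

lemma mero_functions_cmult:
  assumes "f \<in> mero_functions \<tau>"
  shows "(\<lambda>u. c * f u) \<in> mero_functions \<tau>"
proof (rule mero_functionsI)
  show "(\<lambda>u. c * f u) analytic_on - D_lift \<tau>"
    by (rule analytic_on_mult[OF analytic_on_const mero_functionsD(1)[OF assms]])
  show "(\<lambda>u. c * f u) meromorphic_on D_lift \<tau>"
    by (rule meromorphic_on_mult[OF meromorphic_on_const mero_functionsD(2)[OF assms]])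
qed (simp_all add: mero_functionsD[OF assms])

lemma mero_functions_diff:
  assumes "f \<in> mero_functions \<tau>" "g \<in> mero_functions \<tau>"
  shows "(\<lambda>u. f u - g u) \<in> mero_functions \<tau>"
  using mero_functions_add[OF assms(1) mero_functions_cmult[OF assms(2), of "-1"]] by simp

lemma mero_functions_const: "on_M \<tau> (\<lambda>_. c) \<in> mero_functions \<tau>"
  by (rule on_M_in_mero_functions) auto

lemma mero_functions_zero: "(\<lambda>_. 0) \<in> mero_functions \<tau>"
  by (rule mero_functionsI) auto

lemma mero_functions_deriv:
  assumes "f \<in> mero_functions \<tau>"
  shows "on_M \<tau> (deriv f) \<in> mero_functions \<tau>"
proof (rule on_M_in_mero_functions)
  show "deriv f analytic_on - D_lift \<tau>"
    using mero_functionsD(1)[OF assms] by (rule analytic_deriv)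
  show "deriv f meromorphic_on D_lift \<tau>"
    by (intro meromorphic_on_deriv mero_functionsD assms)
  have "deriv f (u + w) = deriv f u" if "\<And>u. f (u + w) = f u" for u w
    using deriv_shift[of f w u] that by (simp add: add.commute)
  thus "deriv f (u + 1) = deriv f u" "deriv f (u + \<tau>) = deriv f u" for u
    using mero_functionsD(3,4)[OF assms] by blast+
qed

lemma mero_functions_reflect:
  assumes "f \<in> mero_functions \<tau>"
  shows "(\<lambda>u. f (- u)) \<in> mero_functions \<tau>"
proof (rule mero_functionsI)
  have "f \<circ> uminus analytic_on - D_lift \<tau>"
    by (rule analytic_on_compose_gen[OF _ mero_functionsD(1)[OF assms]])
       (auto intro!: analytic_intros simp: D_lift_uminus_iff)
  thus "(\<lambda>u. f (- u)) analytic_on - D_lift \<tau>" by (simp add: o_def)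
  show "(\<lambda>u. f (- u)) meromorphic_on D_lift \<tau>"
    by (rule meromorphic_on_compose[OF mero_functionsD(2)[OF assms, of UNIV]]) (auto intro!: analytic_intros)
  show "f (- (u + 1)) = f (- u)" "f (- (u + \<tau>)) = f (- u)" for u
    using mero_functionsD(3,4)[OF assms, of "- u - 1"] mero_functionsD(3,4)[OF assms, of "- u - \<tau>"] by simp_all
qed (auto simp: mero_functionsD[OF assms] D_lift_uminus_iff)

lemma mero_functions_off_D_lift_eqI:
  assumes "f \<in> mero_functions \<tau>" "g \<in> mero_functions \<tau>" "\<And>u. u \<notin> D_lift \<tau> \<Longrightarrow> f u = g u"
  shows "f = g"
  using assms mero_functionsD(5) by (metis ext)

end

section \<open>The residue theorem and the reduction of pole orders\<close>

text \<open>
  This function plays the role of the Weierstrass zeta function: simple poles of residue \<open>1\<close> at the lattice points,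
  period \<open>1\<close>, and an additive constant \<open>- 2\<pi>\<i>\<close> under translation by \<open>\<tau>\<close>.
\<close>
definition theta_zeta :: "complex \<Rightarrow> complex \<Rightarrow> complex" where
  "theta_zeta \<tau> = logderiv (theta1 \<tau>)"

lemma lcoeff_sum:
  assumes "finite A" "\<And>q. q \<in> A \<Longrightarrow> f q meromorphic_on {p}"
  shows "lcoeff (\<lambda>u. \<Sum>q\<in>A. f q u) p n = (\<Sum>q\<in>A. lcoeff (f q) p n)"
  using assms
proof (induction A rule: finite_induct)
  case empty
  show ?case using lcoeff_cmult[OF meromorphic_on_const, of 0 0 p n] by simp
next
  case (insert x F)
  have "lcoeff (\<lambda>u. \<Sum>q\<in>insert x F. f q u) p n = lcoeff (\<lambda>u. f x u + (\<Sum>q\<in>F. f q u)) p n"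
    using insert by simp
  also have "\<dots> = lcoeff (f x) p n + lcoeff (\<lambda>u. \<Sum>q\<in>F. f q u) p n"
    using insert by (intro lcoeff_add meromorphic_on_sum) auto
  finally show ?case using insert by simp
qed

text \<open>
  Differentiation removes the additive constant, so these functions are doubly periodic. Modulo the lattice, the only
  pole is at \<open>p\<close>; as \<open>k + 1\<close> derivatives are taken, it has order \<open>k + 2\<close>.
\<close>
primrec theta_zeta_deriv :: "complex \<Rightarrow> complex \<Rightarrow> nat \<Rightarrow> complex \<Rightarrow> complex" where
  "theta_zeta_deriv \<tau> p 0 = on_M \<tau> (deriv (\<lambda>u. theta_zeta \<tau> (u - p)))"
| "theta_zeta_deriv \<tau> p (Suc k) = on_M \<tau> (deriv (theta_zeta_deriv \<tau> p k))"

context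
  fixes \<tau> :: complex
  assumes tau: "Im \<tau> > 0"
begin

lemma theta_zeta_analytic: "u \<notin> period_lattice \<tau> \<Longrightarrow> theta_zeta \<tau> analytic_on {u}"
  unfolding theta_zeta_def logderiv_def[abs_def]
  by (intro analytic_on_divide analytic_deriv entire_analytic theta_entire tau)
     (auto simp: theta1_eq_0_iff[OF tau])

lemma theta_zeta_meromorphic: "theta_zeta \<tau> meromorphic_on A"
  unfolding theta_zeta_def logderiv_def[abs_def]
  by (intro meromorphic_intros analytic_on_imp_meromorphic_on analytic_deriv entire_analytic theta_entire tau)

lemma theta_zeta_add_1: "theta_zeta \<tau> (u + 1) = theta_zeta \<tau> u"
  unfolding theta_zeta_def by (rule logderiv_shift_constant_factor[where s = "-1"]) (simp_all add: theta1_add_1 theta_entire tau)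

lemma theta_zeta_add_tau: "u \<notin> period_lattice \<tau> \<Longrightarrow> theta_zeta \<tau> (u + \<tau>) = theta_zeta \<tau> u - 2 * of_real pi * \<i>"
  unfolding theta_zeta_def
  by (rule logderiv_shift_exponential_factor[where s = "-1" and a = "- \<tau>/2"])
     (simp_all add: theta1_add_tau theta_entire tau theta1_eq_0_iff)

lemma theta_zeta_lcoeff_0: "n < -1 \<Longrightarrow> lcoeff (theta_zeta \<tau>) 0 n = 0" "lcoeff (theta_zeta \<tau>) 0 (-1) = 1"
  unfolding theta_zeta_def
  by (rule logderiv_lcoeff; simp add: entire_analytic theta_entire tau theta1_0 deriv_theta1_0)+

lemma theta_zeta_lcoeff_shift: "lcoeff (\<lambda>u. theta_zeta \<tau> (u - p)) q n = lcoeff (theta_zeta \<tau>) (q - p) n"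
  using lcoeff_shift[of "theta_zeta \<tau>" q "- p" n] theta_zeta_meromorphic by simp

lemma theta_zeta_shift_meromorphic: "(\<lambda>u. theta_zeta \<tau> (u - p)) meromorphic_on A"
  by (rule meromorphic_on_compose[OF theta_zeta_meromorphic[of UNIV]]) (auto intro!: analytic_intros)

lemma theta_zeta_shift_lcoeff:
  assumes "p \<in> D_reps \<tau>" "q \<in> D_reps \<tau>"
  shows "n < -1 \<Longrightarrow> lcoeff (\<lambda>u. theta_zeta \<tau> (u - p)) q n = 0"
    and "lcoeff (\<lambda>u. theta_zeta \<tau> (u - p)) q (-1) = (if p = q then 1 else 0)"
    and "q \<noteq> p \<Longrightarrow> n < 0 \<Longrightarrow> lcoeff (\<lambda>u. theta_zeta \<tau> (u - p)) q n = 0"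
proof -
  have 1: "lcoeff (theta_zeta \<tau>) (q - p) n = 0" if "q \<noteq> p" "n < 0" for n
    using analytic_lcoeff(1)[OF theta_zeta_analytic[OF D_reps_diff_not_in_period_lattice[OF tau assms(2,1)]]] that
    by simp
  thus "q \<noteq> p \<Longrightarrow> n < 0 \<Longrightarrow> lcoeff (\<lambda>u. theta_zeta \<tau> (u - p)) q n = 0"
    by (simp add: theta_zeta_lcoeff_shift)
  show "n < -1 \<Longrightarrow> lcoeff (\<lambda>u. theta_zeta \<tau> (u - p)) q n = 0"
    and "lcoeff (\<lambda>u. theta_zeta \<tau> (u - p)) q (-1) = (if p = q then 1 else 0)"
    using 1[of n] 1[of "-1"] theta_zeta_lcoeff_0 by (cases "p = q"; simp add: theta_zeta_lcoeff_shift)+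
qed

lemma theta_zeta_shift_analytic:
  assumes "p \<in> D_reps \<tau>" "u \<notin> D_lift \<tau>"
  shows "(\<lambda>u. theta_zeta \<tau> (u - p)) analytic_on {u}" and "u - p \<notin> period_lattice \<tau>"
proof -
  show *: "u - p \<notin> period_lattice \<tau>" using assms by (auto simp: D_lift_iff[OF tau])
  have "theta_zeta \<tau> \<circ> (\<lambda>u. u - p) analytic_on {u}"
    using theta_zeta_analytic[OF *] by (intro analytic_on_compose) (auto intro!: analytic_intros)
  thus "(\<lambda>u. theta_zeta \<tau> (u - p)) analytic_on {u}" by (simp add: o_def)
qed

lemma lcoeff_mero_functions_shift:
  assumes "f \<in> mero_functions \<tau>" "v \<in> period_lattice \<tau>"
  shows "lcoeff f (p + v) n = lcoeff f p n"
proof -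
  have "(\<lambda>u. f (u + v)) = f" using mero_functionsD(6)[OF tau assms(1,2)] by auto
  thus ?thesis using lcoeff_shift[of f p v n] mero_functionsD(2)[OF tau assms(1)] by simp
qed

lemma mero_functions_without_poles_constant:
  assumes "f \<in> mero_functions \<tau>" "\<And>p n. p \<in> D_reps \<tau> \<Longrightarrow> n < 0 \<Longrightarrow> lcoeff f p n = 0"
  obtains c where "f = on_M \<tau> (\<lambda>_. c)"
proof -
  have no_pole: "\<not> is_pole f z" for z
  proof (cases "z \<in> D_lift \<tau>")
    case False
    hence "f analytic_on {z}" using mero_functionsD(1)[OF tau assms(1)] by (auto intro: analytic_on_subset)
    thus ?thesis by (rule analytic_at_imp_no_pole)
  next
    case True
    then obtain p where p: "p \<in> D_reps \<tau>" "z - p \<in> period_lattice \<tau>" by (auto simp: D_lift_iff[OF tau])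
    hence "lcoeff f (p + (z - p)) n = 0" if "n < 0" for n
      using that assms by (simp only: lcoeff_mero_functions_shift)
    thus ?thesis using mero_functionsD(2)[OF tau assms(1)] by (simp add: not_is_pole_iff_lcoeff)
  qed
  obtain c where c: "\<And>u. f analytic_on {u} \<Longrightarrow> f u = c"
    using doubly_periodic_no_poles_constant[OF tau mero_functionsD(2)[OF tau assms(1)]
       mero_functionsD(3,4)[OF tau assms(1)] no_pole] by blast
  have "f = on_M \<tau> (\<lambda>_. c)"
  proof (rule mero_functions_off_D_lift_eqI[OF tau assms(1) mero_functions_const[OF tau]])
    fix u assume u: "u \<notin> D_lift \<tau>"
    hence "f analytic_on {u}" using mero_functionsD(1)[OF tau assms(1)] by (auto intro: analytic_on_subset)
    thus "f u = on_M \<tau> (\<lambda>_. c) u" using c u by (simp add: tau)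
  qed
  with that show ?thesis .
qed

lemma entire_eq_off_D_lift:
  assumes "f holomorphic_on UNIV" "g holomorphic_on UNIV" "\<And>u. u \<notin> D_lift \<tau> \<Longrightarrow> f u = g u"
  shows "f u = g u"
proof -
  have "f \<midarrow>u\<rightarrow> f u" "g \<midarrow>u\<rightarrow> g u"
    using assms(1,2) by (meson UNIV_I continuous_on_eq_continuous_at holomorphic_on_imp_continuous_on isContD open_UNIV)+
  moreover have "\<forall>\<^sub>F w in at u. f w = g w"
    using eventually_not_in_D_lift[OF tau, of u] by eventually_elim (rule assms(3))
  ultimately have "g \<midarrow>u\<rightarrow> f u" using Lim_transform_eventually by blast
  with \<open>g \<midarrow>u\<rightarrow> g u\<close> show ?thesis using LIM_unique by blast
qed

text \<open>
  The derivative is doubly periodic and entire, hence constant. So \<open>h\<close> is affine, and period \<open>1\<close> makes its slope \<open>0\<close>.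
\<close>
lemma entire_additively_quasiperiodic:
  assumes "h holomorphic_on UNIV" "\<And>u. h (u + 1) = h u" "\<And>u. h (u + \<tau>) = h u + C"
  shows "C = 0"
proof -
  have h': "(h has_field_derivative deriv h u) (at u)" for u
    using assms(1) by (rule holomorphic_derivI) auto
  have "deriv h holomorphic_on UNIV"
    using assms(1) by (intro holomorphic_deriv) auto
  moreover have "deriv h (u + 1) = deriv h u" for u
    using deriv_shift[of h 1 u] assms(2) by (simp add: add.commute)
  moreover have "deriv h (u + \<tau>) = deriv h u" for u
  proof -
    have "((\<lambda>u. h u + C) has_field_derivative deriv h u + 0) (at u)"
      by (intro derivative_intros h')
    hence "deriv (\<lambda>u. h u + C) u = deriv h u" by (intro DERIV_imp_deriv) simp
    thus ?thesis using deriv_shift[of h \<tau> u] assms(3) by (simp add: add.commute)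
  qed
  ultimately obtain d where d: "\<And>u. deriv h u = d"
    using entire_doubly_periodic_constant[OF tau] by metis
  have "((\<lambda>u. h u - d * u) has_field_derivative 0) (at u within UNIV)" for u
    using h'[of u] d by (auto intro!: derivative_eq_intros)
  then obtain e where e: "\<And>u. h u - d * u = e"
    using has_field_derivative_zero_constant[of UNIV "\<lambda>u. h u - d * u"] by auto
  from e[of 1] e[of 0] assms(2)[of 0] have "d = 0" by simp
  with e[of \<tau>] e[of 0] assms(3)[of 0] show "C = 0" by simp
qed

text \<open>
  Subtracting from \<open>f\<close> its residues times translates of \<open>theta_zeta\<close> leaves no poles. The difference extends to an
  entire function of period \<open>1\<close> that gains the constant \<open>C\<close>, which is \<open>2\<pi>\<i>\<close> times the sum of the residues, under
  translation by \<open>\<tau>\<close>; such a constant is \<open>0\<close>.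
\<close>
lemma sum_residues_simple_poles:
  assumes f: "f \<in> mero_functions \<tau>"
    and simple: "\<And>p n. p \<in> D_reps \<tau> \<Longrightarrow> n < -1 \<Longrightarrow> lcoeff f p n = 0"
  shows "(\<Sum>p\<in>D_reps \<tau>. lcoeff f p (-1)) = 0"
proof -
  define r where "r = (\<lambda>p. lcoeff f p (-1))"
  define Z where "Z = (\<lambda>p u. theta_zeta \<tau> (u - p))"
  define g where "g = (\<lambda>u. f u - (\<Sum>p\<in>D_reps \<tau>. r p * Z p u))"
  define C where "C = 2 * of_real pi * \<i> * (\<Sum>p\<in>D_reps \<tau>. r p)"
  note fin = finite_D_reps
  note mero_f = mero_functionsD(2)[OF tau f]
  have mero_Z: "Z p meromorphic_on A" for p A unfolding Z_def by (rule theta_zeta_shift_meromorphic)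
  have mero_S: "(\<lambda>u. \<Sum>p\<in>D_reps \<tau>. r p * Z p u) meromorphic_on A" for A
    by (intro meromorphic_intros mero_Z)
  have mero: "g meromorphic_on A" for A
    unfolding g_def by (intro meromorphic_on_diff mero_f mero_S)
  have ana: "g analytic_on {u}" if "u \<notin> D_lift \<tau>" for u
    unfolding g_def Z_def
    by (intro analytic_on_diff analytic_on_sum analytic_on_mult analytic_on_const theta_zeta_shift_analytic that
          analytic_on_subset[OF mero_functionsD(1)[OF tau f]]) (use that in auto)
  have g1: "g (u + 1) = g u" for u
  proof -
    have "Z p (u + 1) = Z p u" for p
      using theta_zeta_add_1[of "u - p"] by (simp add: Z_def algebra_simps)
    thus ?thesis by (simp add: g_def mero_functionsD(3)[OF tau f])
  qed
  have g_tau: "g (u + \<tau>) = g u + C" if "u \<notin> D_lift \<tau>" for u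
  proof -
    have "Z p (u + \<tau>) = Z p u - 2 * of_real pi * \<i>" if "p \<in> D_reps \<tau>" for p
      using theta_zeta_add_tau[OF theta_zeta_shift_analytic(2)[OF that \<open>u \<notin> D_lift \<tau>\<close>]] by (simp add: Z_def algebra_simps)
    hence "(\<Sum>p\<in>D_reps \<tau>. r p * Z p (u + \<tau>)) = (\<Sum>p\<in>D_reps \<tau>. r p * Z p u - 2 * of_real pi * \<i> * r p)"
      by (intro sum.cong refl) (simp only: right_diff_distrib mult.commute)
    thus ?thesis by (simp add: g_def C_def mero_functionsD(4)[OF tau f] sum_subtractf sum_distrib_left)
  qed
  have g_lattice: "\<exists>c. \<forall>u. u \<notin> D_lift \<tau> \<longrightarrow> g (u + v) = g u + c" if "v \<in> period_lattice \<tau>" for v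
  proof -
    obtain m n where v: "v = of_int m + of_int n * \<tau>" using \<open>v \<in> _\<close> by (rule period_lattice_cases)
    have "g (u + v) = g u + of_int m * 0 + of_int n * C" if "u \<notin> D_lift \<tau>" for u
      unfolding v
      by (rule additive_shift_period_lattice[of "- D_lift \<tau>"]) (use that g1 g_tau in \<open>auto simp: D_lift_add_iff[OF tau]\<close>)
    thus ?thesis by (auto intro!: exI[of _ "of_int n * C"])
  qed
  have low: "lcoeff g p n = 0" if p: "p \<in> D_reps \<tau>" and n: "n < 0" for p n
  proof -
    have "lcoeff g p n = lcoeff f p n - (\<Sum>q\<in>D_reps \<tau>. r q * lcoeff (Z q) p n)"
      unfolding g_def
      by (subst lcoeff_diff, rule mero_f, rule mero_S, subst lcoeff_sum, rule fin)
         (intro meromorphic_on_mult meromorphic_on_const mero_Z, simp add: lcoeff_cmult mero_Z)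
    also have "(\<Sum>q\<in>D_reps \<tau>. r q * lcoeff (Z q) p n) = (\<Sum>q\<in>D_reps \<tau>. if q = p then r p * lcoeff (Z p) p n else 0)"
      using theta_zeta_shift_lcoeff(3)[OF _ p _ n] by (intro sum.cong refl) (auto simp: Z_def)
    also have "\<dots> = r p * lcoeff (Z p) p n" using p fin[of \<tau>] by simp
    also have "lcoeff f p n - \<dots> = 0"
    proof (cases "n = -1")
      case True
      thus ?thesis using theta_zeta_shift_lcoeff(2)[OF p p] by (simp add: Z_def r_def)
    next
      case False
      thus ?thesis using n simple[OF p, of n] theta_zeta_shift_lcoeff(1)[OF p p, of n] by (simp add: Z_def)
    qed
    finally show ?thesis .
  qed
  have no_pole: "\<not> is_pole g z" for z
  proof (cases "z \<in> D_lift \<tau>")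
    case False
    thus ?thesis using ana analytic_at_imp_no_pole by blast
  next
    case True
    then obtain p where p: "p \<in> D_reps \<tau>" "z - p \<in> period_lattice \<tau>" by (auto simp: D_lift_iff[OF tau])
    obtain c where c: "\<And>u. u \<notin> D_lift \<tau> \<Longrightarrow> g (u + (z - p)) = g u + c" using g_lattice[OF p(2)] by blast
    have "lcoeff g z n = 0" if n: "n < 0" for n
    proof -
      have "lcoeff g z n = lcoeff (\<lambda>u. g (u + (z - p))) p n"
        by (subst lcoeff_shift) (simp_all add: mero)
      also have "\<dots> = lcoeff (\<lambda>u. g u + c) p n"
        by (rule lcoeff_cong_ev, rule eventually_mono[OF eventually_not_in_D_lift[OF tau]]) (rule c)
      also have "\<dots> = lcoeff g p n + lcoeff (\<lambda>_. c) p n"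
        by (intro lcoeff_add mero meromorphic_on_const)
      also have "\<dots> = 0" using low[OF p(1) n] analytic_lcoeff(1)[of "\<lambda>_. c" p n] n by simp
      finally show ?thesis .
    qed
    thus ?thesis using mero not_is_pole_iff_lcoeff by blast
  qed
  define h where "h = remove_sings g"
  have h: "h holomorphic_on UNIV" unfolding h_def by (intro remove_sings_entire mero no_pole)
  have h_eq: "h u = g u" if "u \<notin> D_lift \<tau>" for u
    unfolding h_def by (intro remove_sings_at_analytic ana that)
  have "C = 0"
  proof (rule entire_additively_quasiperiodic[OF h])
    have shift: "(\<lambda>u. h (u + w)) holomorphic_on UNIV" for w
      by (rule entire_compose[OF h]) (intro holomorphic_intros)
    show "h (u + 1) = h u" for u
      by (rule entire_eq_off_D_lift[OF shift h]) (simp add: h_eq g1 tau)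
    have "(\<lambda>u. h u + C) holomorphic_on UNIV" by (intro holomorphic_intros h)
    from entire_eq_off_D_lift[OF shift this] show "h (u + \<tau>) = h u + C" for u
      by (simp add: h_eq g_tau tau)
  qed
  thus ?thesis by (simp add: C_def r_def)
qed

text \<open>
  Induction over the total excess of the pole orders over \<open>d\<close>. The functions \<open>B p k\<close> are building blocks: \<open>B p k\<close> has
  a pole of exact order \<open>k\<close> at \<open>p\<close> and poles of order at most \<open>d\<close> elsewhere, so that a suitable multiple of it removes
  the leading term of \<open>f\<close> at \<open>p\<close> without raising the excess at the other points.
\<close>
lemma pole_reduction [consumes 1, case_names generator base step]:
  fixes d :: nat
  assumes f: "f \<in> mero_functions \<tau>"
    and gen: "\<And>p k. p \<in> D_reps \<tau> \<Longrightarrow> d < k \<Longrightarrow> B p k \<in> mero_functions \<tau> \<and>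
        (\<forall>n < - int k. lcoeff (B p k) p n = 0) \<and> lcoeff (B p k) p (- int k) \<noteq> 0 \<and>
        (\<forall>q \<in> D_reps \<tau> - {p}. \<forall>n < - int d. lcoeff (B p k) q n = 0)"
    and base: "\<And>g. g \<in> mero_functions \<tau> \<Longrightarrow> (\<And>p n. p \<in> D_reps \<tau> \<Longrightarrow> n < - int d \<Longrightarrow> lcoeff g p n = 0) \<Longrightarrow> P g"
    and step: "\<And>g c p k. g \<in> mero_functions \<tau> \<Longrightarrow> p \<in> D_reps \<tau> \<Longrightarrow> d < k \<Longrightarrow> P g \<Longrightarrow> P (\<lambda>u. g u + c * B p k u)"
  shows "P f"
proof -
  note fin = finite_D_reps
  have main: "P f" if "f \<in> mero_functions \<tau>" "(\<Sum>p\<in>D_reps \<tau>. m p) = N"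
    "\<And>p n. p \<in> D_reps \<tau> \<Longrightarrow> n < - int (d + m p) \<Longrightarrow> lcoeff f p n = 0" for f N and m :: "complex \<Rightarrow> nat"
    using that
  proof (induction N arbitrary: f m)
    case 0
    hence "m p = 0" if "p \<in> D_reps \<tau>" for p using fin[of \<tau>] that by simp
    thus ?case using 0 by (intro base) auto
  next
    case (Suc N)
    then obtain p where p: "p \<in> D_reps \<tau>" "m p \<noteq> 0"
      using sum.neutral by (metis nat.distinct(1))
    then obtain j where j: "m p = Suc j" by (cases "m p") auto
    define k where "k = Suc (d + j)"
    note B = gen[OF p(1), of k]
    have BV: "B p k \<in> mero_functions \<tau>" using B by (simp add: k_def)
    define c where "c = lcoeff f p (- int k) / lcoeff (B p k) p (- int k)"
    define g where "g = (\<lambda>u. f u - c * B p k u)"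
    define m' where "m' = m(p := j)"
    have g: "g \<in> mero_functions \<tau>"
      unfolding g_def by (intro mero_functions_diff mero_functions_cmult Suc.prems BV tau)
    have lg: "lcoeff g q n = lcoeff f q n - c * lcoeff (B p k) q n" for q n
    proof -
      have "lcoeff g q n = lcoeff f q n - lcoeff (\<lambda>u. c * B p k u) q n" unfolding g_def
        by (intro lcoeff_diff meromorphic_on_mult meromorphic_on_const mero_functionsD(2)[OF tau] Suc.prems BV)
      thus ?thesis by (simp add: lcoeff_cmult mero_functionsD(2)[OF tau BV])
    qed
    have "P g"
    proof (rule Suc.IH[OF g])
      have "(\<Sum>q\<in>D_reps \<tau>. m q) = m p + (\<Sum>q\<in>D_reps \<tau> - {p}. m q)"
           "(\<Sum>q\<in>D_reps \<tau>. m' q) = m' p + (\<Sum>q\<in>D_reps \<tau> - {p}. m' q)"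
        using p(1) fin by (auto intro: sum.remove)
      moreover have "(\<Sum>q\<in>D_reps \<tau> - {p}. m' q) = (\<Sum>q\<in>D_reps \<tau> - {p}. m q)"
        by (intro sum.cong) (auto simp: m'_def)
      ultimately show "(\<Sum>q\<in>D_reps \<tau>. m' q) = N" using Suc.prems(2) j by (simp add: m'_def)
      show "lcoeff g q n = 0" if q: "q \<in> D_reps \<tau>" and n: "n < - int (d + m' q)" for q n
      proof (cases "q = p")
        case False
        thus ?thesis using B q n Suc.prems(3)[OF q, of n] by (simp add: lg m'_def k_def)
      next
        case True
        show ?thesis
        proof (cases "n = - int k")
          case True
          thus ?thesis using B \<open>q = p\<close> by (simp add: lg c_def k_def)
        next
          case False
          hence "n < - int k" using n \<open>q = p\<close> by (simp add: m'_def k_def)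
          thus ?thesis using B \<open>q = p\<close> Suc.prems(3)[OF p(1), of n] j by (simp add: lg k_def)
        qed
      qed
    qed
    hence "P (\<lambda>u. g u + c * B p k u)" using p(1) g by (intro step) (auto simp: k_def)
    thus ?case by (simp add: g_def)
  qed
  have "\<exists>k. \<forall>n < - int k. lcoeff f p n = 0" for p
    using lcoeff_eventually_bounded[of f p] mero_functionsD(2)[OF tau f] by metis
  then obtain m where m: "\<And>p n. n < - int (m p) \<Longrightarrow> lcoeff f p n = 0" by metis
  show ?thesis by (rule main[OF f refl, of m]) (use m in auto)
qed

lemma theta_zeta_deriv_in_mero_functions: "p \<in> D_reps \<tau> \<Longrightarrow> theta_zeta_deriv \<tau> p k \<in> mero_functions \<tau>"
proof (induction k)
  case 0
  define f where "f = (\<lambda>u. theta_zeta \<tau> (u - p))"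
  have ana: "f analytic_on - D_lift \<tau>"
    unfolding f_def using theta_zeta_shift_analytic(1)[OF 0] by (subst analytic_on_analytic_at) auto
  show ?case unfolding theta_zeta_deriv.simps f_def [symmetric]
  proof (rule on_M_in_mero_functions[OF tau])
    show "deriv f analytic_on - D_lift \<tau>" using ana by (rule analytic_deriv)
    show "deriv f meromorphic_on D_lift \<tau>"
      unfolding f_def by (intro meromorphic_on_deriv theta_zeta_shift_meromorphic)
    fix u assume u: "u \<notin> D_lift \<tau>"
    have "f (v + 1) = f v" for v using theta_zeta_add_1[of "v - p"] by (simp add: f_def algebra_simps)
    thus "deriv f (u + 1) = deriv f u" using deriv_shift[of f 1 u] by (simp add: add.commute)
    have f': "(f has_field_derivative deriv f u) (at u)"
      using ana u by (intro analytic_derivI) (auto intro: analytic_on_subset)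
    have "((\<lambda>v. f v - 2 * of_real pi * \<i>) has_field_derivative deriv f u - 0) (at u)"
      by (intro derivative_intros f')
    moreover have "\<forall>\<^sub>F v in nhds u. f v - 2 * of_real pi * \<i> = f (v + \<tau>)"
    proof -
      have "\<forall>\<^sub>F v in nhds u. v \<in> - D_lift \<tau>"
        using u by (intro eventually_nhds_in_open open_compl_D_lift tau) auto
      thus ?thesis
        by eventually_elim
           (use theta_zeta_add_tau[OF theta_zeta_shift_analytic(2)[OF 0]] in \<open>simp add: f_def algebra_simps\<close>)
    qed
    ultimately have "((\<lambda>v. f (v + \<tau>)) has_field_derivative deriv f u) (at u)"
      by (simp add: DERIV_cong_ev[OF refl _ refl])
    hence "deriv (\<lambda>v. f (v + \<tau>)) u = deriv f u" by (rule DERIV_imp_deriv)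
    thus "deriv f (u + \<tau>) = deriv f u" using deriv_shift[of f \<tau> u] by (simp add: add.commute)
  qed
next
  case (Suc k)
  thus ?case using mero_functions_deriv[OF tau] by simp
qed

lemma theta_zeta_deriv_lcoeff:
  assumes p: "p \<in> D_reps \<tau>" and q: "q \<in> D_reps \<tau>"
  shows "n < - int (k + 2) \<Longrightarrow> lcoeff (theta_zeta_deriv \<tau> p k) q n = 0"
    and "q \<noteq> p \<Longrightarrow> n < 0 \<Longrightarrow> lcoeff (theta_zeta_deriv \<tau> p k) q n = 0"
    and "q = p \<Longrightarrow> lcoeff (theta_zeta_deriv \<tau> p k) q (- int (k + 2)) \<noteq> 0"
    and "lcoeff (theta_zeta_deriv \<tau> p k) q (-1) = 0"
proof -
  have rec0: "lcoeff (theta_zeta_deriv \<tau> p 0) q n = of_int (n + 1) * lcoeff (\<lambda>u. theta_zeta \<tau> (u - p)) q (n + 1)" for n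
    by (simp add: lcoeff_on_M tau lcoeff_deriv theta_zeta_shift_meromorphic)
  have recS: "lcoeff (theta_zeta_deriv \<tau> p (Suc k)) q n = of_int (n + 1) * lcoeff (theta_zeta_deriv \<tau> p k) q (n + 1)" for n k
    using mero_functionsD(2)[OF tau theta_zeta_deriv_in_mero_functions[OF p]]
    by (simp add: lcoeff_on_M tau lcoeff_deriv)
  show "lcoeff (theta_zeta_deriv \<tau> p k) q (-1) = 0" by (cases k) (simp_all add: rec0 recS del: theta_zeta_deriv.simps)
  show "n < - int (k + 2) \<Longrightarrow> lcoeff (theta_zeta_deriv \<tau> p k) q n = 0"
    by (induction k arbitrary: n)
       (simp_all add: rec0 recS theta_zeta_shift_lcoeff(1)[OF p q] del: theta_zeta_deriv.simps)
  show "q \<noteq> p \<Longrightarrow> n < 0 \<Longrightarrow> lcoeff (theta_zeta_deriv \<tau> p k) q n = 0"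
  proof (induction k arbitrary: n)
    case 0
    thus ?case using theta_zeta_shift_lcoeff(3)[OF p q, of "n + 1"]
      by (cases "n = -1") (simp_all add: rec0 del: theta_zeta_deriv.simps)
  next
    case (Suc k)
    thus ?case using Suc.IH[of "n + 1"] by (cases "n = -1") (simp_all add: recS del: theta_zeta_deriv.simps)
  qed
  show "q = p \<Longrightarrow> lcoeff (theta_zeta_deriv \<tau> p k) q (- int (k + 2)) \<noteq> 0"
  proof (induction k)
    case 0
    thus ?case using theta_zeta_shift_lcoeff(2)[OF p q] rec0[of "-2"] by simp
  next
    case (Suc k)
    have eq: "- int (Suc k + 2) + 1 = - int (k + 2)" by simp
    have "of_int (- int (k + 2)) \<noteq> (0 :: complex)" by (simp only: of_int_eq_0_iff)
    thus ?case using Suc unfolding recS eq mult_eq_0_iff by blast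
  qed
qed

text \<open>
  The derivatives of \<open>theta_zeta\<close> have no residues, and subtracting them reduces all poles to simple ones.
\<close>
theorem sum_residues_eq_0:
  assumes "f \<in> mero_functions \<tau>"
  shows "(\<Sum>p\<in>D_reps \<tau>. lcoeff f p (-1)) = 0"
  using assms
proof (induction f rule: pole_reduction[where d = 1 and B = "\<lambda>p k. theta_zeta_deriv \<tau> p (k - 2)"])
  case (generator p k)
  hence k: "int (k - 2 + 2) = int k" by simp
  have "lcoeff (theta_zeta_deriv \<tau> p (k - 2)) q n = 0" if "q \<in> D_reps \<tau> - {p}" "n < - int 1" for q n
    using theta_zeta_deriv_lcoeff(2)[OF generator(1), of q n "k - 2"] that by simp
  thus ?case
    using theta_zeta_deriv_in_mero_functions[OF generator(1), of "k - 2"]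
      theta_zeta_deriv_lcoeff(1)[OF generator(1,1), of _ "k - 2", unfolded k]
      theta_zeta_deriv_lcoeff(3)[OF generator(1,1) refl, of "k - 2", unfolded k] by blast
next
  case (step g c p k)
  have "lcoeff (\<lambda>u. g u + c * theta_zeta_deriv \<tau> p (k - 2) u) q (-1) = lcoeff g q (-1)" if q: "q \<in> D_reps \<tau>" for q
  proof -
    have mero: "theta_zeta_deriv \<tau> p (k - 2) meromorphic_on {q}"
      by (rule mero_functionsD(2)[OF tau theta_zeta_deriv_in_mero_functions[OF step(2)]])
    have "lcoeff (\<lambda>u. g u + c * theta_zeta_deriv \<tau> p (k - 2) u) q (-1) =
        lcoeff g q (-1) + lcoeff (\<lambda>u. c * theta_zeta_deriv \<tau> p (k - 2) u) q (-1)"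
      by (intro lcoeff_add meromorphic_on_mult meromorphic_on_const mero mero_functionsD(2)[OF tau step(1)])
    also have "lcoeff (\<lambda>u. c * theta_zeta_deriv \<tau> p (k - 2) u) q (-1) = 0"
      using theta_zeta_deriv_lcoeff(4)[OF step(2) q] mero by (simp add: lcoeff_cmult)
    finally show ?thesis by simp
  qed
  thus ?case using step(4) by (simp cong: sum.cong)
next
  case (base g)
  thus ?case by (intro sum_residues_simple_poles) auto
qed

end

section \<open>The connection form and the four cocycles\<close>

text \<open>
  Writing \<open>1/f = (f'/f) (1/f')\<close>, where \<open>1/f'\<close> is holomorphic at \<open>p\<close>, reduces this to the logarithmic derivative.
\<close>
lemma inverse_lcoeff:
  assumes "f analytic_on {p}" "f p = 0" "deriv f p \<noteq> 0"
  shows "n < -1 \<Longrightarrow> lcoeff (\<lambda>u. 1 / f u) p n = 0"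
    and "lcoeff (\<lambda>u. 1 / f u) p (-1) \<noteq> 0"
proof -
  have ana: "(\<lambda>u. 1 / deriv f u) analytic_on {p}"
    using assms(3) by (intro analytic_on_divide analytic_deriv assms(1) analytic_on_const) auto
  have mero: "logderiv f meromorphic_on {p}" "(\<lambda>u. 1 / deriv f u) meromorphic_on {p}"
    unfolding logderiv_def[abs_def] by (intro meromorphic_intros analytic_on_imp_meromorphic_on assms(1))+
  have "deriv f \<midarrow>p\<rightarrow> deriv f p"
    using analytic_deriv[OF assms(1)] analytic_at_imp_isCont isContD by blast
  hence "\<forall>\<^sub>F u in at p. deriv f u \<noteq> 0" by (rule tendsto_imp_eventually_ne[OF _ assms(3)])
  hence eq: "lcoeff (\<lambda>u. 1 / f u) p n = lcoeff (\<lambda>u. logderiv f u * (1 / deriv f u)) p n" for n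
    by (intro lcoeff_cong_ev) (auto elim!: eventually_mono simp: logderiv_def)
  have low: "\<And>i. i < 0 \<Longrightarrow> lcoeff (\<lambda>u. 1 / deriv f u) p i = 0"
    by (rule analytic_lcoeff[OF ana])
  show "n < -1 \<Longrightarrow> lcoeff (\<lambda>u. 1 / f u) p n = 0"
    using lcoeff_mult_lowest(1)[OF mero, of "-1" 0 n] logderiv_lcoeff(1)[OF assms] low by (simp add: eq)
  show "lcoeff (\<lambda>u. 1 / f u) p (-1) \<noteq> 0"
    using lcoeff_mult_lowest(2)[OF mero, of "-1" 0] logderiv_lcoeff[OF assms] low
      analytic_lcoeff(2)[OF ana] assms(3) by (simp add: eq)
qed

text \<open>
  What the computation of principal parts uses about each of the four theta functions: among the points of \<open>D\<close> it
  vanishes at \<open>p\<close> alone, to first order.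
\<close>
definition simple_theta :: "complex \<Rightarrow> (complex \<Rightarrow> complex) \<Rightarrow> complex \<Rightarrow> bool" where
  "simple_theta \<tau> f p \<longleftrightarrow> (\<forall>A. f analytic_on A) \<and> p \<in> D_reps \<tau> \<and> f p = 0 \<and> deriv f p \<noteq> 0 \<and>
     (\<forall>q \<in> D_reps \<tau> - {p}. f q \<noteq> 0)"

context
  fixes \<tau> :: complex
  assumes tau: "Im \<tau> > 0"
begin

lemma deriv_theta_zeros:
  "deriv (theta2 \<tau>) (1/2) \<noteq> 0" "deriv (theta4 \<tau>) (\<tau>/2) \<noteq> 0"
proof -
  have "deriv (theta2 \<tau>) u = deriv (theta1 \<tau>) (u + 1/2)" for u
    using deriv_shift[of "theta1 \<tau>" "1/2" u] by (simp add: theta2_conv_theta1[abs_def] add.commute)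
  hence "deriv (theta2 \<tau>) (1/2) = deriv (theta1 \<tau>) (0 + 1)" by simp
  also have "\<dots> = deriv (\<lambda>u. - theta1 \<tau> u) 0"
    using deriv_shift[of "theta1 \<tau>" 1 0] by (simp add: theta1_add_1 add.commute)
  also have "\<dots> = - deriv (theta1 \<tau>) 0"
    by (intro deriv_minus holomorphic_on_imp_differentiable_at[OF theta_entire(1)[OF tau]]) auto
  finally show "deriv (theta2 \<tau>) (1/2) \<noteq> 0" using deriv_theta1_0[OF tau] by simp
  have "deriv (theta4 \<tau>) (\<tau>/2) = deriv (theta3 \<tau>) (\<tau>/2 + 1/2)"
    using deriv_shift[of "theta3 \<tau>" "1/2" "\<tau>/2"] by (simp add: theta4_conv_theta3[abs_def] add.commute)
  also have "\<tau>/2 + 1/2 = (1 + \<tau>)/2" by (simp add: add_divide_distrib)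
  finally show "deriv (theta4 \<tau>) (\<tau>/2) \<noteq> 0" using deriv_theta3_zero[OF tau] by simp
qed

lemma D_reps_mem: "0 \<in> D_reps \<tau>" "1/2 \<in> D_reps \<tau>" "(1 + \<tau>)/2 \<in> D_reps \<tau>" "\<tau>/2 \<in> D_reps \<tau>"
  by (auto simp: D_reps_def)

lemma theta_nonzero_at_D_reps:
  assumes "q \<in> D_reps \<tau>"
  shows "q \<noteq> 0 \<Longrightarrow> theta1 \<tau> q \<noteq> 0" "q \<noteq> 1/2 \<Longrightarrow> theta2 \<tau> q \<noteq> 0"
    "q \<noteq> (1 + \<tau>)/2 \<Longrightarrow> theta3 \<tau> q \<noteq> 0" "q \<noteq> \<tau>/2 \<Longrightarrow> theta4 \<tau> q \<noteq> 0"
  using D_reps_diff_not_in_period_lattice[OF tau assms] D_reps_mem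
    theta1_eq_0_iff[OF tau] theta2_eq_0_iff[OF tau] theta3_eq_0_iff[OF tau] theta4_eq_0_iff[OF tau]
  by (metis diff_zero)+

lemma theta_zero_at_D_reps:
  "theta1 \<tau> 0 = 0" "theta2 \<tau> (1/2) = 0" "theta3 \<tau> ((1 + \<tau>)/2) = 0" "theta4 \<tau> (\<tau>/2) = 0"
  by (simp_all add: theta1_eq_0_iff[OF tau] theta2_eq_0_iff[OF tau] theta3_eq_0_iff[OF tau]
     theta4_eq_0_iff[OF tau] zero_in_period_lattice)

lemma theta_nonzero_off_D_lift:
  assumes "u \<notin> D_lift \<tau>"
  shows "theta1 \<tau> u \<noteq> 0" "theta2 \<tau> u \<noteq> 0" "theta3 \<tau> u \<noteq> 0" "theta4 \<tau> u \<noteq> 0"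
  using assms by (auto simp: D_lift_iff_theta[OF tau])

lemma theta_analytic:
  "theta1 \<tau> analytic_on A" "theta2 \<tau> analytic_on A" "theta3 \<tau> analytic_on A" "theta4 \<tau> analytic_on A"
  by (intro entire_analytic theta_entire tau)+

lemma theta_meromorphic:
  "theta1 \<tau> meromorphic_on A" "theta2 \<tau> meromorphic_on A"
  "theta3 \<tau> meromorphic_on A" "theta4 \<tau> meromorphic_on A"
  by (intro analytic_on_imp_meromorphic_on theta_analytic)+

lemma simple_theta:
  "simple_theta \<tau> (theta1 \<tau>) 0" "simple_theta \<tau> (theta2 \<tau>) (1/2)"
  "simple_theta \<tau> (theta3 \<tau>) ((1 + \<tau>)/2)" "simple_theta \<tau> (theta4 \<tau>) (\<tau>/2)"
proof -
  show "simple_theta \<tau> (theta1 \<tau>) 0"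
    unfolding simple_theta_def using theta_analytic(1) D_reps_mem(1) theta_zero_at_D_reps(1)
      deriv_theta1_0[OF tau] theta_nonzero_at_D_reps(1) by blast
  show "simple_theta \<tau> (theta2 \<tau>) (1/2)"
    unfolding simple_theta_def using theta_analytic(2) D_reps_mem(2) theta_zero_at_D_reps(2)
      deriv_theta_zeros(1) theta_nonzero_at_D_reps(2) by blast
  show "simple_theta \<tau> (theta3 \<tau>) ((1 + \<tau>)/2)"
    unfolding simple_theta_def using theta_analytic(3) D_reps_mem(3) theta_zero_at_D_reps(3)
      deriv_theta3_zero[OF tau] theta_nonzero_at_D_reps(3) by blast
  show "simple_theta \<tau> (theta4 \<tau>) (\<tau>/2)"
    unfolding simple_theta_def using theta_analytic(4) D_reps_mem(4) theta_zero_at_D_reps(4)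
      deriv_theta_zeros(2) theta_nonzero_at_D_reps(4) by blast
qed

lemma simple_theta_logderiv_lcoeff:
  assumes "simple_theta \<tau> f p" "q \<in> D_reps \<tau>"
  shows "n < -1 \<Longrightarrow> lcoeff (logderiv f) q n = 0"
    and "lcoeff (logderiv f) q (-1) = (if q = p then 1 else 0)"
proof -
  have f: "f analytic_on {q}" "q = p \<Longrightarrow> f q = 0" "q = p \<Longrightarrow> deriv f q \<noteq> 0" "q \<noteq> p \<Longrightarrow> f q \<noteq> 0"
    using assms by (auto simp: simple_theta_def)
  have "logderiv f analytic_on {q}" if "q \<noteq> p"
    unfolding logderiv_def[abs_def] using that f by (intro analytic_on_divide analytic_deriv) auto
  note an = analytic_lcoeff(1)[OF this]
  show "n < -1 \<Longrightarrow> lcoeff (logderiv f) q n = 0"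
    using logderiv_lcoeff(1)[OF f(1-3)] an[of n] by (cases "q = p") auto
  show "lcoeff (logderiv f) q (-1) = (if q = p then 1 else 0)"
    using logderiv_lcoeff(2)[OF f(1-3)] an[of "-1"] by (cases "q = p") auto
qed

lemma omega_conv_logderiv:
  "omega \<tau> \<alpha> \<beta> \<gamma> u = 2 * \<alpha> * logderiv (theta1 \<tau>) u + (2 * \<gamma> - 2 * \<alpha>) * logderiv (theta2 \<tau>) u +
     (- 2 * \<beta>) * logderiv (theta3 \<tau>) u + (2 * \<beta> - 2 * \<gamma>) * logderiv (theta4 \<tau>) u"
  by (simp only: omega_def logderiv_def)

text \<open>
  Under translation by \<open>\<tau>\<close> each logarithmic derivative gains \<open>- 2\<pi>\<i>\<close>; the weights
  \<open>2\<alpha>, 2\<gamma> - 2\<alpha>, - 2\<beta>, 2\<beta> - 2\<gamma>\<close> sum to \<open>0\<close>, so these constants cancel.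
\<close>
lemma omega_on_M: "on_M \<tau> (omega \<tau> \<alpha> \<beta> \<gamma>) \<in> mero_functions \<tau>"
proof (rule on_M_in_mero_functions[OF tau])
  have "omega \<tau> \<alpha> \<beta> \<gamma> analytic_on {u}" if "u \<notin> D_lift \<tau>" for u
    unfolding omega_def
    by (intro analytic_on_add analytic_on_mult analytic_on_const analytic_on_divide analytic_deriv
          theta_analytic) (use theta_nonzero_off_D_lift[OF that] in auto)
  thus "omega \<tau> \<alpha> \<beta> \<gamma> analytic_on - D_lift \<tau>" by (subst analytic_on_analytic_at) auto
  show "omega \<tau> \<alpha> \<beta> \<gamma> meromorphic_on D_lift \<tau>"
    unfolding omega_def by (intro meromorphic_intros theta_meromorphic)
  fix u assume u: "u \<notin> D_lift \<tau>"
  have 1: "logderiv (theta1 \<tau>) (u + 1) = logderiv (theta1 \<tau>) u"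
    by (rule logderiv_shift_constant_factor[where s = "-1"]) (simp_all add: theta1_add_1 theta_entire tau)
  have 2: "logderiv (theta2 \<tau>) (u + 1) = logderiv (theta2 \<tau>) u"
    by (rule logderiv_shift_constant_factor[where s = "-1"]) (simp_all add: theta2_add_1 theta_entire tau)
  have 3: "logderiv (theta3 \<tau>) (u + 1) = logderiv (theta3 \<tau>) u"
    by (rule logderiv_shift_constant_factor[where s = 1]) (simp_all add: theta3_add_1 theta_entire tau)
  have 4: "logderiv (theta4 \<tau>) (u + 1) = logderiv (theta4 \<tau>) u"
    by (rule logderiv_shift_constant_factor[where s = 1]) (simp_all add: theta4_add_1 theta_entire tau)
  show "omega \<tau> \<alpha> \<beta> \<gamma> (u + 1) = omega \<tau> \<alpha> \<beta> \<gamma> u"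
    unfolding omega_conv_logderiv 1 2 3 4 ..
  note nz = theta_nonzero_off_D_lift[OF u]
  have 1: "logderiv (theta1 \<tau>) (u + \<tau>) = logderiv (theta1 \<tau>) u - 2 * of_real pi * \<i>"
    by (rule logderiv_shift_exponential_factor[where s = "-1" and a = "- \<tau>/2"])
       (simp_all add: theta1_add_tau theta_entire tau nz)
  have 2: "logderiv (theta2 \<tau>) (u + \<tau>) = logderiv (theta2 \<tau>) u - 2 * of_real pi * \<i>"
    by (rule logderiv_shift_exponential_factor[where s = 1 and a = "- \<tau>/2"])
       (simp_all add: theta2_add_tau theta_entire tau nz)
  have 3: "logderiv (theta3 \<tau>) (u + \<tau>) = logderiv (theta3 \<tau>) u - 2 * of_real pi * \<i>"
    by (rule logderiv_shift_exponential_factor[where s = 1 and a = "- \<tau>/2"])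
       (simp_all add: theta3_add_tau theta_entire tau nz)
  have 4: "logderiv (theta4 \<tau>) (u + \<tau>) = logderiv (theta4 \<tau>) u - 2 * of_real pi * \<i>"
    by (rule logderiv_shift_exponential_factor[where s = "-1" and a = "- \<tau>/2"])
       (simp_all add: theta4_add_tau theta_entire tau nz)
  show "omega \<tau> \<alpha> \<beta> \<gamma> (u + \<tau>) = omega \<tau> \<alpha> \<beta> \<gamma> u"
    unfolding omega_conv_logderiv 1 2 3 4 by (simp add: algebra_simps)
qed

lemma omega_odd: "omega \<tau> \<alpha> \<beta> \<gamma> (- u) = - omega \<tau> \<alpha> \<beta> \<gamma> u"
proof -
  have 1: "logderiv (theta1 \<tau>) (- u) = - logderiv (theta1 \<tau>) u"
    by (rule logderiv_minus[where s = "-1"]) (simp_all add: theta1_minus theta_entire tau)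
  have 2: "logderiv (theta2 \<tau>) (- u) = - logderiv (theta2 \<tau>) u"
    by (rule logderiv_minus[where s = 1]) (simp_all add: theta2_minus theta_entire tau)
  have 3: "logderiv (theta3 \<tau>) (- u) = - logderiv (theta3 \<tau>) u"
    by (rule logderiv_minus[where s = 1]) (simp_all add: theta3_minus theta_entire tau)
  have 4: "logderiv (theta4 \<tau>) (- u) = - logderiv (theta4 \<tau>) u"
    by (rule logderiv_minus[where s = 1]) (simp_all add: theta4_minus theta_entire tau)
  show ?thesis unfolding omega_conv_logderiv 1 2 3 4 by (simp add: algebra_simps)
qed

lemma omega_meromorphic: "omega \<tau> \<alpha> \<beta> \<gamma> meromorphic_on A"
  unfolding omega_def[abs_def] by (intro meromorphic_intros theta_meromorphic)

lemma omega_lcoeff: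
  assumes q: "q \<in> D_reps \<tau>"
  shows "n < -1 \<Longrightarrow> lcoeff (omega \<tau> \<alpha> \<beta> \<gamma>) q n = 0"
    and "lcoeff (omega \<tau> \<alpha> \<beta> \<gamma>) q (-1) =
      2 * \<alpha> * (if q = 0 then 1 else 0) + (2 * \<gamma> - 2 * \<alpha>) * (if q = 1/2 then 1 else 0) +
      (- 2 * \<beta>) * (if q = (1 + \<tau>)/2 then 1 else 0) + (2 * \<beta> - 2 * \<gamma>) * (if q = \<tau>/2 then 1 else 0)"
proof -
  have mero: "logderiv (theta1 \<tau>) meromorphic_on A" "logderiv (theta2 \<tau>) meromorphic_on A"
    "logderiv (theta3 \<tau>) meromorphic_on A" "logderiv (theta4 \<tau>) meromorphic_on A" for A
    unfolding logderiv_def[abs_def] by (intro meromorphic_intros theta_meromorphic)+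
  note cmult = mero[THEN meromorphic_on_mult[OF meromorphic_on_const]]
  have "lcoeff (omega \<tau> \<alpha> \<beta> \<gamma>) q n = 2 * \<alpha> * lcoeff (logderiv (theta1 \<tau>)) q n +
      (2 * \<gamma> - 2 * \<alpha>) * lcoeff (logderiv (theta2 \<tau>)) q n +
      (- 2 * \<beta>) * lcoeff (logderiv (theta3 \<tau>)) q n + (2 * \<beta> - 2 * \<gamma>) * lcoeff (logderiv (theta4 \<tau>)) q n" for n
    unfolding omega_conv_logderiv[abs_def]
    by (simp only: lcoeff_add lcoeff_cmult cmult mero meromorphic_on_add)
  note eq = this simple_theta_logderiv_lcoeff[OF simple_theta(1) q] simple_theta_logderiv_lcoeff[OF simple_theta(2) q]
    simple_theta_logderiv_lcoeff[OF simple_theta(3) q] simple_theta_logderiv_lcoeff[OF simple_theta(4) q]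
  show "n < -1 \<Longrightarrow> lcoeff (omega \<tau> \<alpha> \<beta> \<gamma>) q n = 0" by (simp add: eq)
  show "lcoeff (omega \<tau> \<alpha> \<beta> \<gamma>) q (-1) =
      2 * \<alpha> * (if q = 0 then 1 else 0) + (2 * \<gamma> - 2 * \<alpha>) * (if q = 1/2 then 1 else 0) +
      (- 2 * \<beta>) * (if q = (1 + \<tau>)/2 then 1 else 0) + (2 * \<beta> - 2 * \<gamma>) * (if q = \<tau>/2 then 1 else 0)"
    by (simp only: eq)
qed

lemma omega_residue_not_Ints:
  assumes "2 * \<alpha> \<notin> \<int>" "2 * \<gamma> - 2 * \<alpha> \<notin> \<int>" "- 2 * \<beta> \<notin> \<int>" "2 * \<beta> - 2 * \<gamma> \<notin> \<int>"
    and q: "q \<in> D_reps \<tau>"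
  shows "lcoeff (omega \<tau> \<alpha> \<beta> \<gamma>) q (-1) \<notin> \<int>"
proof -
  have ne: "(1/2::complex) \<noteq> 0" "(1 + \<tau>)/2 \<noteq> 0" "\<tau>/2 \<noteq> 0" "(1 + \<tau>)/2 \<noteq> 1/2" "\<tau>/2 \<noteq> 1/2" "\<tau>/2 \<noteq> (1 + \<tau>)/2"
    using D_reps_distinct[OF tau] by auto
  show ?thesis
    using q
  proof (cases rule: D_reps_cases[OF tau, consumes 1])
    case 1 show ?thesis using assms(1) ne ne[symmetric] unfolding omega_lcoeff(2)[OF q] unfolding 1 by simp
  next
    case 2 show ?thesis using assms(2) ne ne[symmetric] unfolding omega_lcoeff(2)[OF q] unfolding 2 by simp
  next
    case 3 show ?thesis using assms(3) ne ne[symmetric] unfolding omega_lcoeff(2)[OF q] unfolding 3 by simp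
  next
    case 4 show ?thesis using assms(4) ne ne[symmetric] unfolding omega_lcoeff(2)[OF q] unfolding 4 by simp
  qed
qed

lemma phi1_in_mero_functions: "phi1 \<tau> \<in> mero_functions \<tau>"
  unfolding phi1_def by (rule mero_functions_const[OF tau])

lemma phi_in_mero_functions:
  "phi2 \<tau> \<in> mero_functions \<tau>" "phi3 \<tau> \<in> mero_functions \<tau>" "phi4 \<tau> \<in> mero_functions \<tau>"
proof -
  note ths = theta1_add_1 theta2_add_1 theta3_add_1 theta4_add_1
    theta1_add_tau theta2_add_tau theta3_add_tau theta4_add_tau
  have *: "on_M \<tau> (\<lambda>u. c * (f u / g u)) \<in> mero_functions \<tau>"
    if "\<And>A. f analytic_on A" "\<And>A. g analytic_on A" "\<And>u. u \<notin> D_lift \<tau> \<Longrightarrow> g u \<noteq> 0"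
      "\<And>u. f (u + 1) / g (u + 1) = f u / g u" "\<And>u. f (u + \<tau>) / g (u + \<tau>) = f u / g u" for f g c
  proof (rule on_M_in_mero_functions[OF tau])
    show "(\<lambda>u. c * (f u / g u)) analytic_on - D_lift \<tau>"
      using that(3) by (intro analytic_on_mult analytic_on_const analytic_on_divide that(1,2)) auto
    show "(\<lambda>u. c * (f u / g u)) meromorphic_on D_lift \<tau>"
      by (intro meromorphic_on_mult meromorphic_on_const meromorphic_on_divide
           analytic_on_imp_meromorphic_on that(1,2))
  qed (simp_all add: that(4,5))
  show "phi2 \<tau> \<in> mero_functions \<tau>" "phi3 \<tau> \<in> mero_functions \<tau>" "phi4 \<tau> \<in> mero_functions \<tau>"
    unfolding phi2_def phi3_def phi4_def
    by (rule *; (intro analytic_on_power analytic_on_mult theta_analytic)?;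
        simp add: theta_nonzero_off_D_lift ths power_mult_distrib)+
qed

text \<open>
  As \<open>d(- u) = - du\<close>, even coefficients belong to the eigenvalue \<open>- 1\<close> of \<open>\<iota>\<^sup>*\<close> and odd ones to the eigenvalue \<open>1\<close>.
\<close>
lemma phi_odd_even:
  "phi1 \<tau> (- u) = phi1 \<tau> u" "phi2 \<tau> (- u) = phi2 \<tau> u" "phi3 \<tau> (- u) = - phi3 \<tau> u" "phi4 \<tau> (- u) = - phi4 \<tau> u"
  by (simp_all add: phi1_def phi2_def phi3_def phi4_def on_M_def D_lift_uminus_iff[OF tau]
    theta1_minus theta2_minus theta3_minus theta4_minus)

end

section \<open>Principal parts of the cocycles\<close>

lemma simple_pole_lcoeff:
  assumes "h analytic_on {p}" "f analytic_on {p}" "f p = 0" "deriv f p \<noteq> 0"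
  shows "n < -1 \<Longrightarrow> lcoeff (\<lambda>u. h u * (1 / f u)) p n = 0"
    and "h p \<noteq> 0 \<Longrightarrow> lcoeff (\<lambda>u. h u * (1 / f u)) p (-1) \<noteq> 0"
proof -
  have mero: "h meromorphic_on {p}" "(\<lambda>u. 1 / f u) meromorphic_on {p}"
    by (intro meromorphic_intros analytic_on_imp_meromorphic_on assms(1,2))+
  note inv = inverse_lcoeff[OF assms(2-4)]
  show "n < -1 \<Longrightarrow> lcoeff (\<lambda>u. h u * (1 / f u)) p n = 0"
    using lcoeff_mult_lowest(1)[OF mero, of 0 "-1" n] analytic_lcoeff(1)[OF assms(1)] inv by simp
  show "h p \<noteq> 0 \<Longrightarrow> lcoeff (\<lambda>u. h u * (1 / f u)) p (-1) \<noteq> 0"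
    using lcoeff_mult_lowest(2)[OF mero, of 0 "-1"] analytic_lcoeff(1,2)[OF assms(1)] inv by simp
qed

text \<open>
  The operator \<open>\<nabla>\<close> for an arbitrary connection form \<open>W du\<close>: the computation of its cokernel relies on the principal
  parts of \<open>W\<close> alone.
\<close>
definition twisted_deriv :: "complex \<Rightarrow> (complex \<Rightarrow> complex) \<Rightarrow> (complex \<Rightarrow> complex) \<Rightarrow> complex \<Rightarrow> complex" where
  "twisted_deriv \<tau> W f = on_M \<tau> (\<lambda>u. deriv f u + f u * W u)"

lemma twisted_deriv_alt: "twisted_deriv \<tau> W f = (\<lambda>u. on_M \<tau> (deriv f) u + f u * on_M \<tau> W u)"
  by (auto simp: twisted_deriv_def on_M_def)

definition phi_comb :: "complex \<Rightarrow> complex \<Rightarrow> complex \<Rightarrow> complex \<Rightarrow> complex \<Rightarrow> complex \<Rightarrow> complex" where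
  "phi_comb \<tau> a b c d u = a * phi1 \<tau> u + b * phi2 \<tau> u + c * phi3 \<tau> u + d * phi4 \<tau> u"

context
  fixes \<tau> :: complex
  assumes tau: "Im \<tau> > 0"
begin

lemma theta_0_nonzero: "theta2 \<tau> 0 \<noteq> 0" "theta3 \<tau> 0 \<noteq> 0" "theta4 \<tau> 0 \<noteq> 0"
  using theta_nonzero_at_D_reps[OF tau, of 0] D_reps_mem[OF tau] D_reps_distinct[OF tau] by auto

lemma on_M_analytic_lcoeff: "f analytic_on {p} \<Longrightarrow> n < 0 \<Longrightarrow> lcoeff (on_M \<tau> f) p n = 0"
  by (simp add: lcoeff_on_M tau analytic_lcoeff)

lemma phi1_lcoeff: "n < 0 \<Longrightarrow> lcoeff (phi1 \<tau>) q n = 0"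
  unfolding phi1_def by (rule on_M_analytic_lcoeff) auto

lemma phi2_lcoeff:
  shows "q \<in> D_reps \<tau> \<Longrightarrow> q \<noteq> 0 \<Longrightarrow> n < 0 \<Longrightarrow> lcoeff (phi2 \<tau>) q n = 0"
    and "n < -2 \<Longrightarrow> lcoeff (phi2 \<tau>) 0 n = 0" "lcoeff (phi2 \<tau>) 0 (-2) \<noteq> 0"
proof -
  define C where "C = of_real pi * (theta2 \<tau> 0)^2"
  have C: "C \<noteq> 0" using theta_0_nonzero by (simp add: C_def)
  show "lcoeff (phi2 \<tau>) q n = 0" if "q \<in> D_reps \<tau>" "q \<noteq> 0" "n < 0"
    unfolding phi2_def using that theta_nonzero_at_D_reps(1)[OF tau that(1,2)]
    by (intro on_M_analytic_lcoeff analytic_on_mult analytic_on_const analytic_on_divide analytic_on_power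
         theta_analytic tau) auto
  define h where "h = (\<lambda>u. C * theta4 \<tau> u ^ 2)"
  have h: "h analytic_on {0}"
    unfolding h_def by (intro analytic_on_mult analytic_on_const analytic_on_power theta_analytic tau)
  define g where "g = (\<lambda>u. h u * (1 / theta1 \<tau> u))"
  define i where "i = (\<lambda>u. 1 / theta1 \<tau> u)"
  have mero: "g meromorphic_on {0}" "i meromorphic_on {0}"
    unfolding g_def i_def
    by (intro meromorphic_intros analytic_on_imp_meromorphic_on h theta_analytic tau)+
  note z = theta_analytic(1)[OF tau] theta1_0[OF tau] deriv_theta1_0[OF tau]
  have eq: "lcoeff (phi2 \<tau>) 0 n = lcoeff (\<lambda>u. g u * i u) 0 n" for n
    unfolding phi2_def lcoeff_on_M[OF tau]
    by (intro lcoeff_cong) (simp add: g_def h_def i_def C_def power2_eq_square)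
  note g = simple_pole_lcoeff[OF h z, folded g_def]
  note i = inverse_lcoeff[OF z, folded i_def]
  have "h 0 \<noteq> 0" using C theta_0_nonzero by (simp add: h_def)
  show "n < -2 \<Longrightarrow> lcoeff (phi2 \<tau>) 0 n = 0" "lcoeff (phi2 \<tau>) 0 (-2) \<noteq> 0"
    using lcoeff_mult_lowest[OF mero, of "-1" "-1"] g i \<open>h 0 \<noteq> 0\<close> by (simp_all add: eq)
qed

text \<open>
  The shape shared by \<open>phi3\<close> and \<open>phi4\<close>, whose denominators are products of two different theta functions.
\<close>
lemma two_simple_poles_lcoeff:
  assumes f: "simple_theta \<tau> f1 p1" "simple_theta \<tau> f2 p2" "p1 \<noteq> p2"
    and g: "\<And>A. g analytic_on A" and q: "q \<in> D_reps \<tau>"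
  shows "q \<noteq> p1 \<Longrightarrow> q \<noteq> p2 \<Longrightarrow> n < 0 \<Longrightarrow> lcoeff (\<lambda>u. g u / (f1 u * f2 u)) q n = 0"
    and "n < -1 \<Longrightarrow> lcoeff (\<lambda>u. g u / (f1 u * f2 u)) q n = 0"
    and "g p2 \<noteq> 0 \<Longrightarrow> lcoeff (\<lambda>u. g u / (f1 u * f2 u)) p2 (-1) \<noteq> 0"
proof -
  have 1: "lcoeff (\<lambda>u. g u / (f1 u * f2 u)) q n = 0" if "q \<noteq> p1" "q \<noteq> p2" "n < 0" for n
    by (intro analytic_lcoeff(1) analytic_on_divide analytic_on_mult g) (use f that q in \<open>auto simp: simple_theta_def\<close>)
  thus "q \<noteq> p1 \<Longrightarrow> q \<noteq> p2 \<Longrightarrow> n < 0 \<Longrightarrow> lcoeff (\<lambda>u. g u / (f1 u * f2 u)) q n = 0" .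
  have 2: "n < -1 \<Longrightarrow> lcoeff (\<lambda>u. g u / (f1 u * f2 u)) b n = 0"
      "g b \<noteq> 0 \<Longrightarrow> lcoeff (\<lambda>u. g u / (f1 u * f2 u)) b (-1) \<noteq> 0"
    if "simple_theta \<tau> f1 a" "simple_theta \<tau> f2 b" "a \<noteq> b" for f1 f2 a b n
  proof -
    have h: "(\<lambda>u. g u / f1 u) analytic_on {b}" and nz: "f1 b \<noteq> 0"
      using that by (auto intro!: analytic_on_divide g simp: simple_theta_def)
    have b: "f2 analytic_on {b}" "f2 b = 0" "deriv f2 b \<noteq> 0"
      using that(2) by (auto simp: simple_theta_def)
    have eq: "(\<lambda>u. g u / (f1 u * f2 u)) = (\<lambda>u. g u / f1 u * (1 / f2 u))" by (simp add: fun_eq_iff)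
    show "n < -1 \<Longrightarrow> lcoeff (\<lambda>u. g u / (f1 u * f2 u)) b n = 0"
      "g b \<noteq> 0 \<Longrightarrow> lcoeff (\<lambda>u. g u / (f1 u * f2 u)) b (-1) \<noteq> 0"
      unfolding eq using simple_pole_lcoeff[OF h b] nz by auto
  qed
  show "g p2 \<noteq> 0 \<Longrightarrow> lcoeff (\<lambda>u. g u / (f1 u * f2 u)) p2 (-1) \<noteq> 0" by (rule 2(2)[OF f])
  show "n < -1 \<Longrightarrow> lcoeff (\<lambda>u. g u / (f1 u * f2 u)) q n = 0"
    using 1[of n] 2(1)[OF f(1,2,3), of n] 2(1)[OF f(2,1) f(3)[symmetric], of n]
    by (cases "q = p1"; cases "q = p2") (auto simp: mult.commute)
qed

lemma phi3_lcoeff: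
  assumes q: "q \<in> D_reps \<tau>"
  shows "q \<noteq> 0 \<Longrightarrow> q \<noteq> 1/2 \<Longrightarrow> n < 0 \<Longrightarrow> lcoeff (phi3 \<tau>) q n = 0"
    and "n < -1 \<Longrightarrow> lcoeff (phi3 \<tau>) q n = 0" "lcoeff (phi3 \<tau>) (1/2) (-1) \<noteq> 0"
proof -
  define g where "g = (\<lambda>u. of_real pi * (theta2 \<tau> 0)^2 * (theta3 \<tau> u * theta4 \<tau> u))"
  have g: "g analytic_on A" for A
    unfolding g_def by (intro analytic_on_mult analytic_on_const theta_analytic tau)
  have "g (1/2) \<noteq> 0"
    using theta_nonzero_at_D_reps(3,4)[OF tau D_reps_mem(2)[OF tau]] D_reps_distinct[OF tau] theta_0_nonzero
    by (auto simp: g_def)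
  moreover have "lcoeff (phi3 \<tau>) p n = lcoeff (\<lambda>u. g u / (theta1 \<tau> u * theta2 \<tau> u)) p n" for p n
    by (simp add: phi3_def lcoeff_on_M[OF tau] g_def)
  ultimately show "q \<noteq> 0 \<Longrightarrow> q \<noteq> 1/2 \<Longrightarrow> n < 0 \<Longrightarrow> lcoeff (phi3 \<tau>) q n = 0"
    "n < -1 \<Longrightarrow> lcoeff (phi3 \<tau>) q n = 0" "lcoeff (phi3 \<tau>) (1/2) (-1) \<noteq> 0"
    using two_simple_poles_lcoeff[OF simple_theta(1,2)[OF tau] _ g q] by simp_all
qed

lemma phi4_lcoeff:
  assumes q: "q \<in> D_reps \<tau>"
  shows "q \<noteq> 0 \<Longrightarrow> q \<noteq> (1 + \<tau>)/2 \<Longrightarrow> n < 0 \<Longrightarrow> lcoeff (phi4 \<tau>) q n = 0"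
    and "n < -1 \<Longrightarrow> lcoeff (phi4 \<tau>) q n = 0" "lcoeff (phi4 \<tau>) ((1 + \<tau>)/2) (-1) \<noteq> 0"
proof -
  define p where "p = (1 + \<tau>)/2"
  define g where "g = (\<lambda>u. of_real pi * (theta3 \<tau> 0)^2 * (theta2 \<tau> u * theta4 \<tau> u))"
  have g: "g analytic_on A" for A
    unfolding g_def by (intro analytic_on_mult analytic_on_const theta_analytic tau)
  have p: "p \<in> D_reps \<tau>" "p \<noteq> 0" "p \<noteq> 1/2" "p \<noteq> \<tau>/2"
    using D_reps_mem[OF tau] D_reps_distinct[OF tau] by (auto simp: p_def)
  have "g p \<noteq> 0"
    using theta_nonzero_at_D_reps(2,4)[OF tau p(1)] p theta_0_nonzero by (simp add: g_def)
  moreover have "lcoeff (phi4 \<tau>) r n = lcoeff (\<lambda>u. g u / (theta1 \<tau> u * theta3 \<tau> u)) r n" for r n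
    by (simp add: phi4_def lcoeff_on_M[OF tau] g_def)
  ultimately show "q \<noteq> 0 \<Longrightarrow> q \<noteq> (1 + \<tau>)/2 \<Longrightarrow> n < 0 \<Longrightarrow> lcoeff (phi4 \<tau>) q n = 0"
    "n < -1 \<Longrightarrow> lcoeff (phi4 \<tau>) q n = 0" "lcoeff (phi4 \<tau>) ((1 + \<tau>)/2) (-1) \<noteq> 0"
    using two_simple_poles_lcoeff[OF simple_theta(1,3)[OF tau, folded p_def] p(2)[symmetric] g q]
    unfolding p_def [symmetric] by simp_all
qed

lemma phi1_nonzero: "u \<notin> D_lift \<tau> \<Longrightarrow> phi1 \<tau> u \<noteq> 0"
  using theta_0_nonzero by (simp add: phi1_def tau)

lemma exists_off_D_lift: "\<exists>u. u \<notin> D_lift \<tau>"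
  using eventually_happens[OF eventually_not_in_D_lift[OF tau, of 0]] trivial_limit_at by auto

section \<open>The cokernel of a twisted derivative\<close>

text \<open>
  A function with simple poles at two given points: in the difference the additive constants cancel.
\<close>
lemma theta_zeta_diff_in_mero_functions:
  assumes "p \<in> D_reps \<tau>" "q \<in> D_reps \<tau>"
  shows "on_M \<tau> (\<lambda>u. theta_zeta \<tau> (u - p) - theta_zeta \<tau> (u - q)) \<in> mero_functions \<tau>"
proof (rule on_M_in_mero_functions[OF tau])
  show "(\<lambda>u. theta_zeta \<tau> (u - p) - theta_zeta \<tau> (u - q)) analytic_on - D_lift \<tau>"
    using theta_zeta_shift_analytic(1)[OF tau assms(1)] theta_zeta_shift_analytic(1)[OF tau assms(2)]
    by (subst analytic_on_analytic_at) (auto intro: analytic_on_diff)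
  show "(\<lambda>u. theta_zeta \<tau> (u - p) - theta_zeta \<tau> (u - q)) meromorphic_on D_lift \<tau>"
    by (intro meromorphic_on_diff theta_zeta_shift_meromorphic tau)
  fix u assume u: "u \<notin> D_lift \<tau>"
  show "theta_zeta \<tau> (u + 1 - p) - theta_zeta \<tau> (u + 1 - q) = theta_zeta \<tau> (u - p) - theta_zeta \<tau> (u - q)"
    using theta_zeta_add_1[OF tau, of "u - p"] theta_zeta_add_1[OF tau, of "u - q"] by (simp add: algebra_simps)
  have "theta_zeta \<tau> (u + \<tau> - x) = theta_zeta \<tau> (u - x) - 2 * of_real pi * \<i>" if "x \<in> D_reps \<tau>" for x
    using theta_zeta_add_tau[OF tau theta_zeta_shift_analytic(2)[OF tau that u]] by (simp add: algebra_simps)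
  thus "theta_zeta \<tau> (u + \<tau> - p) - theta_zeta \<tau> (u + \<tau> - q) = theta_zeta \<tau> (u - p) - theta_zeta \<tau> (u - q)"
    using assms by simp
qed

lemma theta_zeta_diff_lcoeff:
  assumes "p \<in> D_reps \<tau>" "q \<in> D_reps \<tau>" "x \<in> D_reps \<tau>"
  shows "lcoeff (on_M \<tau> (\<lambda>u. theta_zeta \<tau> (u - p) - theta_zeta \<tau> (u - q))) x n =
           lcoeff (\<lambda>u. theta_zeta \<tau> (u - p)) x n - lcoeff (\<lambda>u. theta_zeta \<tau> (u - q)) x n"
  by (subst lcoeff_on_M[OF tau], rule lcoeff_diff) (rule theta_zeta_shift_meromorphic[OF tau])+

lemma twisted_deriv_in_mero_functions:
  "on_M \<tau> W \<in> mero_functions \<tau> \<Longrightarrow> f \<in> mero_functions \<tau> \<Longrightarrow> twisted_deriv \<tau> W f \<in> mero_functions \<tau>"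
  unfolding twisted_deriv_alt by (intro mero_functions_add mero_functions_mult mero_functions_deriv tau)

lemma mero_functions_has_derivative:
  assumes "f \<in> mero_functions \<tau>" "u \<notin> D_lift \<tau>"
  shows "(f has_field_derivative deriv f u) (at u)"
  using mero_functionsD(1)[OF tau assms(1)] assms(2)
  by (intro analytic_derivI) (auto intro: analytic_on_subset)

lemma twisted_deriv_linear:
  assumes f: "f \<in> mero_functions \<tau>" and g: "g \<in> mero_functions \<tau>"
  shows "twisted_deriv \<tau> W (\<lambda>u. f u + c * g u) = (\<lambda>u. twisted_deriv \<tau> W f u + c * twisted_deriv \<tau> W g u)"
proof
  fix u
  show "twisted_deriv \<tau> W (\<lambda>u. f u + c * g u) u = twisted_deriv \<tau> W f u + c * twisted_deriv \<tau> W g u"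
  proof (cases "u \<in> D_lift \<tau>")
    case False
    have "((\<lambda>u. f u + c * g u) has_field_derivative deriv f u + c * deriv g u) (at u)"
      by (intro DERIV_add DERIV_cmult mero_functions_has_derivative f g False)
    hence "deriv (\<lambda>u. f u + c * g u) u = deriv f u + c * deriv g u" by (rule DERIV_imp_deriv)
    thus ?thesis using False by (simp add: twisted_deriv_def tau algebra_simps)
  qed (simp add: twisted_deriv_def on_M_def)
qed

lemma phi_comb_lcoeff:
  "lcoeff (phi_comb \<tau> a b c d) q n = a * lcoeff (phi1 \<tau>) q n + b * lcoeff (phi2 \<tau>) q n +
     c * lcoeff (phi3 \<tau>) q n + d * lcoeff (phi4 \<tau>) q n"
proof -
  note m = mero_functionsD(2)[OF tau phi1_in_mero_functions[OF tau]]
    mero_functionsD(2)[OF tau phi_in_mero_functions(1)[OF tau]]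
    mero_functionsD(2)[OF tau phi_in_mero_functions(2)[OF tau]]
    mero_functionsD(2)[OF tau phi_in_mero_functions(3)[OF tau]]
  note m' = m[THEN meromorphic_on_mult[OF meromorphic_on_const]]
  show ?thesis unfolding phi_comb_def[abs_def]
    by (simp only: lcoeff_add lcoeff_cmult m m' meromorphic_on_add)
qed

lemma lcoeff_diff_cmult:
  assumes "f \<in> mero_functions \<tau>" "g \<in> mero_functions \<tau>"
  shows "lcoeff (\<lambda>u. f u - t * g u) q n = lcoeff f q n - t * lcoeff g q n"
proof -
  note m = mero_functionsD(2)[OF tau assms(1)] mero_functionsD(2)[OF tau assms(2)]
  show ?thesis
    by (subst lcoeff_diff[OF m(1) meromorphic_on_mult[OF meromorphic_on_const m(2)]])
       (simp add: lcoeff_cmult[OF m(2)])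
qed

context
  fixes W :: "complex \<Rightarrow> complex"
  assumes W: "on_M \<tau> W \<in> mero_functions \<tau>"
    and W_simple: "\<And>p n. p \<in> D_reps \<tau> \<Longrightarrow> n < -1 \<Longrightarrow> lcoeff W p n = 0"
    and W_residue: "\<And>p. p \<in> D_reps \<tau> \<Longrightarrow> lcoeff W p (-1) \<notin> \<int>"
begin

lemma W_meromorphic: "W meromorphic_on A"
  using mero_functionsD(2)[OF tau W, of A] by (simp add: on_M_meromorphic_iff tau)

text \<open>
  A pole of order \<open>k\<close> at \<open>p\<close> with leading coefficient \<open>c\<close> becomes a pole of order \<open>k + 1\<close> with leading coefficient
  \<open>(r - k) c\<close>, where \<open>r\<close> is the residue of \<open>W\<close>. As \<open>r\<close> is not an integer, the order always increases by exactly one.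
  This includes \<open>k = 0\<close>, where \<open>f\<close> has a nonzero value at \<open>p\<close>.
\<close>
lemma twisted_deriv_lcoeff:
  assumes f: "f \<in> mero_functions \<tau>" and p: "p \<in> D_reps \<tau>"
    and low: "\<And>n. n < - int k \<Longrightarrow> lcoeff f p n = 0"
  shows "n < - int (Suc k) \<Longrightarrow> lcoeff (twisted_deriv \<tau> W f) p n = 0"
    and "lcoeff (twisted_deriv \<tau> W f) p (- int (Suc k)) = (lcoeff W p (-1) - of_nat k) * lcoeff f p (- int k)"
proof -
  note mf = mero_functionsD(2)[OF tau f]
  have eq: "lcoeff (twisted_deriv \<tau> W f) p n = of_int (n + 1) * lcoeff f p (n + 1) + lcoeff (\<lambda>u. f u * W u) p n" for n
    unfolding twisted_deriv_def lcoeff_on_M[OF tau]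
    by (subst lcoeff_add) (auto intro!: meromorphic_on_deriv meromorphic_on_mult mf W_meromorphic simp: lcoeff_deriv mf)
  note prod = lcoeff_mult_lowest[OF mf[of "{p}"] W_meromorphic, where m = "- int k" and n = "-1", OF low W_simple[OF p]]
  show "n < - int (Suc k) \<Longrightarrow> lcoeff (twisted_deriv \<tau> W f) p n = 0"
    using prod(1)[of n] low[of "n + 1"] by (simp add: eq)
  have "lcoeff (\<lambda>u. f u * W u) p (- int (Suc k)) = lcoeff f p (- int k) * lcoeff W p (-1)"
  proof -
    have "- int k + -1 = - int (Suc k)" by simp
    thus ?thesis using prod(2) by (simp only:)
  qed
  thus "lcoeff (twisted_deriv \<tau> W f) p (- int (Suc k)) = (lcoeff W p (-1) - of_nat k) * lcoeff f p (- int k)"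
    by (simp add: eq algebra_simps)
qed

lemma residue_minus_nat_nonzero: "p \<in> D_reps \<tau> \<Longrightarrow> lcoeff W p (-1) - of_nat k \<noteq> 0"
  using W_residue[of p] by (metis Ints_of_nat eq_iff_diff_eq_0)

text \<open>
  Downward induction on a bound for the pole order of \<open>f\<close>: a leading term of order above \<open>j\<close> would survive in the
  twisted derivative.
\<close>
lemma twisted_deriv_pole_order:
  assumes f: "f \<in> mero_functions \<tau>" and p: "p \<in> D_reps \<tau>"
    and low: "\<And>n. n < - int (Suc j) \<Longrightarrow> lcoeff (twisted_deriv \<tau> W f) p n = 0"
  shows "n < - int j \<Longrightarrow> lcoeff f p n = 0"
proof -
  obtain k where "\<And>n. n < - int k \<Longrightarrow> lcoeff f p n = 0"
    using lcoeff_eventually_bounded[of f p] mero_functionsD(2)[OF tau f] by metis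
  hence ex: "\<forall>n < - int (j + k). lcoeff f p n = 0" by auto
  have "\<forall>n < - int j. lcoeff f p n = 0" using ex
  proof (induction k)
    case (Suc k)
    have "lcoeff (twisted_deriv \<tau> W f) p (- int (Suc (j + Suc k))) = 0" by (rule low) simp
    hence "lcoeff f p (- int (j + Suc k)) = 0"
      using twisted_deriv_lcoeff(2)[OF f p, of "j + Suc k"] Suc.prems residue_minus_nat_nonzero[OF p, of "j + Suc k"]
      by (simp del: of_nat_Suc of_nat_add)
    hence "lcoeff f p n = 0" if "n < - int (j + k)" for n
      using Suc.prems that by (cases "n = - int (j + Suc k)") auto
    hence "\<forall>n < - int (j + k). lcoeff f p n = 0" by blast
    thus ?case by (rule Suc.IH)
  qed simp
  thus "n < - int j \<Longrightarrow> lcoeff f p n = 0" by blast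
qed

definition spanned :: "(complex \<Rightarrow> complex) \<Rightarrow> bool" where
  "spanned g \<longleftrightarrow> (\<exists>f\<in>mero_functions \<tau>. \<exists>a b c d. g = (\<lambda>u. twisted_deriv \<tau> W f u + phi_comb \<tau> a b c d u))"

lemma spanned_add_exact:
  assumes "spanned g" "f \<in> mero_functions \<tau>"
  shows "spanned (\<lambda>u. g u + t * twisted_deriv \<tau> W f u)"
proof -
  obtain h a b c d where h: "h \<in> mero_functions \<tau>" "g = (\<lambda>u. twisted_deriv \<tau> W h u + phi_comb \<tau> a b c d u)"
    using assms(1) by (auto simp: spanned_def)
  have "(\<lambda>u. g u + t * twisted_deriv \<tau> W f u) =
      (\<lambda>u. twisted_deriv \<tau> W (\<lambda>u. h u + t * f u) u + phi_comb \<tau> a b c d u)"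
    by (simp add: h(2) twisted_deriv_linear[OF h(1) assms(2)] algebra_simps)
  moreover have "(\<lambda>u. h u + t * f u) \<in> mero_functions \<tau>"
    by (intro mero_functions_add mero_functions_cmult h(1) assms(2) tau)
  ultimately show ?thesis unfolding spanned_def by blast
qed

lemma spanned_add_phi_comb:
  assumes "spanned g"
  shows "spanned (\<lambda>u. g u + phi_comb \<tau> a' b' c' d' u)"
proof -
  obtain h a b c d where h: "h \<in> mero_functions \<tau>" "g = (\<lambda>u. twisted_deriv \<tau> W h u + phi_comb \<tau> a b c d u)"
    using assms by (auto simp: spanned_def)
  have "(\<lambda>u. g u + phi_comb \<tau> a' b' c' d' u) =
      (\<lambda>u. twisted_deriv \<tau> W h u + phi_comb \<tau> (a + a') (b + b') (c + c') (d + d') u)"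
    by (simp add: h(2) phi_comb_def algebra_simps)
  thus ?thesis using h(1) unfolding spanned_def by blast
qed

text \<open>
  One step of an elimination: it suffices to treat the function in which a multiple of \<open>x\<close> has removed the coefficient
  of index \<open>m\<close> at \<open>p\<close>. The coefficients of the remainder \<open>g'\<close> are expressed by those of \<open>g\<close> and \<open>x\<close>, so that previously
  achieved zeros can be carried along.
\<close>
lemma spanned_kill:
  assumes g: "g \<in> mero_functions \<tau>" and x: "x \<in> mero_functions \<tau>" and nz: "lcoeff x p m \<noteq> 0"
    and add: "\<And>g t. spanned g \<Longrightarrow> spanned (\<lambda>u. g u + t * x u)"
    and rest: "\<And>g' t. g' \<in> mero_functions \<tau> \<Longrightarrow> lcoeff g' p m = 0 \<Longrightarrow>
        (\<And>q n. lcoeff g' q n = lcoeff g q n - t * lcoeff x q n) \<Longrightarrow> spanned g'"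
  shows "spanned g"
proof -
  define t where "t = lcoeff g p m / lcoeff x p m"
  define g' where "g' = (\<lambda>u. g u - t * x u)"
  have l: "lcoeff g' q n = lcoeff g q n - t * lcoeff x q n" for q n
    unfolding g'_def by (rule lcoeff_diff_cmult[OF g x])
  have "spanned g'"
  proof (rule rest[OF _ _ l])
    show "g' \<in> mero_functions \<tau>" unfolding g'_def by (intro mero_functions_diff mero_functions_cmult g x tau)
    show "lcoeff g' p m = 0" using nz by (simp add: l t_def)
  qed
  from add[OF this, of t] show ?thesis by (simp add: g'_def)
qed

lemma spanned_exact_kill:
  assumes "g \<in> mero_functions \<tau>" "f \<in> mero_functions \<tau>" "lcoeff (twisted_deriv \<tau> W f) p m \<noteq> 0"
    and "\<And>g' t. g' \<in> mero_functions \<tau> \<Longrightarrow> lcoeff g' p m = 0 \<Longrightarrow>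
        (\<And>q n. lcoeff g' q n = lcoeff g q n - t * lcoeff (twisted_deriv \<tau> W f) q n) \<Longrightarrow> spanned g'"
  shows "spanned g"
  by (rule spanned_kill[OF assms(1) twisted_deriv_in_mero_functions[OF W assms(2)] assms(3)])
     (auto intro: spanned_add_exact assms(2,4))

lemma spanned_phi_kill:
  assumes "g \<in> mero_functions \<tau>" "x \<in> {phi2 \<tau>, phi3 \<tau>, phi4 \<tau>}" "lcoeff x p m \<noteq> 0"
    and rest: "\<And>g' t. g' \<in> mero_functions \<tau> \<Longrightarrow> lcoeff g' p m = 0 \<Longrightarrow>
        (\<And>q n. lcoeff g' q n = lcoeff g q n - t * lcoeff x q n) \<Longrightarrow> spanned g'"
  shows "spanned g"
proof (rule spanned_kill[OF assms(1) _ assms(3)])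
  show "x \<in> mero_functions \<tau>" using assms(2) phi_in_mero_functions[OF tau] by auto
  fix g t assume g: "spanned g"
  have "phi_comb \<tau> 0 t 0 0 = (\<lambda>u. t * phi2 \<tau> u)" "phi_comb \<tau> 0 0 t 0 = (\<lambda>u. t * phi3 \<tau> u)"
    "phi_comb \<tau> 0 0 0 t = (\<lambda>u. t * phi4 \<tau> u)"
    by (auto simp: phi_comb_def)
  thus "spanned (\<lambda>u. g u + t * x u)"
    using assms(2) spanned_add_phi_comb[OF g, of 0 t 0 0] spanned_add_phi_comb[OF g, of 0 0 t 0]
      spanned_add_phi_comb[OF g, of 0 0 0 t] by auto
qed (rule rest)

text \<open>
  Building blocks for the reduction to poles of order at most \<open>2\<close> that are moreover exact. Off \<open>p\<close> the function under
  the derivative is holomorphic, so that only simple poles arise there.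
\<close>
lemma twisted_deriv_theta_zeta_deriv_lcoeff:
  assumes p: "p \<in> D_reps \<tau>" and k: "2 < k"
  shows "twisted_deriv \<tau> W (theta_zeta_deriv \<tau> p (k - 3)) \<in> mero_functions \<tau> \<and>
    (\<forall>n < - int k. lcoeff (twisted_deriv \<tau> W (theta_zeta_deriv \<tau> p (k - 3))) p n = 0) \<and>
    lcoeff (twisted_deriv \<tau> W (theta_zeta_deriv \<tau> p (k - 3))) p (- int k) \<noteq> 0 \<and>
    (\<forall>q \<in> D_reps \<tau> - {p}. \<forall>n < - int 2. lcoeff (twisted_deriv \<tau> W (theta_zeta_deriv \<tau> p (k - 3))) q n = 0)"
proof -
  define f where "f = theta_zeta_deriv \<tau> p (k - 3)"
  obtain j where j: "k = Suc j" "j - 2 + 2 = j" "k - 3 = j - 2" using k by (cases k) auto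
  have f: "f \<in> mero_functions \<tau>" unfolding f_def by (rule theta_zeta_deriv_in_mero_functions[OF tau p])
  have lowp: "lcoeff f p n = 0" if "n < - int j" for n
    using theta_zeta_deriv_lcoeff(1)[OF tau p p, of n "j - 2", unfolded j(2)] that unfolding f_def j(3) by blast
  have lead: "lcoeff f p (- int j) \<noteq> 0"
    using theta_zeta_deriv_lcoeff(3)[OF tau p p refl, of "j - 2", unfolded j(2)] unfolding f_def j(3) by blast
  have "lcoeff (twisted_deriv \<tau> W f) p n = 0" if "n < - int k" for n
    using twisted_deriv_lcoeff(1)[OF f p lowp] that j(1) by auto
  moreover have "lcoeff (twisted_deriv \<tau> W f) p (- int k) \<noteq> 0"
    using twisted_deriv_lcoeff(2)[OF f p lowp] lead residue_minus_nat_nonzero[OF p, of j]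
    unfolding j(1) by simp
  moreover have "lcoeff (twisted_deriv \<tau> W f) q n = 0" if q: "q \<in> D_reps \<tau> - {p}" and n: "n < - int 2" for q n
  proof -
    have "lcoeff f q n = 0" if "n < - int 0" for n
      using theta_zeta_deriv_lcoeff(2)[OF tau p, of q n "k - 3"] q that by (auto simp: f_def)
    thus ?thesis using twisted_deriv_lcoeff(1)[OF f, of q 0 n] q n by auto
  qed
  ultimately show ?thesis using twisted_deriv_in_mero_functions[OF W f] unfolding f_def by blast
qed

text \<open>
  Exact forms reduce all pole orders to at most \<open>2\<close>. The remaining principal parts are eliminated in an order in which
  no step destroys an earlier zero:
  the double poles at \<open>1/2\<close>, \<open>(1 + \<tau>)/2\<close>, \<open>\<tau>/2\<close> by twisted derivatives of functions with simple poles at that point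
  and at \<open>0\<close>; the residue at \<open>\<tau>/2\<close> by the twisted derivative of \<open>1\<close>; the double pole at \<open>0\<close> by \<open>phi2\<close>; the residue at
  \<open>1/2\<close> by \<open>phi3\<close> and the one at \<open>(1 + \<tau>)/2\<close> by \<open>phi4\<close>. The residue at \<open>0\<close> then vanishes by the residue theorem, and a
  constant multiple of \<open>phi1\<close> is left.
\<close>
lemma spanned_mero_functions:
  assumes "g \<in> mero_functions \<tau>"
  shows "spanned g"
  using assms
proof (induction g rule: pole_reduction[OF tau, consumes 1, case_names generator base step,
    where d = 2 and B = "\<lambda>p k. twisted_deriv \<tau> W (theta_zeta_deriv \<tau> p (k - 3))"])
  case (generator p k)
  thus ?case by (rule twisted_deriv_theta_zeta_deriv_lcoeff)
next
  case (step g c p k)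
  show ?case by (rule spanned_add_exact[OF step(4) theta_zeta_deriv_in_mero_functions[OF tau step(2)]])
next
  case (base g)
  define p2 p3 p4 where "p2 = (1/2 :: complex)" and "p3 = (1 + \<tau>)/2" and "p4 = \<tau>/2"
  have ne: "0 \<noteq> p2" "0 \<noteq> p3" "0 \<noteq> p4" "p2 \<noteq> p3" "p2 \<noteq> p4" "p3 \<noteq> p4"
    using D_reps_distinct[OF tau] by (simp_all add: p2_def p3_def p4_def)
  note ne' = ne ne[symmetric]
  have D: "0 \<in> D_reps \<tau>" "p2 \<in> D_reps \<tau>" "p3 \<in> D_reps \<tau>" "p4 \<in> D_reps \<tau>"
    using D_reps_mem[OF tau] by (simp_all add: p2_def p3_def p4_def)
  have D_eq: "D_reps \<tau> = {0, p2, p3, p4}" by (simp add: D_reps_def p2_def p3_def p4_def)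
  \<comment> \<open>\<open>e p\<close> has simple poles at \<open>p\<close> and at \<open>0\<close>\<close>
  define e where "e = (\<lambda>p. on_M \<tau> (\<lambda>u. theta_zeta \<tau> (u - p) - theta_zeta \<tau> (u - 0)))"
  have e: "e p \<in> mero_functions \<tau>" if "p \<in> D_reps \<tau>" for p
    unfolding e_def by (rule theta_zeta_diff_in_mero_functions[OF that D(1)])
  have e_coeff: "lcoeff (e p) q n = lcoeff (\<lambda>u. theta_zeta \<tau> (u - p)) q n - lcoeff (\<lambda>u. theta_zeta \<tau> (u - 0)) q n"
    if "p \<in> D_reps \<tau>" "q \<in> D_reps \<tau>" for p q n
    unfolding e_def by (rule theta_zeta_diff_lcoeff[OF that(1) D(1) that(2)])
  note z0 = theta_zeta_shift_lcoeff[OF tau D(1), simplified]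
  have e_low: "lcoeff (e p) q n = 0" if "p \<in> D_reps \<tau>" "q \<in> D_reps \<tau>" "n < - int 1" for p q n
    using that theta_zeta_shift_lcoeff(1)[OF tau, of _ q n] z0(1)[of q n] by (simp add: e_coeff)
  have te_low: "lcoeff (twisted_deriv \<tau> W (e p)) q n = 0"
    if "p \<in> D_reps \<tau>" "q \<in> D_reps \<tau>" "n < -2" for p q n
    using twisted_deriv_lcoeff(1)[where k = 1, OF e[OF that(1)] that(2) e_low[OF that(1,2)]] that(3) by simp
  have te_low': "lcoeff (twisted_deriv \<tau> W (e p)) q n = 0"
    if "p \<in> D_reps \<tau>" "q \<in> D_reps \<tau>" "q \<noteq> p" "q \<noteq> 0" "n < -1" for p q n
  proof -
    have "lcoeff (e p) q n = 0" if "n < - int 0" for n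
      using that \<open>p \<in> _\<close> \<open>q \<in> _\<close> \<open>q \<noteq> p\<close> \<open>q \<noteq> 0\<close> theta_zeta_shift_lcoeff(3)[OF tau, of _ q n] z0(3)[of q n] by (simp add: e_coeff)
    thus ?thesis using twisted_deriv_lcoeff(1)[OF e[OF that(1)] that(2), of 0 n] that(5) by simp
  qed
  have te_lead: "lcoeff (twisted_deriv \<tau> W (e p)) p (-2) \<noteq> 0" if "p \<in> D_reps \<tau>" "p \<noteq> 0" for p
  proof -
    have "lcoeff (e p) p (- int 1) = 1"
      using that theta_zeta_shift_lcoeff(2)[OF tau] z0(2)[of p] by (simp add: e_coeff)
    thus ?thesis using twisted_deriv_lcoeff(2)[where k = 1, OF e[OF that(1)] that(1) e_low[OF that(1,1)]]
        residue_minus_nat_nonzero[OF that(1), of 1] by simp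
  qed
  \<comment> \<open>the constant function: its twisted derivative has a simple pole at every point of \<open>D\<close>\<close>
  define one where "one = on_M \<tau> (\<lambda>_. 1)"
  have one: "one \<in> mero_functions \<tau>" unfolding one_def by (rule mero_functions_const[OF tau])
  have one_low: "lcoeff one q n = 0" if "n < - int 0" for q n
    unfolding one_def using that by (intro on_M_analytic_lcoeff) auto
  have one_0: "lcoeff one q (- int 0) = 1" for q
    unfolding one_def lcoeff_on_M[OF tau] using analytic_lcoeff(2)[of "\<lambda>_. 1" q] by simp
  have t1_low: "lcoeff (twisted_deriv \<tau> W one) q n = 0" if "q \<in> D_reps \<tau>" "n < -1" for q n
    using twisted_deriv_lcoeff(1)[where k = 0, OF one that(1) one_low] that(2) by simp
  have t1_lead: "lcoeff (twisted_deriv \<tau> W one) q (-1) \<noteq> 0" if "q \<in> D_reps \<tau>" for q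
    using twisted_deriv_lcoeff(2)[where k = 0, OF one that one_low] one_0 residue_minus_nat_nonzero[OF that, of 0] by simp
  note phi2 = phi2_lcoeff
  note phi3 = phi3_lcoeff[folded p2_def]
  note phi4 = phi4_lcoeff[folded p3_def]
  have base_low: "q \<in> D_reps \<tau> \<Longrightarrow> n < -2 \<Longrightarrow> lcoeff g q n = 0" for q n
    using base(2)[of q n] by simp
  show ?case
  proof (rule spanned_exact_kill[OF base(1) e[OF D(2)] te_lead[OF D(2) ne'(7)]])
    fix g1 t1 assume g1: "g1 \<in> mero_functions \<tau>" "lcoeff g1 p2 (-2) = 0"
      "\<And>q n. lcoeff g1 q n = lcoeff g q n - t1 * lcoeff (twisted_deriv \<tau> W (e p2)) q n"
    have low1: "q \<in> D_reps \<tau> \<Longrightarrow> n < -2 \<Longrightarrow> lcoeff g1 q n = 0" for q n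
      using te_low[OF D(2)] base_low by (simp add: g1(3))
    show "spanned g1"
    proof (rule spanned_exact_kill[OF g1(1) e[OF D(3)] te_lead[OF D(3) ne'(8)]])
      fix g2 t2 assume g2: "g2 \<in> mero_functions \<tau>" "lcoeff g2 p3 (-2) = 0"
        "\<And>q n. lcoeff g2 q n = lcoeff g1 q n - t2 * lcoeff (twisted_deriv \<tau> W (e p3)) q n"
      have low2: "q \<in> D_reps \<tau> \<Longrightarrow> n < -2 \<Longrightarrow> lcoeff g2 q n = 0" for q n
        using te_low[OF D(3)] low1 by (simp add: g2(3))
      have g2_2: "lcoeff g2 p2 (-2) = 0"
        using te_low'[OF D(3,2)] ne' g1(2) by (simp add: g2(3))
      show "spanned g2"
      proof (rule spanned_exact_kill[OF g2(1) e[OF D(4)] te_lead[OF D(4) ne'(9)]])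
        fix g3 t3 assume g3: "g3 \<in> mero_functions \<tau>" "lcoeff g3 p4 (-2) = 0"
          "\<And>q n. lcoeff g3 q n = lcoeff g2 q n - t3 * lcoeff (twisted_deriv \<tau> W (e p4)) q n"
        have low3: "q \<in> D_reps \<tau> \<Longrightarrow> n < -2 \<Longrightarrow> lcoeff g3 q n = 0" for q n
          using te_low[OF D(4)] low2 by (simp add: g3(3))
        have g3_2: "lcoeff g3 p2 (-2) = 0" "lcoeff g3 p3 (-2) = 0"
          using te_low'[OF D(4,2)] te_low'[OF D(4,3)] ne' g2(2) g2_2 by (simp_all add: g3(3))
        have low3': "q \<in> D_reps \<tau> \<Longrightarrow> q \<noteq> 0 \<Longrightarrow> n < -1 \<Longrightarrow> lcoeff g3 q n = 0" for q n
          using low3[of q n] g3(2) g3_2 by (cases "n = -2") (auto simp: D_eq)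
        show "spanned g3"
        proof (rule spanned_exact_kill[OF g3(1) one t1_lead[OF D(4)]])
          fix g4 t4 assume g4: "g4 \<in> mero_functions \<tau>" "lcoeff g4 p4 (-1) = 0"
            "\<And>q n. lcoeff g4 q n = lcoeff g3 q n - t4 * lcoeff (twisted_deriv \<tau> W one) q n"
          have low4: "q \<in> D_reps \<tau> \<Longrightarrow> n < -2 \<Longrightarrow> lcoeff g4 q n = 0"
            "q \<in> D_reps \<tau> \<Longrightarrow> q \<noteq> 0 \<Longrightarrow> n < -1 \<Longrightarrow> lcoeff g4 q n = 0" for q n
            using t1_low low3 low3' by (simp_all add: g4(3))
          show "spanned g4"
          proof (rule spanned_phi_kill[OF g4(1) _ phi2(3)])
            fix g5 t5 assume g5: "g5 \<in> mero_functions \<tau>" "lcoeff g5 0 (-2) = 0"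
              "\<And>q n. lcoeff g5 q n = lcoeff g4 q n - t5 * lcoeff (phi2 \<tau>) q n"
            have low5: "q \<in> D_reps \<tau> \<Longrightarrow> n < -1 \<Longrightarrow> lcoeff g5 q n = 0" for q n
              using phi2(1)[of q n] phi2(2)[of n] low4[of q n] g5(2)
              by (cases "q = 0"; cases "n = -2") (auto simp: g5(3))
            have g5_4: "lcoeff g5 p4 (-1) = 0"
              using g4(2) phi2(1)[OF D(4)] ne' by (simp add: g5(3))
            show "spanned g5"
            proof (rule spanned_phi_kill[OF g5(1) _ phi3(3)[OF D(1)]])
              fix g6 t6 assume g6: "g6 \<in> mero_functions \<tau>" "lcoeff g6 p2 (-1) = 0"
                "\<And>q n. lcoeff g6 q n = lcoeff g5 q n - t6 * lcoeff (phi3 \<tau>) q n"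
              have low6: "q \<in> D_reps \<tau> \<Longrightarrow> n < -1 \<Longrightarrow> lcoeff g6 q n = 0" for q n
                using phi3(2)[of q n] low5[of q n] by (simp add: g6(3))
              have g6_4: "lcoeff g6 p4 (-1) = 0"
                using g5_4 phi3(1)[OF D(4)] ne' by (simp add: g6(3))
              show "spanned g6"
              proof (rule spanned_phi_kill[OF g6(1) _ phi4(3)[OF D(1)]])
                fix g7 t7 assume g7: "g7 \<in> mero_functions \<tau>" "lcoeff g7 p3 (-1) = 0"
                  "\<And>q n. lcoeff g7 q n = lcoeff g6 q n - t7 * lcoeff (phi4 \<tau>) q n"
                have low7: "q \<in> D_reps \<tau> \<Longrightarrow> n < -1 \<Longrightarrow> lcoeff g7 q n = 0" for q n
                  using phi4(2)[of q n] low6[of q n] by (simp add: g7(3))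
                have g7_res: "lcoeff g7 p4 (-1) = 0" "lcoeff g7 p2 (-1) = 0"
                  using g6_4 g6(2) phi4(1)[OF D(4)] phi4(1)[OF D(2)] ne' by (simp_all add: g7(3))
                hence "lcoeff g7 0 (-1) = 0"
                  using sum_residues_eq_0[OF tau g7(1)] g7(2) ne' by (simp add: D_eq)
                hence "lcoeff g7 q n = 0" if "q \<in> D_reps \<tau>" "n < 0" for q n
                  using that low7[of q n] g7(2) g7_res by (cases "n = -1") (auto simp: D_eq)
                then obtain c where c: "g7 = on_M \<tau> (\<lambda>_. c)"
                  using mero_functions_without_poles_constant[OF tau g7(1)] by blast
                define a where "a = c / (of_real pi * (theta3 \<tau> 0)^2)"
                have "g7 = (\<lambda>u. twisted_deriv \<tau> W (\<lambda>_. 0) u + phi_comb \<tau> a 0 0 0 u)"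
                  unfolding c using theta_0_nonzero
                  by (auto simp: a_def phi_comb_def twisted_deriv_def phi1_def on_M_def)
                thus "spanned g7" unfolding spanned_def using mero_functions_zero[OF tau] by blast
              qed auto
            qed auto
          qed auto
        qed
      qed
    qed
  qed
qed

theorem twisted_cohomology_span:
  assumes "g \<in> mero_functions \<tau>"
  obtains f a b c d where "f \<in> mero_functions \<tau>"
    "g = (\<lambda>u. twisted_deriv \<tau> W f u + phi_comb \<tau> a b c d u)"
  using spanned_mero_functions[OF assms] unfolding spanned_def by blast

text \<open>
  The combination of the cocycles has at most a double pole at \<open>0\<close> and simple poles elsewhere, so \<open>f\<close> has at most a
  simple pole at \<open>0\<close> and no others. By the residue theorem \<open>f\<close> has no pole and is a constant \<open>t\<close>. All four cocycles are
  holomorphic at \<open>\<tau>/2\<close>, where the twisted derivative of \<open>t\<close> has residue \<open>t\<close> times a nonzero number; hence \<open>t = 0\<close>.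
  The coefficients then vanish one after the other by the principal parts at \<open>0\<close>, \<open>1/2\<close> and \<open>(1 + \<tau>)/2\<close>, and finally because \<open>phi1\<close>
  is not \<open>0\<close>.
\<close>
theorem twisted_cohomology_independent:
  assumes f: "f \<in> mero_functions \<tau>" and eq: "twisted_deriv \<tau> W f = phi_comb \<tau> a b c d"
  shows "a = 0 \<and> b = 0 \<and> c = 0 \<and> d = 0"
proof -
  define p2 p3 p4 where "p2 = (1/2 :: complex)" and "p3 = (1 + \<tau>)/2" and "p4 = \<tau>/2"
  have ne: "0 \<noteq> p2" "0 \<noteq> p3" "0 \<noteq> p4" "p2 \<noteq> p3" "p2 \<noteq> p4" "p3 \<noteq> p4"
    using D_reps_distinct[OF tau] by (simp_all add: p2_def p3_def p4_def)
  note ne' = ne ne[symmetric]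
  have D: "0 \<in> D_reps \<tau>" "p2 \<in> D_reps \<tau>" "p3 \<in> D_reps \<tau>" "p4 \<in> D_reps \<tau>"
    using D_reps_mem[OF tau] by (simp_all add: p2_def p3_def p4_def)
  have D_eq: "D_reps \<tau> = {0, p2, p3, p4}" by (simp add: D_reps_def p2_def p3_def p4_def)
  note phi1 = phi1_lcoeff
  note phi2 = phi2_lcoeff
  note phi3 = phi3_lcoeff[folded p2_def]
  note phi4 = phi4_lcoeff[folded p3_def]
  have l: "lcoeff (twisted_deriv \<tau> W f) q n = a * lcoeff (phi1 \<tau>) q n + b * lcoeff (phi2 \<tau>) q n +
     c * lcoeff (phi3 \<tau>) q n + d * lcoeff (phi4 \<tau>) q n" for q n
    unfolding eq by (rule phi_comb_lcoeff)
  have f0: "lcoeff f 0 n = 0" if "n < - int 1" for n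
    by (rule twisted_deriv_pole_order[OF f D(1) _ that])
       (simp add: l phi1 phi2(2) phi3(2)[OF D(1)] phi4(2)[OF D(1)])
  have fq: "lcoeff f q n = 0" if "q \<in> D_reps \<tau>" "q \<noteq> 0" "n < - int 0" for q n
    by (rule twisted_deriv_pole_order[OF f that(1) _ that(3)])
       (simp add: l phi1 phi2(1) phi3(2) phi4(2) that(1,2))
  have "lcoeff f 0 (-1) = 0"
    using sum_residues_eq_0[OF tau f] fq[OF D(2)] fq[OF D(3)] fq[OF D(4)] ne' by (simp add: D_eq)
  hence "lcoeff f q n = 0" if "q \<in> D_reps \<tau>" "n < 0" for q n
    using fq[OF that(1), of n] f0[of n] that by (cases "q = 0"; cases "n = -1") auto
  then obtain t where t: "f = on_M \<tau> (\<lambda>_. t)"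
    using mero_functions_without_poles_constant[OF tau f] by blast
  have "lcoeff (twisted_deriv \<tau> W f) p4 (- int (Suc 0)) = (lcoeff W p4 (-1) - of_nat 0) * lcoeff f p4 (- int 0)"
    by (rule twisted_deriv_lcoeff(2)[OF f D(4)]) (use fq[OF D(4)] ne' in auto)
  moreover have "lcoeff (twisted_deriv \<tau> W f) p4 (- int (Suc 0)) = 0"
    using ne' phi1 phi2(1)[OF D(4)] phi3(1)[OF D(4)] phi4(1)[OF D(4)] by (simp add: l)
  moreover have "lcoeff f p4 (- int 0) = t"
    unfolding t lcoeff_on_M[OF tau] using analytic_lcoeff(2)[of "\<lambda>_. t" p4] by simp
  ultimately have "t = 0" using residue_minus_nat_nonzero[OF D(4), of 0] by simp
  hence zero: "f = (\<lambda>_. 0)" using t by (simp add: on_M_def)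
  hence tz: "twisted_deriv \<tau> W f = (\<lambda>_. 0)" by (simp add: twisted_deriv_def on_M_def)
  have l0: "lcoeff (twisted_deriv \<tau> W f) q n = 0" for q n
    unfolding tz using lcoeff_cmult[OF meromorphic_on_const, of 0 0 q n] by simp
  have "b = 0" using l[of 0 "-2"] phi1 phi2(3) phi3(2)[OF D(1)] phi4(2)[OF D(1)] by (simp add: l0)
  moreover have "c = 0"
    using l[of p2 "-1"] phi1 phi2(1)[OF D(2)] phi3(3)[OF D(1)] phi4(1)[OF D(2)] ne' by (simp add: l0)
  moreover have "d = 0"
    using l[of p3 "-1"] phi1 phi2(1)[OF D(3)] phi3(1)[OF D(3)] phi4(3)[OF D(1)] ne' by (simp add: l0)
  moreover obtain u where u: "u \<notin> D_lift \<tau>" using exists_off_D_lift by blast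
  ultimately show ?thesis using fun_cong[OF eq, of u] phi1_nonzero[OF u] by (simp add: tz phi_comb_def)
qed

end

end

section \<open>Local solutions\<close>

lemma fps_conv_radius_divide_pos:
  fixes P :: "complex fps"
  assumes "fps_conv_radius P > 0" "\<forall>\<^sub>F n in sequentially. norm (b n) \<ge> 1"
  shows "fps_conv_radius (Abs_fps (\<lambda>n. fps_nth P n / b n)) > 0"
proof -
  obtain r where r: "0 < ereal r" "ereal r < fps_conv_radius P"
    using ereal_dense2[OF assms(1)] by (auto simp: zero_ereal_def)
  hence r0: "r > 0" by simp
  have "summable (\<lambda>n. norm (fps_nth P n * of_real r ^ n))"
    by (rule abs_summable_in_conv_radius) (use r in \<open>auto simp: fps_conv_radius_def\<close>)
  hence "summable (\<lambda>n. fps_nth P n / b n * of_real r ^ n)"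
  proof (rule summable_comparison_test_ev[rotated])
    show "\<forall>\<^sub>F n in sequentially. norm (fps_nth P n / b n * of_real r ^ n) \<le> norm (fps_nth P n * of_real r ^ n)"
      using assms(2)
    proof eventually_elim
      case (elim n)
      have "norm (fps_nth P n / b n) \<le> norm (fps_nth P n)"
      proof -
        have "b n \<noteq> 0" using elim by auto
        thus ?thesis using divide_left_mono[OF elim, of "norm (fps_nth P n)"] by (simp add: norm_divide)
      qed
      thus ?case unfolding norm_mult by (rule mult_right_mono) simp
    qed
  qed
  hence "conv_radius (\<lambda>n. fps_nth P n / b n) \<ge> norm (of_real r :: complex)"
    by (rule conv_radius_geI)
  hence "fps_conv_radius (Abs_fps (\<lambda>n. fps_nth P n / b n)) \<ge> ereal r"
    using r0 by (simp add: fps_conv_radius_def)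
  with r(1) show ?thesis by (rule less_le_trans)
qed

lemma eventually_norm_add_ge_1:
  fixes a :: complex
  shows "\<forall>\<^sub>F n in sequentially. norm (of_nat n + a) \<ge> 1"
proof -
  have "\<forall>\<^sub>F n in sequentially. real n \<ge> norm a + 1"
    by (rule eventually_at_top_linorderI[of "nat \<lceil>norm a + 1\<rceil>"]) linarith
  thus ?thesis
  proof eventually_elim
    case (elim n)
    have "norm (of_nat n :: complex) \<le> norm (of_nat n + a) + norm a"
      using norm_triangle_ineq4[of "of_nat n + a" a] by simp
    thus ?case using elim by simp
  qed
qed

text \<open>
  Comparing coefficients, \<open>(n + 1 + a) g\<^bsub>n+1\<^esub> = f\<^bsub>n\<^esub>\<close>. The factors are nonzero because \<open>a\<close> is not an integer, and they are
  eventually of modulus at least \<open>1\<close>, which bounds the coefficients of \<open>g\<close> and gives a positive radius of convergence.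
\<close>
lemma laurent_euler_equation:
  assumes X: "f has_laurent_expansion X" and a: "a \<notin> \<int>"
  obtains g where "g meromorphic_on {0}" "\<forall>\<^sub>F z in at 0. deriv g z + a / z * g z = f z"
proof -
  define N where "N = fls_subdegree X"
  define P where "P = fls_base_factor_to_fps X"
  have X_eq: "X = fls_shift (-N) (fps_to_fls P)"
    unfolding P_def N_def by (rule fls_conv_base_factor_to_fps_shift_subdegree)
  define b where "b = (\<lambda>n. of_nat n + (of_int (N + 1) + a))"
  define Y where "Y = fls_shift (- (N + 1)) (fps_to_fls (Abs_fps (\<lambda>n. fps_nth P n / b n)))"
  have b0: "b n \<noteq> 0" for n
  proof
    assume "b n = 0"
    hence "a = of_int (- (int n + (N + 1)))" by (simp add: b_def eq_neg_iff_add_eq_0 algebra_simps)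
    thus False using a by (metis Ints_of_int)
  qed
  have "fls_conv_radius X > 0" using X by (simp add: has_laurent_expansion_def)
  hence "fps_conv_radius P > 0" by (simp add: X_eq)
  hence "fps_conv_radius (Abs_fps (\<lambda>n. fps_nth P n / b n)) > 0"
    unfolding b_def by (intro fps_conv_radius_divide_pos eventually_norm_add_ge_1)
  hence rad: "fls_conv_radius Y > 0" by (simp add: Y_def)
  define g where "g = eval_fls Y"
  have g: "g has_laurent_expansion Y"
    unfolding g_def by (rule eval_fls_has_laurent_expansion[OF rad])
  have "(\<lambda>z. deriv g z + a * (inverse z * g z)) has_laurent_expansion
          fls_deriv Y + fls_const a * (inverse fls_X * Y)"
    by (intro laurent_expansion_intros g)
  also have "fls_deriv Y + fls_const a * (inverse fls_X * Y) = X"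
  proof (rule fls_eqI)
    fix n
    have "fls_nth (fls_deriv Y + fls_const a * (inverse fls_X * Y)) n = (of_int (n + 1) + a) * fls_nth Y (n + 1)"
      by (simp add: fls_inverse_X fls_X_inv_times_conv_shift algebra_simps)
    also have "\<dots> = fls_nth X n"
    proof (cases "n < N")
      case True
      thus ?thesis by (simp add: Y_def X_eq)
    next
      case False
      define k where "k = nat (n - N)"
      have n: "n = N + int k" using False by (simp add: k_def)
      have "fls_nth Y (n + 1) = fps_nth P k / b k" by (simp add: Y_def n)
      moreover have "of_int (n + 1) + a = b k" by (simp add: b_def n)
      ultimately show ?thesis using b0[of k] by (simp add: X_eq n)
    qed
    finally show "fls_nth (fls_deriv Y + fls_const a * (inverse fls_X * Y)) n = fls_nth X n" .
  qed
  finally have "(\<lambda>z. deriv g z + a * (inverse z * g z) - f z) has_laurent_expansion X - X"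
    by (intro has_laurent_expansion_diff X)
  hence "\<forall>\<^sub>F z in at 0. deriv g z + a * (inverse z * g z) - f z = 0"
    using has_laurent_expansion_eventually_zero_iff[of "\<lambda>z. deriv g z + a * (inverse z * g z) - f z" 0] by simp
  hence ev: "\<forall>\<^sub>F z in at 0. deriv g z + a / z * g z = f z"
    by eventually_elim (simp add: divide_inverse mult.assoc)
  have "g meromorphic_on {0}" using g by (auto simp: meromorphic_on_def)
  with ev that show ?thesis by blast
qed

lemma meromorphic_atD:
  assumes "f meromorphic_on {p}"
  shows "isolated_singularity_at f p" "not_essential f p"
  using assms by (simp_all add: meromorphic_at_iff)

lemma eventually_differentiable:
  assumes "f meromorphic_on {p}"
  shows "\<forall>\<^sub>F u in at p. (f has_field_derivative deriv f u) (at u)"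
proof -
  obtain R where R: "R > 0" "f analytic_on ball p R - {p}"
    using meromorphic_atD(1)[OF assms] by (auto simp: isolated_singularity_at_def)
  have "\<forall>\<^sub>F u in at p. u \<in> ball p R - {p}"
    using R(1) by (intro eventually_at_in_open) auto
  thus ?thesis
    by eventually_elim (use R(2) in \<open>auto intro!: analytic_derivI intro: analytic_on_subset\<close>)
qed

text \<open>
  Split \<open>W = a/(u - p) + w\<close> with \<open>w\<close> holomorphic, and let \<open>E\<close> be the exponential of a primitive of \<open>w\<close>. Then \<open>f\<close> solves
  the equation if and only if \<open>h = f E\<close> solves \<open>h' + a/(u - p) h = \<phi> E\<close>.
\<close>
lemma local_solution_exists:
  assumes W: "W meromorphic_on {p}" "\<And>n. n < -1 \<Longrightarrow> lcoeff W p n = 0" "lcoeff W p (-1) \<notin> \<int>"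
    and \<phi>: "\<phi> meromorphic_on {p}"
  obtains f where "f meromorphic_on {p}" "\<forall>\<^sub>F u in at p. deriv f u + f u * W u = \<phi> u"
proof -
  define a where "a = lcoeff W p (-1)"
  define G where "G = (\<lambda>u. W u - a * (1 / (u - p)))"
  have pole: "(\<lambda>u. u - p) analytic_on {p}" by (intro analytic_intros)
  have mero_1: "(\<lambda>u. 1 / (u - p)) meromorphic_on {p}" by (intro meromorphic_intros)
  hence mero_a: "(\<lambda>u. a * (1 / (u - p))) meromorphic_on {p}" by (intro meromorphic_on_mult meromorphic_on_const)
  have "deriv (\<lambda>u. u - p) u = 1" for u by (intro DERIV_imp_deriv) (auto intro!: derivative_eq_intros)
  hence 1: "n < -1 \<Longrightarrow> lcoeff (\<lambda>u. 1 / (u - p)) p n = 0" "lcoeff (\<lambda>u. 1 / (u - p)) p (-1) = 1" for n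
    using logderiv_lcoeff[OF pole] by (simp_all add: logderiv_def[abs_def])
  have G: "G meromorphic_on {p}" unfolding G_def by (intro meromorphic_on_diff W(1) mero_a)
  have "lcoeff G p n = 0" if "n < 0" for n
  proof -
    have "lcoeff G p n = lcoeff W p n - a * lcoeff (\<lambda>u. 1 / (u - p)) p n"
      unfolding G_def by (subst lcoeff_diff[OF W(1) mero_a]) (simp only: lcoeff_cmult mero_1)
    thus ?thesis using that 1 W(2)[of n] by (cases "n = -1") (auto simp: a_def)
  qed
  hence "\<not> is_pole G p" using not_is_pole_iff_lcoeff[OF G] by blast
  then obtain c where "G \<midarrow>p\<rightarrow> c"
    using meromorphic_atD(2)[OF G] by (auto simp: not_essential_def)
  hence ana: "remove_sings G analytic_on {p}"
    using meromorphic_atD(1)[OF G] by (intro remove_sings_analytic_at) auto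
  define w where "w = remove_sings G"
  obtain r where r: "r > 0" "w holomorphic_on ball p r"
    using ana unfolding w_def analytic_on_def by auto
  obtain Om where Om: "\<And>x. x \<in> ball p r \<Longrightarrow> (Om has_field_derivative w x) (at x within ball p r)"
    using holomorphic_convex_primitive'[OF convex_ball open_ball r(2)] by blast
  have Om': "(Om has_field_derivative w x) (at x)" if "x \<in> ball p r" for x
    using Om[OF that] that by (simp add: at_within_open[OF that])
  define E where "E = (\<lambda>u. exp (Om u))"
  have E: "(E has_field_derivative E u * w u) (at u)" if "u \<in> ball p r" for u
    unfolding E_def by (rule DERIV_chain2[OF DERIV_exp Om'[OF that]])
  have "E holomorphic_on ball p r"
    unfolding holomorphic_on_open[OF open_ball] using E by blast
  hence E_ana: "E analytic_on {p}" using r(1) by (auto simp: analytic_at intro!: exI[of _ "ball p r"])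
  have E_mero: "E meromorphic_on {p}" using E_ana by (rule analytic_on_imp_meromorphic_on)
  have "(\<lambda>u. \<phi> u * E u) meromorphic_on {p}" by (intro meromorphic_on_mult \<phi> E_mero)
  from laurent_euler_equation[OF meromorphic_at_expansion[OF this], of a]
  obtain g where g: "g meromorphic_on {0}" "\<forall>\<^sub>F x in at 0. deriv g x + a / x * g x = \<phi> (p + x) * E (p + x)"
    using W(3) by (auto simp: a_def)
  define h where "h = (\<lambda>u. g (u - p))"
  have h: "h meromorphic_on {p}"
    unfolding h_def by (rule meromorphic_on_compose[OF g(1)]) (auto intro!: analytic_intros)
  have dh: "deriv h u = deriv g (u - p)" for u
    using deriv_shift[of h p "u - p"] by (simp add: h_def)
  have ev_h: "\<forall>\<^sub>F u in at p. deriv h u + a / (u - p) * h u = \<phi> u * E u"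
    using g(2) by (simp add: eventually_at_to_0[of _ p] dh) (simp add: h_def add_ac)
  define f where "f = (\<lambda>u. h u / E u)"
  have f: "f meromorphic_on {p}" unfolding f_def by (intro meromorphic_on_divide h E_mero)
  have "\<forall>\<^sub>F u in at p. u \<in> ball p r - {p}"
    using r(1) by (intro eventually_at_in_open) auto
  moreover have "\<forall>\<^sub>F u in at p. w u = G u"
    unfolding w_def using meromorphic_atD(1)[OF G]
    by (intro eventually_remove_sings_eq_at) auto
  ultimately have "\<forall>\<^sub>F u in at p. deriv f u + f u * W u = \<phi> u"
    using ev_h eventually_differentiable[OF h]
  proof eventually_elim
    case (elim u)
    have "E u \<noteq> 0" by (simp add: E_def)
    with elim(4) have "(f has_field_derivative (deriv h u * E u - h u * (E u * w u)) / (E u * E u)) (at u)"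
      unfolding f_def using elim(1) by (intro DERIV_divide E) auto
    hence "deriv f u = (deriv h u * E u - h u * (E u * w u)) / (E u * E u)" by (rule DERIV_imp_deriv)
    also have "\<dots> = (deriv h u - h u * w u) / E u" using \<open>E u \<noteq> 0\<close> by (simp add: field_simps)
    finally have "deriv f u + f u * W u = (deriv h u + h u * (W u - w u)) / E u"
      using \<open>E u \<noteq> 0\<close> by (simp add: f_def divide_simps) (simp add: algebra_simps)
    also have "W u - w u = a / (u - p)" using elim(2) by (simp add: G_def)
    also have "(deriv h u + h u * (a / (u - p))) / E u = \<phi> u"
      using elim(3) \<open>E u \<noteq> 0\<close> by (simp add: field_simps)
    finally show ?case .
  qed
  with f that show ?thesis by blast
qed

text \<open>
  The difference \<open>d\<close> of two solutions satisfies \<open>d' + d W = 0\<close>. If its leading exponent were \<open>n\<close>, the coefficient of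
  index \<open>n - 1\<close> would force the residue of \<open>W\<close> to be \<open>- n\<close>.
\<close>
lemma local_solution_unique:
  assumes W: "W meromorphic_on {p}" "\<And>n. n < -1 \<Longrightarrow> lcoeff W p n = 0" "lcoeff W p (-1) \<notin> \<int>"
    and f: "f meromorphic_on {p}" "\<forall>\<^sub>F u in at p. deriv f u + f u * W u = \<phi> u"
    and g: "g meromorphic_on {p}" "\<forall>\<^sub>F u in at p. deriv g u + g u * W u = \<phi> u"
  shows "\<forall>\<^sub>F u in at p. f u = g u"
proof -
  define d where "d = (\<lambda>u. f u - g u)"
  have d: "d meromorphic_on {p}" unfolding d_def by (intro meromorphic_on_diff f g)
  have zero: "\<forall>\<^sub>F u in at p. deriv d u + d u * W u = 0"
    using f(2) g(2) eventually_differentiable[OF f(1)] eventually_differentiable[OF g(1)]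
  proof eventually_elim
    case (elim u)
    have "(d has_field_derivative deriv f u - deriv g u) (at u)"
      unfolding d_def by (intro derivative_intros elim)
    hence "deriv d u = deriv f u - deriv g u" by (rule DERIV_imp_deriv)
    hence "deriv d u + d u * W u = (deriv f u + f u * W u) - (deriv g u + g u * W u)"
      by (simp add: d_def left_diff_distrib)
    thus ?case by (simp only: elim(1,2) diff_self)
  qed
  define D where "D = laurent_expansion d p"
  have "D = 0"
  proof (rule ccontr)
    assume "D \<noteq> 0"
    define n where "n = fls_subdegree D"
    have low: "\<And>i. i < n \<Longrightarrow> lcoeff d p i = 0" by (simp add: lcoeff_def n_def D_def)
    have lead: "lcoeff d p n \<noteq> 0" using \<open>D \<noteq> 0\<close> by (simp add: lcoeff_def n_def D_def)
    have "lcoeff (\<lambda>u. deriv d u + d u * W u) p (n - 1) =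
        lcoeff (deriv d) p (n - 1) + lcoeff (\<lambda>u. d u * W u) p (n - 1)"
      by (intro lcoeff_add meromorphic_on_deriv meromorphic_on_mult d W)
    also have "\<dots> = (of_int n + lcoeff W p (-1)) * lcoeff d p n"
      using lcoeff_mult_lowest(2)[OF d W(1), of n "-1", OF low W(2)]
      by (simp add: lcoeff_deriv d algebra_simps)
    also have "lcoeff (\<lambda>u. deriv d u + d u * W u) p (n - 1) = lcoeff (\<lambda>_. 0) p (n - 1)"
      by (rule lcoeff_cong_ev[OF zero])
    also have "lcoeff (\<lambda>_. 0) p (n - 1) = 0"
      using lcoeff_cmult[OF meromorphic_on_const, of 0 0 p "n - 1"] by simp
    finally have "lcoeff W p (-1) = of_int (- n)" using lead by (simp add: eq_neg_iff_add_eq_0 add.commute)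
    thus False using W(3) by (metis Ints_of_int)
  qed
  hence "\<forall>\<^sub>F u in at p. d u = 0"
    using has_laurent_expansion_eventually_zero_iff[OF meromorphic_at_expansion[OF d]] by (simp add: D_def)
  thus ?thesis by eventually_elim (simp add: d_def)
qed

lemma eventually_reflect:
  fixes p :: complex
  assumes "\<forall>\<^sub>F u in at p. P u" shows "\<forall>\<^sub>F u in at p. P (2 * p - u)"
proof -
  have "filterlim (\<lambda>u. 2 * p - u) (at p) (at p)"
  proof (rule filterlim_atI)
    have "((\<lambda>u. 2 * p - u) \<longlongrightarrow> 2 * p - p) (at p)" by (intro tendsto_intros)
    thus "((\<lambda>u. 2 * p - u) \<longlongrightarrow> p) (at p)" by simp
    show "\<forall>\<^sub>F u in at p. 2 * p - u \<noteq> p"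
      by (rule eventually_at_filter[THEN iffD2]) (auto simp: algebra_simps)
  qed
  with assms show ?thesis by (rule eventually_compose_filterlim)
qed

text \<open>
  If \<open>W\<close> is odd about \<open>p\<close> and \<open>\<phi>\<close> has parity \<open>s\<close>, then \<open>- s f(2p - u)\<close> solves the same equation as \<open>f\<close>; by uniqueness
  they agree. So solving the equation reverses the parity.
\<close>
lemma local_solution_reflect:
  assumes W: "W meromorphic_on {p}" "\<And>n. n < -1 \<Longrightarrow> lcoeff W p n = 0" "lcoeff W p (-1) \<notin> \<int>"
    and f: "f meromorphic_on {p}" "\<forall>\<^sub>F u in at p. deriv f u + f u * W u = \<phi> u"
    and W_odd: "\<forall>\<^sub>F u in at p. W (2 * p - u) = - W u"
    and \<phi>: "\<forall>\<^sub>F u in at p. \<phi> (2 * p - u) = s * \<phi> u" and s: "s * s = 1"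
  shows "\<forall>\<^sub>F u in at p. f (2 * p - u) = - s * f u"
proof -
  define g where "g = (\<lambda>u. - s * f (2 * p - u))"
  have g: "g meromorphic_on {p}"
  proof -
    have "(\<lambda>u. f (2 * p - u)) meromorphic_on {p}"
      by (rule meromorphic_on_compose[OF f(1)]) (auto intro!: analytic_intros)
    thus ?thesis unfolding g_def by (intro meromorphic_on_mult meromorphic_on_const)
  qed
  from eventually_reflect[OF eventually_differentiable[OF f(1)]] eventually_reflect[OF f(2)] W_odd \<phi>
  have "\<forall>\<^sub>F u in at p. deriv g u + g u * W u = \<phi> u"
  proof eventually_elim
    case (elim u)
    define v where "v = 2 * p - u"
    have "(f has_field_derivative deriv f v) (at v)"
      using elim(1) by (simp add: v_def)
    hence "((\<lambda>u. f (2 * p - u)) has_field_derivative deriv f v * (0 - 1)) (at u)"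
      unfolding v_def by (rule DERIV_chain2) (intro derivative_intros)
    hence "(g has_field_derivative - s * (deriv f v * (0 - 1))) (at u)"
      unfolding g_def by (rule DERIV_cmult)
    hence "deriv g u = s * deriv f v" by (intro DERIV_imp_deriv) simp
    also have "deriv f v = s * \<phi> u + f v * W u" using elim(2,3,4) by (simp add: v_def algebra_simps)
    finally show ?case using s by (simp add: g_def v_def algebra_simps flip: mult.assoc)
  qed
  from local_solution_unique[OF W f g this] have "\<forall>\<^sub>F u in at p. f u = - s * f (2 * p - u)"
    by (simp add: g_def)
  thus ?thesis
  proof eventually_elim
    case (elim u)
    hence "- s * f u = (s * s) * f (2 * p - u)" by simp
    thus ?case using s by simp
  qed
qed

section \<open>The intersection number of forms of opposite parity\<close>

lemma nabla_conv_twisted_deriv: "nabla \<tau> \<alpha> \<beta> \<gamma> = twisted_deriv \<tau> (omega \<tau> \<alpha> \<beta> \<gamma>)"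
  by (auto simp: nabla_def twisted_deriv_def)

lemma omega_minus_parameters: "omega \<tau> (- \<alpha>) (- \<beta>) (- \<gamma>) u = - omega \<tau> \<alpha> \<beta> \<gamma> u"
  by (simp add: omega_def algebra_simps)

text \<open>
  Negating the parameters turns \<open>T\<close> into \<open>1/T\<close>. So every statement about \<open>\<nabla>\<close> that holds for all parameters contains its
  dual.
\<close>
lemma nabla_dual_conv_nabla: "nabla_dual \<tau> \<alpha> \<beta> \<gamma> = nabla \<tau> (- \<alpha>) (- \<beta>) (- \<gamma>)"
  unfolding nabla_def nabla_dual_def omega_minus_parameters by simp

lemma nabla_in_mero_functions:
  assumes "Im \<tau> > 0" "f \<in> mero_functions \<tau>"
  shows "nabla \<tau> \<alpha> \<beta> \<gamma> f \<in> mero_functions \<tau>"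
  unfolding nabla_conv_twisted_deriv
  by (rule twisted_deriv_in_mero_functions[OF assms(1) omega_on_M[OF assms(1)] assms(2)])

lemma mero_functions_reflect_at:
  assumes "Im \<tau> > 0" "f \<in> mero_functions \<tau>" "p \<in> D_reps \<tau>"
  shows "f (2 * p - u) = f (- u)"
  using mero_functionsD(6)[OF assms(1,2) D_reps_twice[OF assms(1,3)], of "- u"] by simp

lemma omega_reflect_at:
  assumes tau: "Im \<tau> > 0" and p: "p \<in> D_reps \<tau>"
  shows "\<forall>\<^sub>F u in at p. omega \<tau> \<alpha> \<beta> \<gamma> (2 * p - u) = - omega \<tau> \<alpha> \<beta> \<gamma> u"
  using eventually_not_in_D_lift[OF tau, of p] eventually_reflect[OF eventually_not_in_D_lift[OF tau, of p]]
proof eventually_elim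
  case (elim u)
  thus ?case
    using mero_functions_reflect_at[OF tau omega_on_M[OF tau, of \<alpha> \<beta> \<gamma>] p, of u]
    by (simp add: tau D_lift_uminus_iff omega_odd)
qed

text \<open>
  Let \<open>g\<close> be the local solution for \<open>\<phi> + \<nabla>F\<close> at \<open>p\<close>; then \<open>f = g - F\<close> is the one for \<open>\<phi>\<close>. Since
  \<open>f \<nabla>\<^sup>\<or>G = (f G)' - G \<phi>\<close>, near \<open>p\<close>
  \<open>g (\<psi> + \<nabla>\<^sup>\<or>G) = f \<psi> + (f G)' - G \<phi> + F (\<psi> + \<nabla>\<^sup>\<or>G)\<close>.
  The first summand is even about \<open>p\<close>, because \<open>f\<close> has the parity opposite to \<open>\<phi>\<close>; so it has no residue, and neither has a
  derivative. The other two are global functions, whose residues sum to \<open>0\<close> over \<open>D\<close>.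
\<close>
lemma intersection_number_opposite_parity:
  assumes tau: "Im \<tau> > 0"
    and nonint: "2 * \<alpha> \<notin> \<int>" "2 * \<gamma> - 2 * \<alpha> \<notin> \<int>" "- 2 * \<beta> \<notin> \<int>" "2 * \<beta> - 2 * \<gamma> \<notin> \<int>"
    and V: "\<phi> \<in> mero_functions \<tau>" "\<psi> \<in> mero_functions \<tau>" "F \<in> mero_functions \<tau>" "G \<in> mero_functions \<tau>"
    and parity: "\<And>u. \<phi> (- u) = s * \<phi> u" "\<And>u. \<psi> (- u) = - s * \<psi> u" and s: "s * s = 1"
  shows "intersection_number \<tau> \<alpha> \<beta> \<gamma> (\<lambda>u. \<phi> u + nabla \<tau> \<alpha> \<beta> \<gamma> F u) (\<lambda>u. \<psi> u + nabla_dual \<tau> \<alpha> \<beta> \<gamma> G u) = 0"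
proof -
  define W where "W = omega \<tau> \<alpha> \<beta> \<gamma>"
  define \<Phi> where "\<Phi> = (\<lambda>u. \<phi> u + nabla \<tau> \<alpha> \<beta> \<gamma> F u)"
  define \<Psi> where "\<Psi> = (\<lambda>u. \<psi> u + nabla_dual \<tau> \<alpha> \<beta> \<gamma> G u)"
  have \<Phi>: "\<Phi> \<in> mero_functions \<tau>" unfolding \<Phi>_def
    by (intro mero_functions_add V nabla_in_mero_functions tau)
  have \<Psi>: "\<Psi> \<in> mero_functions \<tau>" unfolding \<Psi>_def nabla_dual_conv_nabla
    by (intro mero_functions_add V nabla_in_mero_functions tau)
  note mero = mero_functionsD(2)[OF tau V(1)] mero_functionsD(2)[OF tau V(2)]
    mero_functionsD(2)[OF tau V(3)] mero_functionsD(2)[OF tau V(4)]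
    mero_functionsD(2)[OF tau \<Phi>] mero_functionsD(2)[OF tau \<Psi>]
  have main: "residue (\<lambda>u. (SOME f. local_solution \<tau> \<alpha> \<beta> \<gamma> \<Phi> p f) u * \<Psi> u) p =
      lcoeff (\<lambda>u. F u * \<Psi> u) p (-1) - lcoeff (\<lambda>u. G u * \<phi> u) p (-1)" if p: "p \<in> D_reps \<tau>" for p
  proof -
    have W: "W meromorphic_on {p}" "\<And>n. n < -1 \<Longrightarrow> lcoeff W p n = 0" "lcoeff W p (-1) \<notin> \<int>"
      unfolding W_def using omega_meromorphic[OF tau] omega_lcoeff(1)[OF tau p]
        omega_residue_not_Ints[OF tau nonint p] by auto
    define g where "g = (SOME f. local_solution \<tau> \<alpha> \<beta> \<gamma> \<Phi> p f)"
    obtain g0 where "g0 meromorphic_on {p}" "\<forall>\<^sub>F u in at p. deriv g0 u + g0 u * W u = \<Phi> u"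
      using local_solution_exists[OF W mero(5)] .
    hence "local_solution \<tau> \<alpha> \<beta> \<gamma> \<Phi> p g0" by (simp add: local_solution_def W_def)
    hence "local_solution \<tau> \<alpha> \<beta> \<gamma> \<Phi> p g" unfolding g_def by (rule someI[of "local_solution \<tau> \<alpha> \<beta> \<gamma> \<Phi> p"])
    hence g: "g meromorphic_on {p}" "\<forall>\<^sub>F u in at p. deriv g u + g u * W u = \<Phi> u"
      by (simp_all add: local_solution_def W_def)
    define f where "f = (\<lambda>u. g u - F u)"
    have f: "f meromorphic_on {p}" unfolding f_def by (intro meromorphic_on_diff g mero)
    note off = eventually_not_in_D_lift[OF tau, of p]
    have f_sol: "\<forall>\<^sub>F u in at p. deriv f u + f u * W u = \<phi> u"
      using eventually_differentiable[OF g(1)] eventually_differentiable[OF mero(3)] g(2) off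
    proof eventually_elim
      case (elim u)
      have "(f has_field_derivative deriv g u - deriv F u) (at u)"
        unfolding f_def by (intro DERIV_diff elim)
      hence "deriv f u = deriv g u - deriv F u" by (rule DERIV_imp_deriv)
      hence "deriv f u + f u * W u = (deriv g u + g u * W u) - (deriv F u + F u * W u)"
        by (simp add: f_def left_diff_distrib)
      also have "deriv F u + F u * W u = nabla \<tau> \<alpha> \<beta> \<gamma> F u"
        using elim(4) by (simp add: nabla_def W_def tau)
      finally show ?case using elim(3) by (simp add: \<Phi>_def)
    qed
    have "\<forall>\<^sub>F u in at p. f (2 * p - u) = - s * f u"
    proof (rule local_solution_reflect[OF W f f_sol _ _ s])
      show "\<forall>\<^sub>F u in at p. W (2 * p - u) = - W u" unfolding W_def by (rule omega_reflect_at[OF tau p])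
      show "\<forall>\<^sub>F u in at p. \<phi> (2 * p - u) = s * \<phi> u"
        using mero_functions_reflect_at[OF tau V(1) p] parity(1) by simp
    qed
    hence "\<forall>\<^sub>F u in at p. f (2 * p - u) * \<psi> (2 * p - u) = f u * \<psi> u"
    proof eventually_elim
      case (elim u)
      have "f (2 * p - u) * \<psi> (2 * p - u) = (s * s) * (f u * \<psi> u)"
        using mero_functions_reflect_at[OF tau V(2) p, of u] parity(2)[of u] elim by simp
      thus ?case using s by simp
    qed
    hence "residue (\<lambda>u. f u * \<psi> u) p = 0"
      by (intro residue_even_eq_0 meromorphic_on_mult f mero)
    hence even: "lcoeff (\<lambda>u. f u * \<psi> u) p (-1) = 0"
      by (subst (asm) lcoeff_residue) (intro meromorphic_on_mult f mero)
    have "\<forall>\<^sub>F u in at p. g u * \<Psi> u = f u * \<psi> u + (deriv (\<lambda>u. f u * G u) u - G u * \<phi> u) + F u * \<Psi> u"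
      using eventually_differentiable[OF f] eventually_differentiable[OF mero(4)] f_sol off
    proof eventually_elim
      case (elim u)
      have "((\<lambda>u. f u * G u) has_field_derivative deriv f u * G u + deriv G u * f u) (at u)"
        by (intro DERIV_mult elim)
      hence dfG: "deriv (\<lambda>u. f u * G u) u = deriv f u * G u + deriv G u * f u" by (rule DERIV_imp_deriv)
      have Psi_eq: "\<Psi> u = \<psi> u + (deriv G u - G u * W u)"
        using elim(4) by (simp add: \<Psi>_def nabla_dual_def W_def tau)
      have "g u * \<Psi> u = f u * \<Psi> u + F u * \<Psi> u" by (simp add: f_def algebra_simps)
      also have "f u * \<Psi> u = f u * \<psi> u + (deriv (\<lambda>u. f u * G u) u - G u * \<phi> u)"
        unfolding elim(3)[symmetric] Psi_eq dfG by (simp add: algebra_simps)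
      finally show ?case .
    qed
    hence "residue (\<lambda>u. g u * \<Psi> u) p =
        residue (\<lambda>u. f u * \<psi> u + (deriv (\<lambda>u. f u * G u) u - G u * \<phi> u) + F u * \<Psi> u) p"
      by (rule residue_cong) simp
    also have "\<dots> = lcoeff (\<lambda>u. f u * \<psi> u + (deriv (\<lambda>u. f u * G u) u - G u * \<phi> u) + F u * \<Psi> u) p (-1)"
      by (intro lcoeff_residue meromorphic_on_add meromorphic_on_diff meromorphic_on_deriv meromorphic_on_mult f mero)
    also have "\<dots> = lcoeff (\<lambda>u. f u * \<psi> u) p (-1) + (lcoeff (deriv (\<lambda>u. f u * G u)) p (-1) -
        lcoeff (\<lambda>u. G u * \<phi> u) p (-1)) + lcoeff (\<lambda>u. F u * \<Psi> u) p (-1)"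
      using f mero by (simp add: lcoeff_add lcoeff_diff meromorphic_on_add meromorphic_on_diff
          meromorphic_on_deriv meromorphic_on_mult)
    also have "lcoeff (deriv (\<lambda>u. f u * G u)) p (-1) = 0"
      by (subst lcoeff_deriv) (auto intro!: meromorphic_on_mult f mero)
    finally show ?thesis using even by (simp add: g_def)
  qed
  have "(\<Sum>p\<in>D_reps \<tau>. residue (\<lambda>u. (SOME f. local_solution \<tau> \<alpha> \<beta> \<gamma> \<Phi> p f) u * \<Psi> u) p) =
      (\<Sum>p\<in>D_reps \<tau>. lcoeff (\<lambda>u. F u * \<Psi> u) p (-1)) - (\<Sum>p\<in>D_reps \<tau>. lcoeff (\<lambda>u. G u * \<phi> u) p (-1))"
    by (subst sum_subtractf [symmetric], intro sum.cong refl main)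
  also have "\<dots> = 0"
    using sum_residues_eq_0[OF tau mero_functions_mult[OF tau V(3) \<Psi>]]
      sum_residues_eq_0[OF tau mero_functions_mult[OF tau V(4,1)]] by simp
  finally show ?thesis unfolding intersection_number_def \<Phi>_def [symmetric] \<Psi>_def [symmetric] by simp
qed

section \<open>Linear involutions and quotient spaces\<close>

text \<open>
  The axioms with the operations of \<open>class_ring\<close> already replaced by those of \<open>\<complex>\<close>.
\<close>
lemma vectorspace_class_ring_rules:
  fixes V :: "(complex, 'b) module"
  assumes "vectorspace class_ring V"
  shows "\<And>c v. v \<in> carrier V \<Longrightarrow> c \<odot>\<^bsub>V\<^esub> v \<in> carrier V"
    and "\<And>a b v. v \<in> carrier V \<Longrightarrow> (a + b) \<odot>\<^bsub>V\<^esub> v = a \<odot>\<^bsub>V\<^esub> v \<oplus>\<^bsub>V\<^esub> b \<odot>\<^bsub>V\<^esub> v"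
    and "\<And>a v w. v \<in> carrier V \<Longrightarrow> w \<in> carrier V \<Longrightarrow> a \<odot>\<^bsub>V\<^esub> (v \<oplus>\<^bsub>V\<^esub> w) = a \<odot>\<^bsub>V\<^esub> v \<oplus>\<^bsub>V\<^esub> a \<odot>\<^bsub>V\<^esub> w"
    and "\<And>a b v. v \<in> carrier V \<Longrightarrow> (a * b) \<odot>\<^bsub>V\<^esub> v = a \<odot>\<^bsub>V\<^esub> (b \<odot>\<^bsub>V\<^esub> v)"
    and "\<And>v. v \<in> carrier V \<Longrightarrow> 1 \<odot>\<^bsub>V\<^esub> v = v"
    and "\<And>v. v \<in> carrier V \<Longrightarrow> 0 \<odot>\<^bsub>V\<^esub> v = \<zero>\<^bsub>V\<^esub>"
proof -
  interpret vectorspace "class_ring :: complex ring" V by fact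
  show "\<And>c v. v \<in> carrier V \<Longrightarrow> c \<odot>\<^bsub>V\<^esub> v \<in> carrier V" using smult_closed by simp
  show "\<And>a b v. v \<in> carrier V \<Longrightarrow> (a + b) \<odot>\<^bsub>V\<^esub> v = a \<odot>\<^bsub>V\<^esub> v \<oplus>\<^bsub>V\<^esub> b \<odot>\<^bsub>V\<^esub> v"
    using smult_l_distr by simp
  show "\<And>a v w. v \<in> carrier V \<Longrightarrow> w \<in> carrier V \<Longrightarrow> a \<odot>\<^bsub>V\<^esub> (v \<oplus>\<^bsub>V\<^esub> w) = a \<odot>\<^bsub>V\<^esub> v \<oplus>\<^bsub>V\<^esub> a \<odot>\<^bsub>V\<^esub> w"
    using smult_r_distr by simp
  show "\<And>a b v. v \<in> carrier V \<Longrightarrow> (a * b) \<odot>\<^bsub>V\<^esub> v = a \<odot>\<^bsub>V\<^esub> (b \<odot>\<^bsub>V\<^esub> v)"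
    using smult_assoc1 by simp
  show "\<And>v. v \<in> carrier V \<Longrightarrow> 1 \<odot>\<^bsub>V\<^esub> v = v" using smult_one by simp
  show "\<And>v. v \<in> carrier V \<Longrightarrow> 0 \<odot>\<^bsub>V\<^esub> v = \<zero>\<^bsub>V\<^esub>" using lmult_0 by simp
qed

locale linear_involution = vectorspace "class_ring :: complex ring" V for V :: "(complex, 'b) module" (structure) +
  fixes F :: "'b \<Rightarrow> 'b"
  assumes F_closed: "v \<in> carrier V \<Longrightarrow> F v \<in> carrier V"
    and F_add: "v \<in> carrier V \<Longrightarrow> w \<in> carrier V \<Longrightarrow> F (v \<oplus> w) = F v \<oplus> F w"
    and F_smult: "v \<in> carrier V \<Longrightarrow> F (c \<odot> v) = c \<odot> F v"
    and F_F: "v \<in> carrier V \<Longrightarrow> F (F v) = v"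
begin

lemma vs: "vectorspace (class_ring :: complex ring) V" ..

lemmas rules = vectorspace_class_ring_rules[OF vs]

lemma F_zero: "F \<zero> = \<zero>"
  using F_smult[of "\<zero>" 0] F_closed[of "\<zero>"] rules(6) by simp

lemma submodule_eigenspace: "submodule class_ring (eigenspace V F c) V"
proof
  show "eigenspace V F c \<subseteq> carrier V" by (auto simp: eigenspace_def)
  show "\<zero> \<in> eigenspace V F c"
    using rules(4)[of "\<zero>" c 0] rules(6)[of "\<zero>"] by (simp add: eigenspace_def F_zero)
next
  fix v w assume "v \<in> eigenspace V F c" "w \<in> eigenspace V F c"
  thus "v \<oplus> w \<in> eigenspace V F c" by (simp add: eigenspace_def F_add rules(3))
next
  fix a v assume "v \<in> eigenspace V F c"
  thus "a \<odot> v \<in> eigenspace V F c"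
    using rules(4)[of v a c] rules(4)[of v c a]
    by (simp add: eigenspace_def F_smult rules(1) mult.commute)
qed

lemma subspace_eigenspace: "VectorSpace.subspace class_ring (eigenspace V F c) V"
  using vs submodule_eigenspace by (simp add: VectorSpace.subspace_def)

lemma smult_eq_zero:
  assumes "v \<in> carrier V" "c \<odot> v = \<zero>" "c \<noteq> 0"
  shows "v = \<zero>"
proof -
  have "v = (inverse c * c) \<odot> v" using assms by (simp add: rules(5))
  also have "\<dots> = inverse c \<odot> (c \<odot> v)" by (rule rules(4)[OF assms(1)])
  also have "\<dots> = inverse c \<odot> (0 \<odot> v)" using assms rules(6) by simp
  also have "\<dots> = (inverse c * 0) \<odot> v" by (rule rules(4)[OF assms(1), symmetric])
  finally show ?thesis using rules(6)[OF assms(1)] by simp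
qed

lemma is_direct_sum_eigenspaces: "is_direct_sum V (eigenspace V F (-1)) (eigenspace V F 1)"
proof -
  have "submodule_sum (eigenspace V F (-1)) (eigenspace V F 1) = carrier V"
  proof (intro equalityI subsetI)
    fix v assume v: "v \<in> carrier V"
    \<comment> \<open>the projections of \<open>v\<close> to the two eigenspaces\<close>
    define x where "x = (1/2) \<odot> (v \<oplus> (-1) \<odot> F v)"
    define y where "y = (1/2) \<odot> (v \<oplus> F v)"
    note c = v F_closed[OF v] rules(1)[OF v] rules(1)[OF F_closed[OF v]]
    have "(-1) \<odot> ((-1) \<odot> F v) = F v"
      using rules(4)[OF c(2), of "-1" "-1"] rules(5)[OF c(2)] by simp
    hence "F (v \<oplus> (-1) \<odot> F v) = (-1) \<odot> (v \<oplus> (-1) \<odot> F v)"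
      using c by (simp add: F_add F_smult F_F rules(3) a_comm)
    hence "x \<in> eigenspace V F (-1)"
      using c rules(4)[of "v \<oplus> (-1) \<odot> F v" "-1" "1/2"] rules(4)[of "v \<oplus> (-1) \<odot> F v" "1/2" "-1"]
      by (simp add: eigenspace_def x_def F_smult rules(1))
    moreover have "F (v \<oplus> F v) = v \<oplus> F v" using c by (simp add: F_add F_F a_comm)
    hence "y \<in> eigenspace V F 1" using c by (simp add: eigenspace_def y_def F_smult rules(1,5))
    moreover have "x \<oplus> y = v"
    proof -
      have "(v \<oplus> (-1) \<odot> F v) \<oplus> (v \<oplus> F v) = (v \<oplus> v) \<oplus> ((-1) \<odot> F v \<oplus> F v)"
        using c by (simp add: a_ac)
      also have "(-1) \<odot> F v \<oplus> F v = \<zero>"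
        using rules(2)[OF c(2), of "-1" 1] rules(5,6)[OF c(2)] by simp
      also have "v \<oplus> v = 2 \<odot> v" using rules(2)[OF v, of 1 1] rules(5)[OF v] by simp
      finally have "(v \<oplus> (-1) \<odot> F v) \<oplus> (v \<oplus> F v) = 2 \<odot> v" using c by simp
      hence "x \<oplus> y = (1/2) \<odot> (2 \<odot> v)"
        unfolding x_def y_def using c by (simp flip: rules(3))
      thus ?thesis using rules(4)[OF v, of "1/2" 2] rules(5)[OF v] by simp
    qed
    ultimately show "v \<in> submodule_sum (eigenspace V F (-1)) (eigenspace V F 1)"
      unfolding submodule_sum_def by force
  qed (auto simp: submodule_sum_def eigenspace_def)
  moreover have "eigenspace V F (-1) \<inter> eigenspace V F 1 = {\<zero>}"
  proof (intro equalityI subsetI)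
    fix v assume "v \<in> eigenspace V F (-1) \<inter> eigenspace V F 1"
    hence v: "v \<in> carrier V" "1 \<odot> v = (-1) \<odot> v" by (auto simp: eigenspace_def)
    have "2 \<odot> v = 1 \<odot> v \<oplus> 1 \<odot> v" using rules(2)[OF v(1), of 1 1] by simp
    also have "\<dots> = (-1) \<odot> v \<oplus> 1 \<odot> v" using v(2) by simp
    also have "\<dots> = \<zero>" using rules(2)[OF v(1), of "-1" 1] rules(6)[OF v(1)] by simp
    finally show "v \<in> {\<zero>}" using smult_eq_zero[OF v(1)] by simp
  next
    fix v assume "v \<in> {\<zero>}"
    thus "v \<in> eigenspace V F (-1) \<inter> eigenspace V F 1"
      using submodule.zero_closed[OF submodule_eigenspace] by simp
  qed
  ultimately show ?thesis using subspace_eigenspace by (simp add: is_direct_sum_def)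
qed

text \<open>
  When four eigenvectors form a basis of the whole space, those for the eigenvalue \<open>s\<close> form a basis of its eigenspace:
  the part \<open>q\<close> of an \<open>s\<close>-eigenvector in the span of the other two satisfies \<open>- s q = s q\<close> and vanishes.
\<close>
lemma is_basis2_eigenspace:
  assumes s: "s = 1 \<or> s = -1"
    and X: "X \<in> carrier V" "F X = s \<odot> X" and Y: "Y \<in> carrier V" "F Y = s \<odot> Y"
    and Z: "Z \<in> carrier V" "F Z = (- s) \<odot> Z" and W: "W \<in> carrier V" "F W = (- s) \<odot> W"
    and span: "\<And>v. v \<in> carrier V \<Longrightarrow> \<exists>a b c d. v = (a \<odot> X \<oplus> b \<odot> Y) \<oplus> (c \<odot> Z \<oplus> d \<odot> W)"
    and indep: "\<And>a b c d. (a \<odot> X \<oplus> b \<odot> Y) \<oplus> (c \<odot> Z \<oplus> d \<odot> W) = \<zero> \<Longrightarrow> a = 0 \<and> b = 0 \<and> c = 0 \<and> d = 0"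
  shows "is_basis2 V (eigenspace V F s) X Y"
proof -
  define E where "E = eigenspace V F s"
  note cl = X(1) Y(1) Z(1) W(1) rules(1)[OF X(1)] rules(1)[OF Y(1)] rules(1)[OF Z(1)] rules(1)[OF W(1)]
  have XY: "X \<in> E" "Y \<in> E" using X Y by (simp_all add: E_def eigenspace_def)
  have indep2: "a = 0 \<and> b = 0" if "a \<odot> X \<oplus> b \<odot> Y = \<zero>" for a b
    using indep[of a b 0 0] that rules(6) cl by simp
  have ne: "X \<noteq> Y"
  proof
    assume "X = Y"
    hence "1 \<odot> X \<oplus> (-1) \<odot> Y = \<zero>"
      using rules(2)[OF X(1), of 1 "-1"] rules(6)[OF X(1)] by simp
    thus False using indep2 by fastforce
  qed
  have E_eq: "\<exists>a b. v = a \<odot> X \<oplus> b \<odot> Y" if "v \<in> E" for v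
  proof -
    have v: "v \<in> carrier V" "F v = s \<odot> v" using that by (auto simp: E_def eigenspace_def)
    obtain a b c d where v_eq: "v = (a \<odot> X \<oplus> b \<odot> Y) \<oplus> (c \<odot> Z \<oplus> d \<odot> W)"
      using span[OF v(1)] by blast
    define p where "p = a \<odot> X \<oplus> b \<odot> Y"
    define q where "q = c \<odot> Z \<oplus> d \<odot> W"
    have pq: "p \<in> carrier V" "q \<in> carrier V" using cl by (simp_all add: p_def q_def)
    have comm: "a \<odot> (b \<odot> x) = b \<odot> (a \<odot> x)" if "x \<in> carrier V" for a b x
      using rules(4)[OF that, of a b] rules(4)[OF that, of b a] by (simp add: mult.commute)
    have Fp: "F p = s \<odot> p"
      using cl X(2) Y(2) comm by (simp add: p_def F_add F_smult rules(3))
    have Fq: "F q = (- s) \<odot> q"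
      using cl Z(2) W(2) comm by (simp add: q_def F_add F_smult rules(3))
    have "s \<odot> p \<oplus> (- s) \<odot> q = s \<odot> p \<oplus> s \<odot> q"
      using v(2) pq unfolding v_eq p_def [symmetric] q_def [symmetric]
      by (simp add: F_add Fp Fq rules(3))
    hence eq: "(- s) \<odot> q = s \<odot> q" using pq rules(1) by simp
    have "(s + s) \<odot> q = (- s) \<odot> q \<oplus> s \<odot> q"
      using rules(2)[OF pq(2), of s s] eq by simp
    also have "\<dots> = \<zero>" using rules(2)[OF pq(2), of "- s" s] rules(6)[OF pq(2)] by simp
    finally have "q = \<zero>" using s by (intro smult_eq_zero[OF pq(2), of "s + s"]) auto
    hence "v = p" using pq by (simp add: v_eq flip: p_def q_def)
    thus ?thesis by (auto simp: p_def)
  qed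
  interpret S: vectorspace "class_ring :: complex ring" "V\<lparr>carrier := E\<rparr>"
    using subspace_is_vs[OF subspace_eigenspace[of s]] by (simp add: E_def)
  have S_carrier: "carrier (V\<lparr>carrier := E\<rparr>) = E" by simp
  note srules = vectorspace_class_ring_rules[OF S.vectorspace_axioms]
  have lincomb: "S.lincomb a {X, Y} = a X \<odot> X \<oplus> a Y \<odot> Y" for a
  proof -
    have "a X \<odot> X \<in> E" "a Y \<odot> Y \<in> E" using srules(1) XY by simp_all
    thus ?thesis using ne S.finsum_insert[of "{Y}" X "\<lambda>v. a v \<odot> v"]
        S.finsum_insert[of "{}" Y "\<lambda>v. a v \<odot> v"] S.r_zero[of "a Y \<odot> Y"]
      by (simp add: S.lincomb_def)
  qed
  have "S.lin_indpt {X, Y}"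
  proof (rule S.finite_lin_indpt2)
    fix a assume "S.lincomb a {X, Y} = \<zero>\<^bsub>V\<lparr>carrier := E\<rparr>\<^esub>"
    hence "a X = 0 \<and> a Y = 0" using indep2 by (simp add: lincomb)
    thus "\<forall>v\<in>{X, Y}. a v = \<zero>\<^bsub>class_ring\<^esub>" by simp
  qed (use XY in auto)
  moreover have "S.span {X, Y} = E"
  proof (intro equalityI subsetI)
    fix v assume "v \<in> E"
    then obtain a b where v: "v = a \<odot> X \<oplus> b \<odot> Y" using E_eq by blast
    have "v = S.lincomb (\<lambda>x. if x = X then a else b) {X, Y}" using ne by (simp add: lincomb v)
    moreover have "S.span {X, Y} = {S.lincomb a {X, Y} | a. a \<in> {X, Y} \<rightarrow> carrier class_ring}"
      by (rule S.finite_span) (use XY in auto)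
    ultimately show "v \<in> S.span {X, Y}" by auto
  next
    fix v assume "v \<in> S.span {X, Y}"
    thus "v \<in> E" using S.span_closed[of "{X, Y}" v] XY by simp
  qed
  ultimately show ?thesis
    unfolding is_basis2_def S.basis_def E_def [symmetric] using ne XY by simp
qed

end

locale quotient_space = vectorspace "class_ring :: complex ring" V for V :: "(complex, 'b) module" (structure) +
  fixes N
  assumes N: "submodule class_ring N V"
begin

abbreviation Q where "Q \<equiv> quot_module V N"

lemma V_vs: "vectorspace (class_ring :: complex ring) V" ..

lemmas V_rules = vectorspace_class_ring_rules[OF V_vs]

lemma N_rules: "N \<subseteq> carrier V" "\<zero> \<in> N" "v \<in> N \<Longrightarrow> w \<in> N \<Longrightarrow> v \<oplus> w \<in> N" "v \<in> N \<Longrightarrow> c \<odot> v \<in> N"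
  using submodule.subset[OF N] submodule.zero_closed[OF N] submodule.m_closed[OF N] submodule.smult_closed[OF N]
  by auto

lemma neg_eq: "v \<in> carrier V \<Longrightarrow> \<ominus> v = (-1) \<odot> v"
  using V_rules(2)[of v "-1" 1] V_rules(1)[of v "-1"] V_rules(5,6)[of v] by (intro minus_equality) auto

sublocale N: abelian_subgroup N V
proof (rule abelian_subgroupI3)
  show "additive_subgroup N V"
  proof (rule additive_subgroup.intro, rule add.subgroupI)
    show "N \<subseteq> carrier V" "N \<noteq> {}" using N_rules by auto
    show "\<ominus> v \<in> N" if "v \<in> N" for v
      using N_rules(4)[OF that, of "-1"] N_rules(1) that by (simp add: neg_eq subset_iff)
  qed (rule N_rules)
  show "abelian_group V" ..
qed

lemma Q_carrier: "carrier Q = {N +> v | v. v \<in> carrier V}"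
  by (auto simp: quot_module_def A_RCOSETS_def')

lemma coset_in_Q: "v \<in> carrier V \<Longrightarrow> N +> v \<in> carrier Q"
  by (auto simp: Q_carrier)

lemma Q_add: "v \<in> carrier V \<Longrightarrow> w \<in> carrier V \<Longrightarrow> (N +> v) \<oplus>\<^bsub>Q\<^esub> (N +> w) = N +> (v \<oplus> w)"
  by (simp add: quot_module_def N.a_rcos_sum)

lemma Q_zero: "\<zero>\<^bsub>Q\<^esub> = N +> \<zero>"
  by (simp add: quot_module_def N.a_rcos_const N_rules)

lemma coset_eq_iff:
  assumes "v \<in> carrier V" "w \<in> carrier V"
  shows "N +> v = N +> w \<longleftrightarrow> v \<oplus> (-1) \<odot> w \<in> N"
proof
  assume "N +> v = N +> w"
  hence "v \<in> N +> w" using N.a_rcos_self[OF assms(1)] by simp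
  thus "v \<oplus> (-1) \<odot> w \<in> N"
    unfolding N.a_rcos_module[OF assms(2,1)] neg_eq[OF assms(2)] .
next
  assume "v \<oplus> (-1) \<odot> w \<in> N"
  hence "v \<in> N +> w"
    unfolding N.a_rcos_module[OF assms(2,1)] neg_eq[OF assms(2)] .
  thus "N +> v = N +> w" by (rule N.a_repr_independence'[OF _ assms(2), symmetric])
qed

lemma mem_coset_iff: "v \<in> carrier V \<Longrightarrow> x \<in> N +> v \<longleftrightarrow> (\<exists>n\<in>N. x = n \<oplus> v)"
  by (auto simp: a_r_coset_def')

text \<open>
  Scaling a coset elementwise gives a coset except for \<open>c = 0\<close>, where it gives \<open>{0}\<close>; the summand \<open>N\<close> in the definition of
  the scalar multiplication of the quotient repairs this.
\<close>
lemma Q_smult: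
  assumes v: "v \<in> carrier V"
  shows "c \<odot>\<^bsub>Q\<^esub> (N +> v) = N +> (c \<odot> v)"
proof -
  have "N <+>\<^bsub>V\<^esub> ((\<lambda>a. c \<odot> a) ` (N +> v)) = N +> (c \<odot> v)"
  proof (intro equalityI subsetI)
    fix x assume "x \<in> N <+>\<^bsub>V\<^esub> ((\<lambda>a. c \<odot> a) ` (N +> v))"
    then obtain n m where nm: "n \<in> N" "m \<in> N" "x = n \<oplus> c \<odot> (m \<oplus> v)"
      using v by (auto simp: set_add_def' mem_coset_iff)
    hence "x = (n \<oplus> c \<odot> m) \<oplus> c \<odot> v"
      using v N_rules(1) V_rules(1)[OF v] V_rules(1)[of m c] by (simp add: V_rules(3) subset_iff a_assoc)
    thus "x \<in> N +> (c \<odot> v)" using nm N_rules(3,4) V_rules(1)[OF v] by (auto simp: mem_coset_iff)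
  next
    fix x assume "x \<in> N +> (c \<odot> v)"
    then obtain n where "n \<in> N" "x = n \<oplus> c \<odot> v" using V_rules(1)[OF v] by (auto simp: mem_coset_iff)
    thus "x \<in> N <+>\<^bsub>V\<^esub> ((\<lambda>a. c \<odot> a) ` (N +> v))"
      using N.a_rcos_self[OF v] by (auto simp: set_add_def')
  qed
  thus ?thesis by (simp add: quot_module_def)
qed

lemma vectorspace_Q: "vectorspace (class_ring :: complex ring) Q"
proof (rule vs_criteria)
  show "field (class_ring :: complex ring)" by (rule class_field)
  show "\<zero>\<^bsub>Q\<^esub> \<in> carrier Q" unfolding Q_zero by (rule coset_in_Q) simp
  show "\<forall>v w. v \<in> carrier Q \<and> w \<in> carrier Q \<longrightarrow> v \<oplus>\<^bsub>Q\<^esub> w \<in> carrier Q"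
    by (auto simp: Q_carrier Q_add)
  show "\<forall>v\<in>carrier Q. \<exists>neg_v\<in>carrier Q. v \<oplus>\<^bsub>Q\<^esub> neg_v = \<zero>\<^bsub>Q\<^esub>"
  proof
    fix A assume "A \<in> carrier Q"
    then obtain v where v: "v \<in> carrier V" "A = N +> v" by (auto simp: Q_carrier)
    hence "A \<oplus>\<^bsub>Q\<^esub> (N +> (\<ominus> v)) = \<zero>\<^bsub>Q\<^esub>" by (simp add: Q_add Q_zero r_neg)
    thus "\<exists>B\<in>carrier Q. A \<oplus>\<^bsub>Q\<^esub> B = \<zero>\<^bsub>Q\<^esub>" using v coset_in_Q by blast
  qed
qed (auto simp: Q_carrier Q_add Q_smult Q_zero V_rules a_ac)

end

locale quotient_involution = quotient_space V N + f: linear_involution V f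
  for V :: "(complex, 'b) module" (structure) and N f +
  assumes f_N: "n \<in> N \<Longrightarrow> f n \<in> N"
begin

lemma image_coset:
  assumes v: "v \<in> carrier V"
  shows "f ` (N +> v) = N +> f v"
proof (intro equalityI subsetI)
  fix x assume "x \<in> f ` (N +> v)"
  then obtain n where n: "n \<in> N" "x = f (n \<oplus> v)" using v by (auto simp: mem_coset_iff)
  hence "x = f n \<oplus> f v" using N_rules(1) v f.F_add by auto
  thus "x \<in> N +> f v" using f_N[OF n(1)] f.F_closed[OF v] by (auto simp: mem_coset_iff)
next
  fix x assume "x \<in> N +> f v"
  then obtain n where n: "n \<in> N" "x = n \<oplus> f v" using f.F_closed[OF v] by (auto simp: mem_coset_iff)
  have "f n \<in> carrier V" "n \<in> carrier V" using f_N n(1) N_rules(1) by auto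
  hence "x = f (f n \<oplus> v)" using v by (simp add: n(2) f.F_add f.F_F)
  thus "x \<in> f ` (N +> v)" using f_N[OF n(1)] v by (auto simp: mem_coset_iff)
qed

sublocale Q: linear_involution Q "(`) f"
proof -
  have rep: "\<exists>v\<in>carrier V. A = N +> v" if "A \<in> carrier Q" for A
    using that by (auto simp: Q_carrier)
  note f_rules = f.F_closed f.F_add f.F_smult f.F_F
  have "linear_involution_axioms Q ((`) f)"
  proof
    fix A assume "A \<in> carrier Q"
    then obtain v where v: "v \<in> carrier V" "A = N +> v" using rep by blast
    show "f ` A \<in> carrier Q" "f ` (f ` A) = A"
      by (simp_all only: v image_coset f_rules coset_in_Q)
    show "f ` (c \<odot>\<^bsub>Q\<^esub> A) = c \<odot>\<^bsub>Q\<^esub> f ` A" for c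
      by (simp only: v image_coset f_rules Q_smult V_rules(1))
    fix B assume "B \<in> carrier Q"
    then obtain w where w: "w \<in> carrier V" "B = N +> w" using rep by blast
    show "f ` (A \<oplus>\<^bsub>Q\<^esub> B) = f ` A \<oplus>\<^bsub>Q\<^esub> f ` B"
      by (simp only: v w image_coset f_rules Q_add a_closed)
  qed
  thus "linear_involution Q ((`) f)" using vectorspace_Q by (simp add: linear_involution_def)
qed

lemma induces_automorphism: "induces_automorphism V N f"
proof -
  have "mod_hom class_ring Q Q ((`) f)"
    by unfold_locales (auto simp: module_hom_def Q.F_closed Q.F_add Q.F_smult)
  hence "linear_map class_ring Q Q ((`) f)"
    using vectorspace_Q by (simp add: linear_map_def)
  moreover have "bij_betw ((`) f) (carrier Q) (carrier Q)"
    by (rule bij_betwI[of _ _ _ "(`) f"]) (auto simp: Q.F_closed Q.F_F)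
  ultimately show ?thesis using image_coset by (simp add: induces_automorphism_def)
qed

lemma eigenspace_memD:
  assumes A: "A \<in> eigenspace Q ((`) f) s" and s: "s * s = 1" and x: "x \<in> A"
  shows "x \<in> carrier V" and "f x \<oplus> (- s) \<odot> x \<in> N"
proof -
  obtain v where v: "v \<in> carrier V" "A = N +> v" using A by (auto simp: eigenspace_def Q_carrier)
  show xV: "x \<in> carrier V" using x v N_rules(1) by (auto simp: mem_coset_iff)
  have Ax: "A = N +> x" using N.a_repr_independence'[of x v] x v by simp
  have "f ` A = s \<odot>\<^bsub>Q\<^esub> A" using A by (simp add: eigenspace_def)
  hence "N +> f x = N +> (s \<odot> x)" using Ax xV by (simp add: image_coset Q_smult)
  hence "f x \<oplus> (-1) \<odot> (s \<odot> x) \<in> N"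
    using xV f.F_closed[OF xV] V_rules(1)[OF xV] by (simp add: coset_eq_iff)
  thus "f x \<oplus> (- s) \<odot> x \<in> N" using V_rules(4)[OF xV, of "-1" s] by simp
qed

lemma eigenspace_basis:
  assumes s: "s = 1 \<or> s = -1"
    and x: "x \<in> carrier V" "f x = s \<odot> x" and y: "y \<in> carrier V" "f y = s \<odot> y"
    and z: "z \<in> carrier V" "f z = (- s) \<odot> z" and w: "w \<in> carrier V" "f w = (- s) \<odot> w"
    and span: "\<And>v. v \<in> carrier V \<Longrightarrow> \<exists>n\<in>N. \<exists>a b c d. v = n \<oplus> ((a \<odot> x \<oplus> b \<odot> y) \<oplus> (c \<odot> z \<oplus> d \<odot> w))"
    and indep: "\<And>a b c d. (a \<odot> x \<oplus> b \<odot> y) \<oplus> (c \<odot> z \<oplus> d \<odot> w) \<in> N \<Longrightarrow> a = 0 \<and> b = 0 \<and> c = 0 \<and> d = 0"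
  shows "is_basis2 Q (eigenspace Q ((`) f) s) (N +> x) (N +> y)"
proof -
  define comb where "comb = (\<lambda>a b c d. (a \<odot> x \<oplus> b \<odot> y) \<oplus> (c \<odot> z \<oplus> d \<odot> w))"
  note cl = V_rules(1)[OF x(1)] V_rules(1)[OF y(1)] V_rules(1)[OF z(1)] V_rules(1)[OF w(1)]
  have comb_closed: "comb a b c d \<in> carrier V" for a b c d unfolding comb_def using cl by simp
  have comb: "(a \<odot>\<^bsub>Q\<^esub> (N +> x) \<oplus>\<^bsub>Q\<^esub> b \<odot>\<^bsub>Q\<^esub> (N +> y)) \<oplus>\<^bsub>Q\<^esub> (c \<odot>\<^bsub>Q\<^esub> (N +> z) \<oplus>\<^bsub>Q\<^esub> d \<odot>\<^bsub>Q\<^esub> (N +> w)) = N +> comb a b c d" for a b c d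
    unfolding comb_def using x(1) y(1) z(1) w(1) cl by (simp add: Q_add Q_smult)
  show ?thesis
  proof (rule Q.is_basis2_eigenspace[OF s, where Z = "N +> z" and W = "N +> w"])
    fix A assume "A \<in> carrier Q"
    then obtain v where v: "v \<in> carrier V" "A = N +> v" by (auto simp: Q_carrier)
    obtain n a b c d where n: "n \<in> N" "v = n \<oplus> comb a b c d" using span[OF v(1)] unfolding comb_def by blast
    hence "v \<in> N +> comb a b c d" using comb_closed by (auto simp: mem_coset_iff)
    hence "A = N +> comb a b c d" using N.a_repr_independence' comb_closed v(2) by metis
    thus "\<exists>a b c d. A = (a \<odot>\<^bsub>Q\<^esub> (N +> x) \<oplus>\<^bsub>Q\<^esub> b \<odot>\<^bsub>Q\<^esub> (N +> y)) \<oplus>\<^bsub>Q\<^esub> (c \<odot>\<^bsub>Q\<^esub> (N +> z) \<oplus>\<^bsub>Q\<^esub> d \<odot>\<^bsub>Q\<^esub> (N +> w))"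
      unfolding comb by blast
  next
    fix a b c d
    assume "(a \<odot>\<^bsub>Q\<^esub> (N +> x) \<oplus>\<^bsub>Q\<^esub> b \<odot>\<^bsub>Q\<^esub> (N +> y)) \<oplus>\<^bsub>Q\<^esub> (c \<odot>\<^bsub>Q\<^esub> (N +> z) \<oplus>\<^bsub>Q\<^esub> d \<odot>\<^bsub>Q\<^esub> (N +> w)) = \<zero>\<^bsub>Q\<^esub>"
    hence "N +> comb a b c d = N" unfolding comb by (simp add: quot_module_def)
    hence "comb a b c d \<in> N" using N.a_rcos_self[OF comb_closed] by metis
    thus "a = 0 \<and> b = 0 \<and> c = 0 \<and> d = 0" unfolding comb_def by (rule indep)
  qed (use x y z w in \<open>simp_all add: coset_in_Q image_coset Q_smult\<close>)
qed

end

section \<open>The twisted cohomology groups\<close>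

lemma mero_forms_simps:
  "carrier (mero_forms \<tau>) = mero_functions \<tau>"
  "f \<oplus>\<^bsub>mero_forms \<tau>\<^esub> g = (\<lambda>u. f u + g u)"
  "c \<odot>\<^bsub>mero_forms \<tau>\<^esub> f = (\<lambda>u. c * f u)"
  "\<zero>\<^bsub>mero_forms \<tau>\<^esub> = (\<lambda>_. 0)"
  by (simp_all add: mero_forms_def)

lemma nabla_linear:
  assumes "Im \<tau> > 0" "f \<in> mero_functions \<tau>" "g \<in> mero_functions \<tau>"
  shows "nabla \<tau> \<alpha> \<beta> \<gamma> (\<lambda>u. f u + c * g u) = (\<lambda>u. nabla \<tau> \<alpha> \<beta> \<gamma> f u + c * nabla \<tau> \<alpha> \<beta> \<gamma> g u)"
  unfolding nabla_conv_twisted_deriv by (rule twisted_deriv_linear[OF assms])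

lemma nabla_zero: "nabla \<tau> \<alpha> \<beta> \<gamma> (\<lambda>_. 0) = (\<lambda>_. 0)"
  by (simp add: nabla_def on_M_def)

text \<open>
  Pullback commutes with \<open>d\<close>, and it fixes the form \<open>\<omega>\<close>, whose coefficient is odd. Hence it preserves exact forms.
\<close>
lemma iota_pullback_nabla:
  assumes tau: "Im \<tau> > 0" and f: "f \<in> mero_functions \<tau>"
  shows "iota_pullback (nabla \<tau> \<alpha> \<beta> \<gamma> f) = nabla \<tau> \<alpha> \<beta> \<gamma> (\<lambda>u. f (- u))"
proof
  fix u
  show "iota_pullback (nabla \<tau> \<alpha> \<beta> \<gamma> f) u = nabla \<tau> \<alpha> \<beta> \<gamma> (\<lambda>u. f (- u)) u"
  proof (cases "u \<in> D_lift \<tau>")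
    case False
    hence "(f has_field_derivative deriv f (- u)) (at (- u))"
      using mero_functionsD(1)[OF tau f]
      by (intro analytic_derivI) (auto intro: analytic_on_subset simp: D_lift_uminus_iff tau)
    hence "((\<lambda>u. f (- u)) has_field_derivative deriv f (- u) * (- 1)) (at u)"
      by (rule DERIV_chain2[where f = f and g = uminus]) (auto intro!: derivative_eq_intros)
    hence "deriv (\<lambda>u. f (- u)) u = - deriv f (- u)" by (intro DERIV_imp_deriv) simp
    thus ?thesis using False by (simp add: iota_pullback_def nabla_def D_lift_uminus_iff tau omega_odd)
  qed (simp_all add: iota_pullback_def nabla_def on_M_def D_lift_uminus_iff tau)
qed

context
  fixes \<tau> :: complex
  assumes tau: "Im \<tau> > 0"
begin

lemma vectorspace_mero_forms: "vectorspace (class_ring :: complex ring) (mero_forms \<tau>)"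
proof (rule vs_criteria)
  show "field (class_ring :: complex ring)" by (rule class_field)
  show "\<forall>f\<in>carrier (mero_forms \<tau>). \<exists>g\<in>carrier (mero_forms \<tau>). f \<oplus>\<^bsub>mero_forms \<tau>\<^esub> g = \<zero>\<^bsub>mero_forms \<tau>\<^esub>"
  proof
    fix f assume "f \<in> carrier (mero_forms \<tau>)"
    hence "(\<lambda>u. (-1) * f u) \<in> carrier (mero_forms \<tau>)"
      by (simp only: mero_forms_simps mero_functions_cmult tau)
    thus "\<exists>g\<in>carrier (mero_forms \<tau>). f \<oplus>\<^bsub>mero_forms \<tau>\<^esub> g = \<zero>\<^bsub>mero_forms \<tau>\<^esub>"
      by (intro bexI[of _ "\<lambda>u. (-1) * f u"]) (simp_all add: mero_forms_simps)
  qed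
qed (auto simp: mero_forms_simps algebra_simps mero_functions_zero mero_functions_add mero_functions_cmult tau)

lemma iota_pullback_in_mero_functions:
  "f \<in> mero_functions \<tau> \<Longrightarrow> iota_pullback f \<in> mero_functions \<tau>"
  using mero_functions_cmult[OF tau mero_functions_reflect[OF tau], of f "-1"]
  by (simp add: iota_pullback_def)

lemma linear_involution_iota_pullback: "linear_involution (mero_forms \<tau>) iota_pullback"
proof -
  have "linear_involution_axioms (mero_forms \<tau>) iota_pullback"
    by (rule linear_involution_axioms.intro)
       (simp_all add: mero_forms_simps iota_pullback_in_mero_functions, simp_all add: iota_pullback_def fun_eq_iff)
  thus ?thesis using vectorspace_mero_forms by (simp add: linear_involution_def)
qed

lemma submodule_exact_forms: "submodule (class_ring :: complex ring) (exact_forms \<tau> \<alpha> \<beta> \<gamma>) (mero_forms \<tau>)"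
proof (rule LinearCombinations.submodule.intro)
  show "module (class_ring :: complex ring) (mero_forms \<tau>)"
    using vectorspace_mero_forms by (simp add: vectorspace_def)
  show "exact_forms \<tau> \<alpha> \<beta> \<gamma> \<subseteq> carrier (mero_forms \<tau>)"
    by (auto simp: exact_forms_def mero_forms_simps nabla_in_mero_functions tau)
  show "\<zero>\<^bsub>mero_forms \<tau>\<^esub> \<in> exact_forms \<tau> \<alpha> \<beta> \<gamma>"
    using imageI[OF mero_functions_zero[OF tau], of "nabla \<tau> \<alpha> \<beta> \<gamma>"]
    by (simp add: mero_forms_simps exact_forms_def nabla_zero)
next
  fix v w assume "v \<in> exact_forms \<tau> \<alpha> \<beta> \<gamma>" "w \<in> exact_forms \<tau> \<alpha> \<beta> \<gamma>"
  then obtain f g where fg: "f \<in> mero_functions \<tau>" "g \<in> mero_functions \<tau>"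
      "v = nabla \<tau> \<alpha> \<beta> \<gamma> f" "w = nabla \<tau> \<alpha> \<beta> \<gamma> g"
    by (auto simp: exact_forms_def)
  hence "v \<oplus>\<^bsub>mero_forms \<tau>\<^esub> w = nabla \<tau> \<alpha> \<beta> \<gamma> (\<lambda>u. f u + 1 * g u)"
    unfolding nabla_linear[OF tau fg(1,2)] by (simp add: mero_forms_simps)
  moreover have "(\<lambda>u. f u + 1 * g u) \<in> mero_functions \<tau>"
    by (intro mero_functions_add mero_functions_cmult fg tau)
  ultimately show "v \<oplus>\<^bsub>mero_forms \<tau>\<^esub> w \<in> exact_forms \<tau> \<alpha> \<beta> \<gamma>" by (auto simp: exact_forms_def)
next
  fix c :: complex and v assume "v \<in> exact_forms \<tau> \<alpha> \<beta> \<gamma>"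
  then obtain f where f: "f \<in> mero_functions \<tau>" "v = nabla \<tau> \<alpha> \<beta> \<gamma> f" by (auto simp: exact_forms_def)
  have "c \<odot>\<^bsub>mero_forms \<tau>\<^esub> v = nabla \<tau> \<alpha> \<beta> \<gamma> (\<lambda>u. 0 + c * f u)"
    unfolding nabla_linear[OF tau mero_functions_zero[OF tau] f(1)] by (simp add: nabla_zero f(2) mero_forms_simps)
  moreover have "(\<lambda>u. 0 + c * f u) \<in> mero_functions \<tau>"
    by (intro mero_functions_add mero_functions_cmult mero_functions_zero f tau)
  ultimately show "c \<odot>\<^bsub>mero_forms \<tau>\<^esub> v \<in> exact_forms \<tau> \<alpha> \<beta> \<gamma>" by (auto simp: exact_forms_def)
qed

lemma quotient_involution_iota_pullback:
  "quotient_involution (mero_forms \<tau>) (exact_forms \<tau> \<alpha> \<beta> \<gamma>) iota_pullback"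
proof -
  have "quotient_space (mero_forms \<tau>) (exact_forms \<tau> \<alpha> \<beta> \<gamma>)"
    using vectorspace_mero_forms submodule_exact_forms
    by (simp add: quotient_space_def quotient_space_axioms_def)
  moreover have "iota_pullback n \<in> exact_forms \<tau> \<alpha> \<beta> \<gamma>" if "n \<in> exact_forms \<tau> \<alpha> \<beta> \<gamma>" for n
    using that iota_pullback_nabla[OF tau] mero_functions_reflect[OF tau] by (auto simp: exact_forms_def)
  ultimately show ?thesis using linear_involution_iota_pullback
    by (simp add: quotient_involution_def quotient_involution_axioms_def)
qed

lemma H1_eigenspace_bases:
  assumes nonint: "2 * \<alpha> \<notin> \<int>" "2 * \<gamma> - 2 * \<alpha> \<notin> \<int>" "- 2 * \<beta> \<notin> \<int>" "2 * \<beta> - 2 * \<gamma> \<notin> \<int>"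
  shows "is_basis2 (H1 \<tau> \<alpha> \<beta> \<gamma>) (H1_eig \<tau> \<alpha> \<beta> \<gamma> (-1)) (cls \<tau> \<alpha> \<beta> \<gamma> (phi1 \<tau>)) (cls \<tau> \<alpha> \<beta> \<gamma> (phi2 \<tau>))"
    and "is_basis2 (H1 \<tau> \<alpha> \<beta> \<gamma>) (H1_eig \<tau> \<alpha> \<beta> \<gamma> 1) (cls \<tau> \<alpha> \<beta> \<gamma> (phi3 \<tau>)) (cls \<tau> \<alpha> \<beta> \<gamma> (phi4 \<tau>))"
proof -
  interpret quotient_involution "mero_forms \<tau>" "exact_forms \<tau> \<alpha> \<beta> \<gamma>" iota_pullback
    by (rule quotient_involution_iota_pullback)
  define W where "W = omega \<tau> \<alpha> \<beta> \<gamma>"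
  note W = omega_on_M[OF tau, of \<alpha> \<beta> \<gamma>] omega_lcoeff(1)[OF tau, of _ _ \<alpha> \<beta> \<gamma>] omega_residue_not_Ints[OF tau nonint]
  have carrier: "phi1 \<tau> \<in> carrier (mero_forms \<tau>)" "phi2 \<tau> \<in> carrier (mero_forms \<tau>)"
    "phi3 \<tau> \<in> carrier (mero_forms \<tau>)" "phi4 \<tau> \<in> carrier (mero_forms \<tau>)"
    using phi1_in_mero_functions[OF tau] phi_in_mero_functions[OF tau] by (simp_all add: mero_forms_simps)
  have iota: "iota_pullback (phi1 \<tau>) = (-1) \<odot>\<^bsub>mero_forms \<tau>\<^esub> phi1 \<tau>"
    "iota_pullback (phi2 \<tau>) = (-1) \<odot>\<^bsub>mero_forms \<tau>\<^esub> phi2 \<tau>"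
    "iota_pullback (phi3 \<tau>) = 1 \<odot>\<^bsub>mero_forms \<tau>\<^esub> phi3 \<tau>"
    "iota_pullback (phi4 \<tau>) = 1 \<odot>\<^bsub>mero_forms \<tau>\<^esub> phi4 \<tau>"
    by (simp_all add: iota_pullback_def mero_forms_simps phi_odd_even[OF tau])
  have span: "\<exists>n\<in>exact_forms \<tau> \<alpha> \<beta> \<gamma>. \<exists>a b c d. v = (\<lambda>u. n u + phi_comb \<tau> a b c d u)"
    if v: "v \<in> carrier (mero_forms \<tau>)" for v
  proof -
    have v': "v \<in> mero_functions \<tau>" using v by (simp only: mero_forms_simps)
    obtain f a b c d where "f \<in> mero_functions \<tau>"
        "v = (\<lambda>u. twisted_deriv \<tau> (omega \<tau> \<alpha> \<beta> \<gamma>) f u + phi_comb \<tau> a b c d u)"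
      by (rule twisted_cohomology_span[OF tau W(1) _ _ v']) (erule (1) W(2), erule W(3), rule that)
    thus ?thesis unfolding exact_forms_def nabla_conv_twisted_deriv by blast
  qed
  have indep: "a = 0 \<and> b = 0 \<and> c = 0 \<and> d = 0" if exact: "phi_comb \<tau> a b c d \<in> exact_forms \<tau> \<alpha> \<beta> \<gamma>" for a b c d
  proof -
    obtain f where f: "f \<in> mero_functions \<tau>" "phi_comb \<tau> a b c d = twisted_deriv \<tau> (omega \<tau> \<alpha> \<beta> \<gamma>) f"
      using exact unfolding exact_forms_def nabla_conv_twisted_deriv by blast
    show ?thesis by (rule twisted_cohomology_independent[OF tau W f(1) f(2)[symmetric]])
  qed
  have comb12: "(a \<odot>\<^bsub>mero_forms \<tau>\<^esub> phi1 \<tau> \<oplus>\<^bsub>mero_forms \<tau>\<^esub> b \<odot>\<^bsub>mero_forms \<tau>\<^esub> phi2 \<tau>) \<oplus>\<^bsub>mero_forms \<tau>\<^esub>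
       (c \<odot>\<^bsub>mero_forms \<tau>\<^esub> phi3 \<tau> \<oplus>\<^bsub>mero_forms \<tau>\<^esub> d \<odot>\<^bsub>mero_forms \<tau>\<^esub> phi4 \<tau>) = phi_comb \<tau> a b c d" for a b c d
    by (simp add: mero_forms_simps phi_comb_def[abs_def] add_ac)
  have comb34: "(a \<odot>\<^bsub>mero_forms \<tau>\<^esub> phi3 \<tau> \<oplus>\<^bsub>mero_forms \<tau>\<^esub> b \<odot>\<^bsub>mero_forms \<tau>\<^esub> phi4 \<tau>) \<oplus>\<^bsub>mero_forms \<tau>\<^esub>
       (c \<odot>\<^bsub>mero_forms \<tau>\<^esub> phi1 \<tau> \<oplus>\<^bsub>mero_forms \<tau>\<^esub> d \<odot>\<^bsub>mero_forms \<tau>\<^esub> phi2 \<tau>) = phi_comb \<tau> c d a b" for a b c d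
    by (simp add: mero_forms_simps phi_comb_def[abs_def] add_ac)
  show "is_basis2 (H1 \<tau> \<alpha> \<beta> \<gamma>) (H1_eig \<tau> \<alpha> \<beta> \<gamma> (-1)) (cls \<tau> \<alpha> \<beta> \<gamma> (phi1 \<tau>)) (cls \<tau> \<alpha> \<beta> \<gamma> (phi2 \<tau>))"
    unfolding H1_def H1_eig_def cls_def
  proof (rule eigenspace_basis[where z = "phi3 \<tau>" and w = "phi4 \<tau>"], goal_cases)
    case (10 v)
    show ?case unfolding comb12 using span[OF 10] by (simp add: mero_forms_simps(2))
  next
    case (11 a b c d)
    thus ?case unfolding comb12 by (rule indep)
  qed (use carrier iota in simp_all)
  show "is_basis2 (H1 \<tau> \<alpha> \<beta> \<gamma>) (H1_eig \<tau> \<alpha> \<beta> \<gamma> 1) (cls \<tau> \<alpha> \<beta> \<gamma> (phi3 \<tau>)) (cls \<tau> \<alpha> \<beta> \<gamma> (phi4 \<tau>))"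
    unfolding H1_def H1_eig_def cls_def
  proof (rule eigenspace_basis[where z = "phi1 \<tau>" and w = "phi2 \<tau>"], goal_cases)
    case (10 v)
    show ?case unfolding comb34 using span[OF 10] by (simp add: mero_forms_simps(2)) blast
  next
    case (11 a b c d)
    hence "c = 0 \<and> d = 0 \<and> a = 0 \<and> b = 0" unfolding comb34 by (rule indep)
    thus ?case by simp
  qed (use carrier iota in simp_all)
qed

text \<open>
  Given \<open>\<iota>\<^sup>*\<phi> - s\<phi> = \<nabla>G\<close>, the average \<open>\<phi>' = (\<phi> + s \<iota>\<^sup>*\<phi>)/2\<close> is a true eigenvector, and \<open>\<phi> = \<phi>' - (s/2) \<nabla>G\<close>. The sign in
  the parity of \<open>\<phi>'\<close> comes from \<open>d(- u) = - du\<close>.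
\<close>
lemma H1_eig_representative:
  assumes A: "A \<in> H1_eig \<tau> \<alpha> \<beta> \<gamma> s" and s: "s * s = 1" and \<phi>: "\<phi> \<in> A"
  obtains \<phi>' F where "\<phi>' \<in> mero_functions \<tau>" "F \<in> mero_functions \<tau>"
    "\<And>u. \<phi>' (- u) = - s * \<phi>' u" "\<phi> = (\<lambda>u. \<phi>' u + nabla \<tau> \<alpha> \<beta> \<gamma> F u)"
proof -
  interpret quotient_involution "mero_forms \<tau>" "exact_forms \<tau> \<alpha> \<beta> \<gamma>" iota_pullback
    by (rule quotient_involution_iota_pullback)
  have 1: "\<phi> \<in> mero_functions \<tau>" "(\<lambda>u. iota_pullback \<phi> u + (- s) * \<phi> u) \<in> exact_forms \<tau> \<alpha> \<beta> \<gamma>"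
    using eigenspace_memD[OF A[unfolded H1_eig_def H1_def] s \<phi>] by (simp_all only: mero_forms_simps)
  then obtain G where G: "G \<in> mero_functions \<tau>" "(\<lambda>u. iota_pullback \<phi> u + (- s) * \<phi> u) = nabla \<tau> \<alpha> \<beta> \<gamma> G"
    by (auto simp: exact_forms_def)
  define \<phi>' where "\<phi>' = (\<lambda>u. 1/2 * (\<phi> u + s * iota_pullback \<phi> u))"
  define F where "F = (\<lambda>u. 0 + (- s/2) * G u)"
  have "nabla \<tau> \<alpha> \<beta> \<gamma> F = (\<lambda>u. (- s/2) * nabla \<tau> \<alpha> \<beta> \<gamma> G u)"
    unfolding F_def nabla_linear[OF tau mero_functions_zero[OF tau] G(1)] by (simp add: nabla_zero)
  also have "\<dots> = (\<lambda>u. (- s/2) * (iota_pullback \<phi> u + (- s) * \<phi> u))" unfolding G(2)[symmetric] ..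
  also have "\<dots> = (\<lambda>u. 1/2 * ((s * s) * \<phi> u) - 1/2 * (s * iota_pullback \<phi> u))"
    by (simp add: fun_eq_iff algebra_simps)
  finally have "nabla \<tau> \<alpha> \<beta> \<gamma> F = (\<lambda>u. 1/2 * \<phi> u - 1/2 * (s * iota_pullback \<phi> u))" by (simp add: s)
  hence "\<phi> = (\<lambda>u. \<phi>' u + nabla \<tau> \<alpha> \<beta> \<gamma> F u)" by (simp add: fun_eq_iff \<phi>'_def field_simps)
  moreover have "\<phi>' \<in> mero_functions \<tau>" unfolding \<phi>'_def
    by (intro mero_functions_cmult mero_functions_add iota_pullback_in_mero_functions 1 tau)
  moreover have "F \<in> mero_functions \<tau>" unfolding F_def
    by (intro mero_functions_cmult mero_functions_add mero_functions_zero G tau)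
  moreover have "\<phi>' (- u) = - s * \<phi>' u" for u
  proof -
    have "- s * \<phi>' u = 1/2 * ((s * s) * \<phi> (- u) - s * \<phi> u)"
      by (simp add: \<phi>'_def iota_pullback_def algebra_simps)
    thus ?thesis by (simp only: s) (simp add: \<phi>'_def iota_pullback_def)
  qed
  ultimately show ?thesis using that by blast
qed

lemma H1_eig_nonempty: "A \<in> H1_eig \<tau> \<alpha> \<beta> \<gamma> s \<Longrightarrow> A \<noteq> {}"
proof -
  interpret quotient_involution "mero_forms \<tau>" "exact_forms \<tau> \<alpha> \<beta> \<gamma>" iota_pullback
    by (rule quotient_involution_iota_pullback)
  show "A \<in> H1_eig \<tau> \<alpha> \<beta> \<gamma> s \<Longrightarrow> A \<noteq> {}"
    using N.a_rcos_self unfolding H1_eig_def H1_def eigenspace_def Q_carrier by blast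
qed

end

lemma dual_conv_minus_parameters:
  "exact_forms_dual \<tau> \<alpha> \<beta> \<gamma> = exact_forms \<tau> (- \<alpha>) (- \<beta>) (- \<gamma>)"
  "H1_dual \<tau> \<alpha> \<beta> \<gamma> = H1 \<tau> (- \<alpha>) (- \<beta>) (- \<gamma>)"
  "cls_dual \<tau> \<alpha> \<beta> \<gamma> = cls \<tau> (- \<alpha>) (- \<beta>) (- \<gamma>)"
  "H1_dual_eig \<tau> \<alpha> \<beta> \<gamma> = H1_eig \<tau> (- \<alpha>) (- \<beta>) (- \<gamma>)"
  by (simp_all add: exact_forms_dual_def exact_forms_def nabla_dual_conv_nabla H1_dual_def H1_def
       cls_dual_def[abs_def] cls_def[abs_def] H1_dual_eig_def[abs_def] H1_eig_def[abs_def])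

text \<open>
  The value of the form on classes is a definite description; it denotes \<open>0\<close> because all representatives give \<open>0\<close> and
  there are representatives.
\<close>
lemma ch_form_opposite_eigenspaces:
  assumes tau: "Im \<tau> > 0"
    and nonint: "2 * \<alpha> \<notin> \<int>" "2 * \<gamma> - 2 * \<alpha> \<notin> \<int>" "- 2 * \<beta> \<notin> \<int>" "2 * \<beta> - 2 * \<gamma> \<notin> \<int>"
    and s: "s * s = 1"
    and A: "A \<in> H1_eig \<tau> \<alpha> \<beta> \<gamma> s" and B: "B \<in> H1_dual_eig \<tau> \<alpha> \<beta> \<gamma> (- s)"
  shows "ch_form \<tau> \<alpha> \<beta> \<gamma> A B = 0"
proof -
  note B' = B[unfolded dual_conv_minus_parameters]
  have zero: "intersection_number \<tau> \<alpha> \<beta> \<gamma> \<phi> \<psi> = 0" if \<phi>: "\<phi> \<in> A" and \<psi>: "\<psi> \<in> B" for \<phi> \<psi>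
  proof -
    have s': "(- s) * (- s) = 1" using s by simp
    obtain \<phi>' F where 1: "\<phi>' \<in> mero_functions \<tau>" "F \<in> mero_functions \<tau>"
      "\<And>u. \<phi>' (- u) = - s * \<phi>' u" "\<phi> = (\<lambda>u. \<phi>' u + nabla \<tau> \<alpha> \<beta> \<gamma> F u)"
      using H1_eig_representative[OF tau A s \<phi>] by blast
    obtain \<psi>' G where 2: "\<psi>' \<in> mero_functions \<tau>" "G \<in> mero_functions \<tau>"
      "\<And>u. \<psi>' (- u) = - (- s) * \<psi>' u" "\<psi> = (\<lambda>u. \<psi>' u + nabla_dual \<tau> \<alpha> \<beta> \<gamma> G u)"
      using H1_eig_representative[OF tau B' s' \<psi>] unfolding nabla_dual_conv_nabla by blast
    show ?thesis unfolding 1(4) 2(4)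
      by (rule intersection_number_opposite_parity[OF tau nonint 1(1) 2(1) 1(2) 2(2) 1(3) 2(3) s'])
  qed
  moreover obtain \<phi> \<psi> where "\<phi> \<in> A" "\<psi> \<in> B"
    using H1_eig_nonempty[OF tau A] H1_eig_nonempty[OF tau B'] by blast
  ultimately show ?thesis unfolding ch_form_def by (intro the_equality) auto
qed

theorem proposition3p2:
  fixes \<tau> \<alpha> \<beta> \<gamma> :: complex
  assumes "Im \<tau> > 0"
    and "2 * \<alpha> \<notin> \<int>" and "2 * \<gamma> - 2 * \<alpha> \<notin> \<int>" and "- 2 * \<beta> \<notin> \<int>" and "2 * \<beta> - 2 * \<gamma> \<notin> \<int>"
  shows
    "iota_pullback \<in> carrier (mero_forms \<tau>) \<rightarrow> carrier (mero_forms \<tau>) \<and>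
     (\<forall>\<phi> \<in> carrier (mero_forms \<tau>). iota_pullback (iota_pullback \<phi>) = \<phi>) \<and>
     induces_automorphism (mero_forms \<tau>) (exact_forms \<tau> \<alpha> \<beta> \<gamma>) iota_pullback \<and>
     induces_automorphism (mero_forms \<tau>) (exact_forms_dual \<tau> \<alpha> \<beta> \<gamma>) iota_pullback \<and>
     is_direct_sum (H1 \<tau> \<alpha> \<beta> \<gamma>) (H1_eig \<tau> \<alpha> \<beta> \<gamma> (-1)) (H1_eig \<tau> \<alpha> \<beta> \<gamma> 1) \<and>
     is_direct_sum (H1_dual \<tau> \<alpha> \<beta> \<gamma>) (H1_dual_eig \<tau> \<alpha> \<beta> \<gamma> (-1)) (H1_dual_eig \<tau> \<alpha> \<beta> \<gamma> 1) \<and>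
     is_basis2 (H1 \<tau> \<alpha> \<beta> \<gamma>) (H1_eig \<tau> \<alpha> \<beta> \<gamma> (-1))
       (cls \<tau> \<alpha> \<beta> \<gamma> (phi1 \<tau>)) (cls \<tau> \<alpha> \<beta> \<gamma> (phi2 \<tau>)) \<and>
     is_basis2 (H1_dual \<tau> \<alpha> \<beta> \<gamma>) (H1_dual_eig \<tau> \<alpha> \<beta> \<gamma> (-1))
       (cls_dual \<tau> \<alpha> \<beta> \<gamma> (phi1 \<tau>)) (cls_dual \<tau> \<alpha> \<beta> \<gamma> (phi2 \<tau>)) \<and>
     is_basis2 (H1 \<tau> \<alpha> \<beta> \<gamma>) (H1_eig \<tau> \<alpha> \<beta> \<gamma> 1)
       (cls \<tau> \<alpha> \<beta> \<gamma> (phi3 \<tau>)) (cls \<tau> \<alpha> \<beta> \<gamma> (phi4 \<tau>)) \<and>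
     is_basis2 (H1_dual \<tau> \<alpha> \<beta> \<gamma>) (H1_dual_eig \<tau> \<alpha> \<beta> \<gamma> 1)
       (cls_dual \<tau> \<alpha> \<beta> \<gamma> (phi3 \<tau>)) (cls_dual \<tau> \<alpha> \<beta> \<gamma> (phi4 \<tau>)) \<and>
     (\<forall>A \<in> H1_eig \<tau> \<alpha> \<beta> \<gamma> 1. \<forall>B \<in> H1_dual_eig \<tau> \<alpha> \<beta> \<gamma> (-1). ch_form \<tau> \<alpha> \<beta> \<gamma> A B = 0) \<and>
     (\<forall>A \<in> H1_eig \<tau> \<alpha> \<beta> \<gamma> (-1). \<forall>B \<in> H1_dual_eig \<tau> \<alpha> \<beta> \<gamma> 1. ch_form \<tau> \<alpha> \<beta> \<gamma> A B = 0)"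
proof -
  note tau = assms(1)
  have nonint: "2 * (- \<alpha>) \<notin> \<int>" "2 * (- \<gamma>) - 2 * (- \<alpha>) \<notin> \<int>" "- 2 * (- \<beta>) \<notin> \<int>" "2 * (- \<beta>) - 2 * (- \<gamma>) \<notin> \<int>"
    using assms(2-5) minus_in_Ints_iff[of "2 * \<alpha>"] minus_in_Ints_iff[of "2 * \<gamma> - 2 * \<alpha>"]
      minus_in_Ints_iff[of "2 * \<beta>"] minus_in_Ints_iff[of "2 * \<beta> - 2 * \<gamma>"] by (simp_all add: algebra_simps)
  note involution = quotient_involution_iota_pullback[OF tau]
  have direct: "is_direct_sum (H1 \<tau> a b c) (H1_eig \<tau> a b c (-1)) (H1_eig \<tau> a b c 1)" for a b c
    unfolding H1_def H1_eig_def
  proof -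
    interpret quotient_involution "mero_forms \<tau>" "exact_forms \<tau> a b c" iota_pullback by (rule involution)
    show "is_direct_sum Q (eigenspace Q ((`) iota_pullback) (- 1)) (eigenspace Q ((`) iota_pullback) 1)"
      by (rule Q.is_direct_sum_eigenspaces)
  qed
  have "iota_pullback \<in> carrier (mero_forms \<tau>) \<rightarrow> carrier (mero_forms \<tau>)"
    by (simp add: mero_forms_simps iota_pullback_in_mero_functions tau)
  moreover have "\<forall>\<phi> \<in> carrier (mero_forms \<tau>). iota_pullback (iota_pullback \<phi>) = \<phi>"
    by (simp add: iota_pullback_def)
  ultimately show ?thesis
    using quotient_involution.induces_automorphism[OF involution] direct
      H1_eigenspace_bases[OF tau assms(2-5)] H1_eigenspace_bases[OF tau nonint]
      ch_form_opposite_eigenspaces[OF tau assms(2-5), of 1]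
      ch_form_opposite_eigenspaces[OF tau assms(2-5), of "-1"]
    unfolding dual_conv_minus_parameters by simp
qed

end
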